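(* Assume that $(\Theta,\mathcal H_\Theta)$ is such that $\mathrm{Rd}:\mathcal M(\Omega)\to\mathcal M(\Theta\times\Xi)$ is injective. Let $f=(f_t)_{t\in\mathcal T}\in H^{|\mathcal T|}$ and $\alpha\in[0,\infty)$. Then the minimization problems $$(\mathrm P_\alpha(f))\quad\min_{\gamma\in\mathcal M_+(\Theta\times\Gamma),\ u\in\mathcal M_+(\Omega)^\Sigma}\|\gamma\|_{\mathcal M}+\frac1{2\alpha}\sum_{t\in\mathcal T}\|\mathrm{Ob}_tu_t-f_t\|_H^2\ \text{ s.t. }\overline{\mathrm{Mv}}_t\gamma=\mathrm{Rd}\,u_t\ \forall t\in\Sigma$$ and $$(\mathcal M\text{-}\mathrm P_\alpha(f))\quad\min_{\gamma\in\mathcal M_+(\Theta\times\Gamma),\ u\in\mathcal M_+(\Omega\times\Sigma)}\|\gamma\|_{\mathcal M}+\frac1{2\alpha}\sum_{t\in\mathcal T}\|(\overline{\mathrm{Ob}}u)_t-f_t\|_H^2\ \text{ s.t. }\overline{\mathrm{Mv}}\gamma=\overline{\mathrm{Rd}}u$$ are equivalent in the following sense. (1) If $((u_t)_{t\in\Sigma},\gamma)$ solves $\mathrm P_\alpha(f)$, then $(u,\gamma)$ solves $\mathcal M\text{-}\mathrm P_\alpha(f)$ with $u:=u_t\otimes_t\mathcal H_\Sigma\in\mathcal M_+(\Omega\times\Sigma)$. (2) If $(u,\gamma)$ solves $\mathcal M\text{-}\mathrm P_\alpha(f)$, then $((u_t)_{t\in\Sigma},\gamma)$ solves $\mathrm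 P_\alpha(f)$, where $u=u_t\otimes_t\mathcal H_\Sigma$ is the unique decomposition of $u$ for which $t\mapsto\int_{\Theta\times\Xi}\varphi\,\mathrm d\,\mathrm{Rd}\,u_t$ is continuous for every $\varphi\in C(\Theta\times\Xi)$.
   Context: $\mathcal M(X)$ and $\mathcal M_+(X)$ denote the finite signed and the finite nonnegative Radon measures on $X$, $\|\cdot\|_{\mathcal M}$ the total variation norm, $g_\#\nu$ the pushforward of $\nu$ under $g$. $\mathcal M_+(\Omega)^\Sigma$ is the set of families $(u_t)_{t\in\Sigma}$ with $u_t\in\mathcal M_+(\Omega)$. $d\in\mathbb N$; $\Omega\subset\mathbb R^d$, $\Sigma\subset\mathbb R$ and $\Theta\subset S^{d-1}$ are compact; $\emptyset\ne\mathcal T\subset\Sigma$ is finite; $\mathcal H_\Sigma$ and $\mathcal H_\Theta$ are Borel probability measures on $\Sigma$ and $\Theta$, respectively, with $\operatorname{supp}\mathcal H_\Theta=\Theta$. $\Lambda=\{(x,v)\in\mathbb R^d\times\mathbb R^d: x+tv\in\Omega\ \forall t\in\Sigma\}$, $\Gamma=\{(\theta\cdot x,\theta\cdot v):(x,v)\in\Lambda,\theta\in\Theta\}\subset\mathbb R^2$, $\Xi=\{\theta\cdot x:x\in\Omega,\theta\in\Theta\}\subset\mathbb R$; all are compact. Product notation: for a family $(\nu_z)_{z\in Z}$ of measures on $Y$ with $z\mapsto\nu_z(A)$ measurable for all Borel $A$ and a measure $\omega$ on $Z$, $(\nu_z\otimes_z\omega)(A\times B)=\int_B\nu_z(A)\,\mathrm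 d\omega(z)$ defines a measure on $Y\times Z$; $\omega\otimes_z\nu_z$ is the analogous measure on $Z\times Y$. Operators: $\mathrm{Rd}_\theta\nu=[x\mapsto\theta\cdot x]_\#\nu$, $\mathrm{Rd}\,\nu=\mathcal H_\Theta\otimes_\theta\mathrm{Rd}_\theta\nu$ for $\nu\in\mathcal M(\Omega)$; $\overline{\mathrm{Rd}}_\theta u=[(x,t)\mapsto(\theta\cdot x,t)]_\#u$, $\overline{\mathrm{Rd}}u=\mathcal H_\Theta\otimes_\theta\overline{\mathrm{Rd}}_\theta u\in\mathcal M(\Theta\times\Xi\times\Sigma)$ for $u\in\mathcal M(\Omega\times\Sigma)$; $\overline{\mathrm{Mv}}_t\gamma=[(\theta,x,v)\mapsto(\theta,x+tv)]_\#\gamma$ and $\overline{\mathrm{Mv}}\gamma=\overline{\mathrm{Mv}}_t\gamma\otimes_t\mathcal H_\Sigma$ for $\gamma\in\mathcal M(\Theta\times\Gamma)$. $H$ is a Hilbert space and, for $t\in\mathcal T$, $\mathrm{Ob}_t:\mathcal M(\Omega)\to H$ is the dual of a bounded linear operator $\mathrm{Ob}_t^*:H\to C(\Omega)$. Dynamic observation operator: when $\mathrm{Rd}$ is injective, the source establishes beforehand that every $u\in\mathcal M_+(\Omega\times\Sigma)$ with $\overline{\mathrm{Rd}}u=\overline{\mathrm{Mv}}\gamma$ for some $\gamma\in\mathcal M_+(\Theta\times\Gamma)$ has a unique decomposition $u=u_t\otimes_t\mathcal H_\Sigma$ with $t\mapsto\int_{\Theta\times\Xi}\varphi\,\mathrm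 d\,\mathrm{Rd}\,u_t$ continuous on $\Sigma$ for every $\varphi\in C(\Theta\times\Xi)$; for such $u$ one sets $\overline{\mathrm{Ob}}u=(\mathrm{Ob}_tu_t)_{t\in\mathcal T}$, with $(u_t)_{t\in\Sigma}$ this decomposition. For $\alpha=0$ the data terms are interpreted as the constraints $\mathrm{Ob}_tu_t=f_t$ respectively $(\overline{\mathrm{Ob}}u)_t=f_t$ for all $t\in\mathcal T$.
   Formalization: The formal statement additionally assumes supp H_Σ = Σ; without it (and Ω nonempty) the decomposition of u = 0 is not unique, e.g. Σ={0,1}, H_Σ=δ_0, T={1}, so the dynamic observation operator is undefined. *)

theory Defs
  imports "HOL-Analysis.Analysis" "HOL-Probability.Probability_Measure"
begin

section \<open>Signed and nonnegative measures\<close>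

text \<open>
  A finite signed measure on \<open>X\<close> is represented by its real-valued set function, which is set
  to \<open>0\<close> off the Borel subsets of \<open>X\<close>, so that equality of measures is equality of functions.
  All spaces \<open>X\<close> occurring below are countable unions of compact subsets of Euclidean spaces, on
  which every finite Borel measure is Radon, so regularity is not stated separately. Probability
  measures on parameter spaces, against which functions are integrated, are of the library type
  \<open>measure\<close>.
\<close>

abbreviation borel_on :: "'a::topological_space set \<Rightarrow> 'a measure" where
  "borel_on X \<equiv> restrict_space borel X"

definition signed_measures :: "'a::topological_space set \<Rightarrow> ('a set \<Rightarrow> real) set" where
  "signed_measures X = {\<nu>.
     (\<forall>A. A \<notin> sets (borel_on X) \<longrightarrow> \<nu> A = 0) \<and>
     (\<forall>A :: nat \<Rightarrow> 'a set. range A \<subseteq> sets (borel_on X) \<longrightarrow> disjoint_family A \<longrightarrow>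
        (\<lambda>i. \<nu> (A i)) sums \<nu> (\<Union>i. A i))}"

definition nonneg_measures :: "'a::topological_space set \<Rightarrow> ('a set \<Rightarrow> real) set" where
  "nonneg_measures X = {\<nu> \<in> signed_measures X. \<forall>A. 0 \<le> \<nu> A}"

definition tv_norm :: "'a::topological_space set \<Rightarrow> ('a set \<Rightarrow> real) \<Rightarrow> real" where
  "tv_norm X \<nu> =
     (SUP P \<in> {P. finite P \<and> P \<subseteq> sets (borel_on X) \<and> partition_on X P}. \<Sum>A\<in>P. \<bar>\<nu> A\<bar>)"

text \<open>Upper variation; the lower variation is the upper variation of \<open>- \<nu>\<close>.\<close>

definition upper_variation :: "'a::topological_space set \<Rightarrow> ('a set \<Rightarrow> real) \<Rightarrow> 'a measure" where
  "upper_variation X \<nu> = measure_of X (sets (borel_on X))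
     (\<lambda>A. ennreal (SUP B \<in> {B \<in> sets (borel_on X). B \<subseteq> A}. \<nu> B))"

definition sintegral ::
  "'a::topological_space set \<Rightarrow> ('a set \<Rightarrow> real) \<Rightarrow> ('a \<Rightarrow> real) \<Rightarrow> real" where
  "sintegral X \<nu> \<phi> =
     (\<integral>x. \<phi> x \<partial>upper_variation X \<nu>) - (\<integral>x. \<phi> x \<partial>upper_variation X (\<lambda>A. - \<nu> A))"

definition pushforward ::
  "'a::topological_space set \<Rightarrow> 'b::topological_space set \<Rightarrow> ('a \<Rightarrow> 'b) \<Rightarrow>
     ('a set \<Rightarrow> real) \<Rightarrow> ('b set \<Rightarrow> real)" where
  "pushforward X Y g \<nu> = (\<lambda>B. if B \<in> sets (borel_on Y) then \<nu> (g -` B \<inter> X) else 0)"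

text \<open>
  The products \<open>\<nu>\<^sub>z \<otimes>\<^sub>z \<omega>\<close> on \<open>Y \<times> Z\<close> and \<open>\<omega> \<otimes>\<^sub>z \<nu>\<^sub>z\<close> on \<open>Z \<times> Y\<close>, where \<open>Z = space \<omega>\<close>. The formula
  on rectangles extends to all Borel sets by integrating the sections. It is meaningful only
  for kernels, i.e. if \<open>z \<mapsto> \<nu>\<^sub>z(A)\<close> is measurable for all Borel \<open>A\<close>.
\<close>

definition is_kernel ::
  "'y::topological_space set \<Rightarrow> ('z \<Rightarrow> 'y set \<Rightarrow> real) \<Rightarrow> 'z measure \<Rightarrow> bool" where
  "is_kernel Y \<nu> \<omega> \<longleftrightarrow> (\<forall>A \<in> sets (borel_on Y). (\<lambda>z. \<nu> z A) \<in> borel_measurable \<omega>)"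

definition prod_left ::
  "'y::topological_space set \<Rightarrow> ('z::topological_space \<Rightarrow> 'y set \<Rightarrow> real) \<Rightarrow> 'z measure \<Rightarrow>
     (('y \<times> 'z) set \<Rightarrow> real)" where
  "prod_left Y \<nu> \<omega> = (\<lambda>E. if E \<in> sets (borel_on (Y \<times> space \<omega>))
     then (\<integral>z. \<nu> z {y. (y, z) \<in> E} \<partial>\<omega>) else 0)"

definition prod_right ::
  "'y::topological_space set \<Rightarrow> 'z::topological_space measure \<Rightarrow> ('z \<Rightarrow> 'y set \<Rightarrow> real) \<Rightarrow>
     (('z \<times> 'y) set \<Rightarrow> real)" where
  "prod_right Y \<omega> \<nu> = (\<lambda>E. if E \<in> sets (borel_on (space \<omega> \<times> Y))
     then (\<integral>z. \<nu> z {y. (z, y) \<in> E} \<partial>\<omega>) else 0)"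

definition msupport :: "'a::topological_space measure \<Rightarrow> 'a set" where
  "msupport \<mu> = {x \<in> space \<mu>. \<forall>U. open U \<and> x \<in> U \<longrightarrow> 0 < emeasure \<mu> (U \<inter> space \<mu>)}"

subsection \<open>Consistency with the library type of measures\<close>

lemma measure_in_nonneg_measures:
  assumes "finite_measure \<mu>" "sets \<mu> = sets (borel_on X)"
  shows "measure \<mu> \<in> nonneg_measures X"
proof -
  interpret finite_measure \<mu> by fact
  show ?thesis
    using finite_measure_UNION
    by (auto simp: nonneg_measures_def signed_measures_def measure_notin_sets assms(2)[symmetric])
qed

lemma upper_variation_measure:
  assumes "finite_measure \<mu>" "sets \<mu> = sets (borel_on X)"
  shows "upper_variation X (measure \<mu>) = \<mu>"
proof -
  interpret finite_measure \<mu> by fact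
  have sp: "space \<mu> = X"
    using sets_eq_imp_space_eq[OF assms(2)] by (simp add: space_restrict_space)
  have "(SUP B \<in> {B \<in> sets (borel_on X). B \<subseteq> A}. measure \<mu> B) = measure \<mu> A"
    if "A \<in> sets \<mu>" for A
    using that assms(2) by (intro cSup_eq_maximum) (auto intro!: finite_measure_mono)
  then have "upper_variation X (measure \<mu>) = measure_of X (sets \<mu>) (emeasure \<mu>)"
    unfolding upper_variation_def assms(2)[symmetric]
    using sets.space_closed[of \<mu>]
    by (intro measure_of_eq) (auto simp: sp emeasure_eq_measure sets.sigma_sets_eq[of \<mu>, unfolded sp])
  then show ?thesis
    using measure_of_of_measure[of \<mu>] by (simp add: sp)
qed

lemma upper_variation_uminus_measure:
  assumes "finite_measure \<mu>" "sets \<mu> = sets (borel_on X)"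
  shows "upper_variation X (\<lambda>A. - measure \<mu> A) = null_measure (borel_on X)"
proof -
  have "(SUP B \<in> {B \<in> sets (borel_on X). B \<subseteq> A}. - measure \<mu> B) = 0" for A
    by (intro cSup_eq_maximum) (auto intro!: image_eqI[of _ _ "{}"])
  then show ?thesis
    by (simp add: upper_variation_def null_measure_def space_restrict_space)
qed

lemma sintegral_measure:
  assumes "finite_measure \<mu>" "sets \<mu> = sets (borel_on X)"
  shows "sintegral X (measure \<mu>) \<phi> = (\<integral>x. \<phi> x \<partial>\<mu>)"
  by (simp add: sintegral_def upper_variation_measure[OF assms]
      upper_variation_uminus_measure[OF assms] integral_null_measure)

lemma prod_left_rectangle:
  fixes \<omega> :: "'z::second_countable_topology measure" and Y :: "'y::second_countable_topology set"
  assumes "sets \<omega> = sets (borel_on Z)" "A \<in> sets (borel_on Y)" "B \<in> sets \<omega>" "\<And>z. \<nu> z {} = 0"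
  shows "prod_left Y \<nu> \<omega> (A \<times> B) = (LINT z:B|\<omega>. \<nu> z A)"
proof -
  have sp: "space \<omega> = Z"
    using sets_eq_imp_space_eq[OF assms(1)] by (simp add: space_restrict_space)
  obtain A' B' where "A = Y \<inter> A'" "A' \<in> sets borel" "B = Z \<inter> B'" "B' \<in> sets borel"
    using assms(1-3) by (auto simp: sets_restrict_space)
  then have "A \<times> B = (Y \<times> Z) \<inter> (A' \<times> B')" "A' \<times> B' \<in> sets borel"
    by (auto simp: borel_prod[symmetric])
  then have "A \<times> B \<in> sets (borel_on (Y \<times> Z))"
    unfolding sets_restrict_space by blast
  then show ?thesis
    unfolding prod_left_def sp set_lebesgue_integral_def
    by (auto intro!: Bochner_Integration.integral_cong simp: indicator_def assms(4))
qed

section \<open>Phase space, projections and operators\<close>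

definition Lam :: "(real^'n) set \<Rightarrow> real set \<Rightarrow> ((real^'n) \<times> (real^'n)) set" where
  "Lam \<Omega> \<Sigma> = {(x, v). \<forall>t\<in>\<Sigma>. x + t *\<^sub>R v \<in> \<Omega>}"

definition Gam :: "(real^'n) set \<Rightarrow> real set \<Rightarrow> (real^'n) set \<Rightarrow> (real \<times> real) set" where
  "Gam \<Omega> \<Sigma> \<Theta> = {(\<theta> \<bullet> x, \<theta> \<bullet> v) | x v \<theta>. (x, v) \<in> Lam \<Omega> \<Sigma> \<and> \<theta> \<in> \<Theta>}"

definition Xi :: "(real^'n) set \<Rightarrow> (real^'n) set \<Rightarrow> real set" where
  "Xi \<Omega> \<Theta> = {\<theta> \<bullet> x | x \<theta>. x \<in> \<Omega> \<and> \<theta> \<in> \<Theta>}"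

definition Rd_dir ::
  "(real^'n) set \<Rightarrow> (real^'n) set \<Rightarrow> (real^'n) \<Rightarrow> ((real^'n) set \<Rightarrow> real) \<Rightarrow> (real set \<Rightarrow> real)" where
  "Rd_dir \<Omega> \<Theta> \<theta> = pushforward \<Omega> (Xi \<Omega> \<Theta>) (\<lambda>x. \<theta> \<bullet> x)"

definition Rd ::
  "(real^'n) set \<Rightarrow> (real^'n) set \<Rightarrow> (real^'n) measure \<Rightarrow> ((real^'n) set \<Rightarrow> real) \<Rightarrow>
     (((real^'n) \<times> real) set \<Rightarrow> real)" where
  "Rd \<Omega> \<Theta> H\<Theta> \<nu> = prod_right (Xi \<Omega> \<Theta>) H\<Theta> (\<lambda>\<theta>. Rd_dir \<Omega> \<Theta> \<theta> \<nu>)"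

definition Rd_bar_dir ::
  "(real^'n) set \<Rightarrow> real set \<Rightarrow> (real^'n) set \<Rightarrow> (real^'n) \<Rightarrow>
     (((real^'n) \<times> real) set \<Rightarrow> real) \<Rightarrow> ((real \<times> real) set \<Rightarrow> real)" where
  "Rd_bar_dir \<Omega> \<Sigma> \<Theta> \<theta> = pushforward (\<Omega> \<times> \<Sigma>) (Xi \<Omega> \<Theta> \<times> \<Sigma>) (\<lambda>(x, t). (\<theta> \<bullet> x, t))"

definition Rd_bar ::
  "(real^'n) set \<Rightarrow> real set \<Rightarrow> (real^'n) set \<Rightarrow> (real^'n) measure \<Rightarrow>
     (((real^'n) \<times> real) set \<Rightarrow> real) \<Rightarrow> (((real^'n) \<times> real \<times> real) set \<Rightarrow> real)" where
  "Rd_bar \<Omega> \<Sigma> \<Theta> H\<Theta> u = prod_right (Xi \<Omega> \<Theta> \<times> \<Sigma>) H\<Theta> (\<lambda>\<theta>. Rd_bar_dir \<Omega> \<Sigma> \<Theta> \<theta> u)"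

definition Mv_dir ::
  "(real^'n) set \<Rightarrow> real set \<Rightarrow> (real^'n) set \<Rightarrow> real \<Rightarrow>
     (((real^'n) \<times> real \<times> real) set \<Rightarrow> real) \<Rightarrow> (((real^'n) \<times> real) set \<Rightarrow> real)" where
  "Mv_dir \<Omega> \<Sigma> \<Theta> t =
     pushforward (\<Theta> \<times> Gam \<Omega> \<Sigma> \<Theta>) (\<Theta> \<times> Xi \<Omega> \<Theta>) (\<lambda>(\<theta>, x, v). (\<theta>, x + t * v))"

text \<open>
  The product lives on \<open>(\<Theta> \<times> \<Xi>) \<times> \<Sigma>\<close>; the outer pushforward is the identification with
  \<open>\<Theta> \<times> (\<Xi> \<times> \<Sigma>)\<close>, where the values of \<open>Rd_bar\<close> live.
\<close>

definition Mv_bar ::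
  "(real^'n) set \<Rightarrow> real set \<Rightarrow> (real^'n) set \<Rightarrow> real measure \<Rightarrow>
     (((real^'n) \<times> real \<times> real) set \<Rightarrow> real) \<Rightarrow> (((real^'n) \<times> real \<times> real) set \<Rightarrow> real)" where
  "Mv_bar \<Omega> \<Sigma> \<Theta> H\<Sigma> \<gamma> =
     pushforward ((\<Theta> \<times> Xi \<Omega> \<Theta>) \<times> \<Sigma>) (\<Theta> \<times> Xi \<Omega> \<Theta> \<times> \<Sigma>) (\<lambda>((\<theta>, s), t). (\<theta>, s, t))
       (prod_left (\<Theta> \<times> Xi \<Omega> \<Theta>) (\<lambda>t. Mv_dir \<Omega> \<Sigma> \<Theta> t \<gamma>) H\<Sigma>)"

section \<open>Observation operators\<close>

text \<open>A bounded linear operator \<open>H \<rightarrow> C(X)\<close>; values of its images outside \<open>X\<close> are irrelevant.\<close>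

definition bounded_linear_to_C ::
  "'a::topological_space set \<Rightarrow> ('h::real_normed_vector \<Rightarrow> 'a \<Rightarrow> real) \<Rightarrow> bool" where
  "bounded_linear_to_C X A \<longleftrightarrow>
     (\<forall>h. continuous_on X (A h)) \<and>
     (\<forall>x\<in>X. linear (\<lambda>h. A h x)) \<and>
     (\<exists>K. \<forall>h. \<forall>x\<in>X. \<bar>A h x\<bar> \<le> K * norm h)"

text \<open>\<open>B : M(X) \<rightarrow> H\<close> is the dual of \<open>A : H \<rightarrow> C(X)\<close>, with \<open>H\<close> identified with its dual space.\<close>

definition is_dual_operator ::
  "'a::topological_space set \<Rightarrow> (('a set \<Rightarrow> real) \<Rightarrow> 'h::real_inner) \<Rightarrow>
     ('h \<Rightarrow> 'a \<Rightarrow> real) \<Rightarrow> bool" where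
  "is_dual_operator X B A \<longleftrightarrow>
     (\<forall>\<nu> \<in> signed_measures X. \<forall>h. B \<nu> \<bullet> h = sintegral X \<nu> (A h))"

text \<open>
  \<open>u = u\<^sub>t \<otimes>\<^sub>t H\<Sigma>\<close> with \<open>t \<mapsto> \<integral>\<phi> dRd u\<^sub>t\<close> continuous for all \<open>\<phi> \<in> C(\<Theta> \<times> \<Xi>)\<close>. Families indexed by
  \<open>\<Sigma>\<close> are taken extensional, so that uniqueness refers to the values on \<open>\<Sigma>\<close> only.
  Uniqueness requires \<open>msupport H\<Sigma> = \<Sigma>\<close> (unless \<open>\<Omega>\<close> is empty): adding a continuous nonnegative
  multiple of a point mass on a relatively open \<open>H\<Sigma>\<close>-null subset of \<open>\<Sigma>\<close> changes the family but
  not \<open>u\<close>.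
\<close>

definition is_decomposition ::
  "(real^'n) set \<Rightarrow> real set \<Rightarrow> (real^'n) set \<Rightarrow> real measure \<Rightarrow> (real^'n) measure \<Rightarrow>
     (((real^'n) \<times> real) set \<Rightarrow> real) \<Rightarrow> (real \<Rightarrow> (real^'n) set \<Rightarrow> real) \<Rightarrow> bool" where
  "is_decomposition \<Omega> \<Sigma> \<Theta> H\<Sigma> H\<Theta> u ut \<longleftrightarrow>
     ut \<in> \<Sigma> \<rightarrow>\<^sub>E nonneg_measures \<Omega> \<and>
     is_kernel \<Omega> ut H\<Sigma> \<and>
     u = prod_left \<Omega> ut H\<Sigma> \<and>
     (\<forall>\<phi>. continuous_on (\<Theta> \<times> Xi \<Omega> \<Theta>) \<phi> \<longrightarrow>
        continuous_on \<Sigma> (\<lambda>t. sintegral (\<Theta> \<times> Xi \<Omega> \<Theta>) (Rd \<Omega> \<Theta> H\<Theta> (ut t)) \<phi>))"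

definition decomposition ::
  "(real^'n) set \<Rightarrow> real set \<Rightarrow> (real^'n) set \<Rightarrow> real measure \<Rightarrow> (real^'n) measure \<Rightarrow>
     (((real^'n) \<times> real) set \<Rightarrow> real) \<Rightarrow> (real \<Rightarrow> (real^'n) set \<Rightarrow> real)" where
  "decomposition \<Omega> \<Sigma> \<Theta> H\<Sigma> H\<Theta> u = (THE ut. is_decomposition \<Omega> \<Sigma> \<Theta> H\<Sigma> H\<Theta> u ut)"

definition Ob_bar ::
  "(real^'n) set \<Rightarrow> real set \<Rightarrow> (real^'n) set \<Rightarrow> real measure \<Rightarrow> (real^'n) measure \<Rightarrow>
     (real \<Rightarrow> ((real^'n) set \<Rightarrow> real) \<Rightarrow> 'h) \<Rightarrow> (((real^'n) \<times> real) set \<Rightarrow> real) \<Rightarrow> real \<Rightarrow> 'h" where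
  "Ob_bar \<Omega> \<Sigma> \<Theta> H\<Sigma> H\<Theta> Ob u t = Ob t (decomposition \<Omega> \<Sigma> \<Theta> H\<Sigma> H\<Theta> u t)"

section \<open>The minimization problems\<close>

text \<open>
  \<open>g t\<close> stands for \<open>Ob\<^sub>t u\<^sub>t\<close> and for the \<open>t\<close>-th component of \<open>Ob_bar u\<close>, respectively. For \<open>\<alpha> = 0\<close> the data term is dropped from the objective and
  \<open>g t = f t\<close> becomes part of the feasibility conditions.
\<close>

definition data_constraint ::
  "real \<Rightarrow> real set \<Rightarrow> (real \<Rightarrow> 'h) \<Rightarrow> (real \<Rightarrow> 'h) \<Rightarrow> bool" where
  "data_constraint \<alpha> \<T> f g \<longleftrightarrow> (\<alpha> = 0 \<longrightarrow> (\<forall>t\<in>\<T>. g t = f t))"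

definition objective ::
  "(real^'n) set \<Rightarrow> real set \<Rightarrow> (real^'n) set \<Rightarrow> real \<Rightarrow> real set \<Rightarrow>
     (real \<Rightarrow> 'h::real_normed_vector) \<Rightarrow> (real \<Rightarrow> 'h) \<Rightarrow>
     (((real^'n) \<times> real \<times> real) set \<Rightarrow> real) \<Rightarrow> real" where
  "objective \<Omega> \<Sigma> \<Theta> \<alpha> \<T> f g \<gamma> = tv_norm (\<Theta> \<times> Gam \<Omega> \<Sigma> \<Theta>) \<gamma> +
     (if \<alpha> = 0 then 0 else 1 / (2 * \<alpha>) * (\<Sum>t\<in>\<T>. (norm (g t - f t))\<^sup>2))"

definition P_feasible ::
  "(real^'n) set \<Rightarrow> real set \<Rightarrow> (real^'n) set \<Rightarrow> (real^'n) measure \<Rightarrow>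
     (real \<Rightarrow> ((real^'n) set \<Rightarrow> real) \<Rightarrow> 'h) \<Rightarrow> real \<Rightarrow> real set \<Rightarrow> (real \<Rightarrow> 'h) \<Rightarrow>
     (real \<Rightarrow> (real^'n) set \<Rightarrow> real) \<Rightarrow> (((real^'n) \<times> real \<times> real) set \<Rightarrow> real) \<Rightarrow> bool" where
  "P_feasible \<Omega> \<Sigma> \<Theta> H\<Theta> Ob \<alpha> \<T> f ut \<gamma> \<longleftrightarrow>
     \<gamma> \<in> nonneg_measures (\<Theta> \<times> Gam \<Omega> \<Sigma> \<Theta>) \<and>
     ut \<in> \<Sigma> \<rightarrow>\<^sub>E nonneg_measures \<Omega> \<and>
     (\<forall>t\<in>\<Sigma>. Mv_dir \<Omega> \<Sigma> \<Theta> t \<gamma> = Rd \<Omega> \<Theta> H\<Theta> (ut t)) \<and>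
     data_constraint \<alpha> \<T> f (\<lambda>t. Ob t (ut t))"

definition P_solves ::
  "(real^'n) set \<Rightarrow> real set \<Rightarrow> (real^'n) set \<Rightarrow> (real^'n) measure \<Rightarrow>
     (real \<Rightarrow> ((real^'n) set \<Rightarrow> real) \<Rightarrow> 'h::real_normed_vector) \<Rightarrow> real \<Rightarrow> real set \<Rightarrow>
     (real \<Rightarrow> 'h) \<Rightarrow>
     (real \<Rightarrow> (real^'n) set \<Rightarrow> real) \<Rightarrow> (((real^'n) \<times> real \<times> real) set \<Rightarrow> real) \<Rightarrow> bool" where
  "P_solves \<Omega> \<Sigma> \<Theta> H\<Theta> Ob \<alpha> \<T> f ut \<gamma> \<longleftrightarrow>
     P_feasible \<Omega> \<Sigma> \<Theta> H\<Theta> Ob \<alpha> \<T> f ut \<gamma> \<and>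
     (\<forall>ut' \<gamma>'. P_feasible \<Omega> \<Sigma> \<Theta> H\<Theta> Ob \<alpha> \<T> f ut' \<gamma>' \<longrightarrow>
        objective \<Omega> \<Sigma> \<Theta> \<alpha> \<T> f (\<lambda>t. Ob t (ut t)) \<gamma>
          \<le> objective \<Omega> \<Sigma> \<Theta> \<alpha> \<T> f (\<lambda>t. Ob t (ut' t)) \<gamma>')"

definition MP_feasible ::
  "(real^'n) set \<Rightarrow> real set \<Rightarrow> (real^'n) set \<Rightarrow> real measure \<Rightarrow> (real^'n) measure \<Rightarrow>
     (real \<Rightarrow> ((real^'n) set \<Rightarrow> real) \<Rightarrow> 'h) \<Rightarrow> real \<Rightarrow> real set \<Rightarrow> (real \<Rightarrow> 'h) \<Rightarrow>
     (((real^'n) \<times> real) set \<Rightarrow> real) \<Rightarrow> (((real^'n) \<times> real \<times> real) set \<Rightarrow> real) \<Rightarrow> bool" where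
  "MP_feasible \<Omega> \<Sigma> \<Theta> H\<Sigma> H\<Theta> Ob \<alpha> \<T> f u \<gamma> \<longleftrightarrow>
     \<gamma> \<in> nonneg_measures (\<Theta> \<times> Gam \<Omega> \<Sigma> \<Theta>) \<and>
     u \<in> nonneg_measures (\<Omega> \<times> \<Sigma>) \<and>
     Mv_bar \<Omega> \<Sigma> \<Theta> H\<Sigma> \<gamma> = Rd_bar \<Omega> \<Sigma> \<Theta> H\<Theta> u \<and>
     data_constraint \<alpha> \<T> f (Ob_bar \<Omega> \<Sigma> \<Theta> H\<Sigma> H\<Theta> Ob u)"

definition MP_solves ::
  "(real^'n) set \<Rightarrow> real set \<Rightarrow> (real^'n) set \<Rightarrow> real measure \<Rightarrow> (real^'n) measure \<Rightarrow>
     (real \<Rightarrow> ((real^'n) set \<Rightarrow> real) \<Rightarrow> 'h::real_normed_vector) \<Rightarrow> real \<Rightarrow> real set \<Rightarrow>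
     (real \<Rightarrow> 'h) \<Rightarrow>
     (((real^'n) \<times> real) set \<Rightarrow> real) \<Rightarrow> (((real^'n) \<times> real \<times> real) set \<Rightarrow> real) \<Rightarrow> bool" where
  "MP_solves \<Omega> \<Sigma> \<Theta> H\<Sigma> H\<Theta> Ob \<alpha> \<T> f u \<gamma> \<longleftrightarrow>
     MP_feasible \<Omega> \<Sigma> \<Theta> H\<Sigma> H\<Theta> Ob \<alpha> \<T> f u \<gamma> \<and>
     (\<forall>u' \<gamma>'. MP_feasible \<Omega> \<Sigma> \<Theta> H\<Sigma> H\<Theta> Ob \<alpha> \<T> f u' \<gamma>' \<longrightarrow>
        objective \<Omega> \<Sigma> \<Theta> \<alpha> \<T> f (Ob_bar \<Omega> \<Sigma> \<Theta> H\<Sigma> H\<Theta> Ob u) \<gamma>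
          \<le> objective \<Omega> \<Sigma> \<Theta> \<alpha> \<T> f (Ob_bar \<Omega> \<Sigma> \<Theta> H\<Sigma> H\<Theta> Ob u') \<gamma>')"

end

theory Submission
  imports Defs "HOL-Probability.Helly_Selection"
begin

text \<open>
  The two problems have the same feasible pairs, up to passing between \<open>u\<close> and its decomposition,
  so their objectives can be compared term by term. The tool behind this is weak sequential
  compactness of the measures of fixed mass on \<open>\<Omega>\<close>.

  If \<open>Rd u\<^sub>t = Mv\<^sub>t \<gamma>\<close> for all \<open>t\<close>, every weak limit of \<open>u\<^sub>s\<close> as \<open>s \<rightarrow> t\<close> has Radon transform
  \<open>Mv\<^sub>t \<gamma>\<close>, hence equals \<open>u\<^sub>t\<close> by injectivity of \<open>Rd\<close>. Thus \<open>t \<mapsto> u\<^sub>t\<close> is weakly continuous, in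
  particular a kernel, and Fubini's theorem gives the constraint for \<open>u = u\<^sub>t \<otimes>\<^sub>t H\<Sigma>\<close>.

  Conversely, if the constraint holds for \<open>u\<close>, the averages of \<open>u\<close> over the time intervals
  \<open>ball t (1 / k)\<close>, which are not null because \<open>H\<Sigma>\<close> has full support, have a weak limit \<open>u\<^sub>t\<close>
  with \<open>Rd u\<^sub>t = Mv\<^sub>t \<gamma>\<close>. The measure \<open>u\<^sub>t \<otimes>\<^sub>t H\<Sigma>\<close> has the same image under the injective operator
  \<open>Rd_bar\<close> as \<open>u\<close>, so it is \<open>u\<close>. The same averages determine \<open>Rd u\<^sub>t\<close> for any decomposition with
  the required continuity, which gives uniqueness.
\<close>

section \<open>Measures on Borel subspaces\<close>

text \<open>The obstacle is that the constraint of the measure problem holds only after integration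
  against \<open>H\<Sigma>\<close>, whereas the other problem asks for it at every time, and the
  observation times may themselves be \<open>H\<Sigma>\<close>-null. What bridges the gap is that
  \<open>MvM t \<gamma>\<close> is weakly continuous in t without any assumption, since t enters
  only through the integrand after a change of variables. The fixed mass that compactness needs
  comes from the constraint itself: \<open>H\<Theta>\<close> is a probability measure and the moves
  map \<Theta> \<times> \<Gamma> into \<Theta> \<times> \<Xi>, so every preimage of
  \<open>MvM t \<gamma>\<close> under the Radon transform has the mass of \<gamma>. The Radon
  transform passes to weak limits because its adjoint, which averages a test function over the
  directions, preserves continuity. \<open>Rd_bar\<close> inherits injectivity from
  \<open>Rd\<close> since the transform does not touch time: it may be undone separately for each
  Borel set of times.\<close>

lemma nonneg_measures_ex_measure:
  assumes "\<nu> \<in> nonneg_measures X"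
  obtains \<mu> where "finite_measure \<mu>" "sets \<mu> = sets (borel_on X)" "\<nu> = measure \<mu>"
proof -
  have out: "\<nu> A = 0" if "A \<notin> sets (borel_on X)" for A
    using assms that by (auto simp: nonneg_measures_def signed_measures_def)
  have sums: "(\<lambda>i. \<nu> (A i)) sums \<nu> (\<Union>i. A i)"
    if "range A \<subseteq> sets (borel_on X)" "disjoint_family A" for A :: "nat \<Rightarrow> _"
    using assms that by (auto simp: nonneg_measures_def signed_measures_def)
  have nonneg: "0 \<le> \<nu> A" for A
    using assms by (auto simp: nonneg_measures_def)
  \<comment> \<open>The constant family of empty sets is disjoint, and a constant series converges
    only if its term is 0.\<close>
  have "(\<lambda>i::nat. \<nu> {}) sums \<nu> {}"
    using sums[of "\<lambda>_. {}"] by (simp add: disjoint_family_on_def)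
  then have empty: "\<nu> {} = 0"
    using summable_const_iff sums_summable by blast
  define \<mu> where "\<mu> = measure_of X (sets (borel_on X)) (\<lambda>A. ennreal (\<nu> A))"
  have sp: "space (borel_on X) = X"
    by (simp add: space_restrict_space)
  have sa: "sigma_algebra X (sets (borel_on X))"
    using sets.sigma_algebra_axioms[of "borel_on X"] by (simp add: sp)
  have sets: "sets \<mu> = sets (borel_on X)"
    unfolding \<mu>_def using sets.space_closed[of "borel_on X"] sa
    by (simp add: sp sigma_algebra.sigma_sets_eq)
  have em: "emeasure \<mu> A = ennreal (\<nu> A)" if "A \<in> sets (borel_on X)" for A
    unfolding \<mu>_def
  proof (rule emeasure_measure_of_sigma[OF sa _ _ that])
    show "positive (sets (borel_on X)) (\<lambda>A. ennreal (\<nu> A))"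
      by (simp add: positive_def empty)
    show "countably_additive (sets (borel_on X)) (\<lambda>A. ennreal (\<nu> A))"
      unfolding countably_additive_def
      by (intro allI impI suminf_ennreal_eq[OF nonneg] sums)
  qed
  have "finite_measure \<mu>"
    using em[OF sets.top] by (intro finite_measureI) (simp add: sets_eq_imp_space_eq[OF sets])
  moreover have "\<nu> A = measure \<mu> A" for A
    using em[of A] out[of A] nonneg[of A] sets measure_notin_sets[of A \<mu>]
    by (cases "A \<in> sets (borel_on X)") (auto simp: measure_def)
  ultimately show thesis
    using that sets by blast
qed

text \<open>Dynkin's argument: open sets are stable under intersection and generate. The induction
  runs over the Borel sets of the whole space and is then cut down to \<open>X\<close>, so
  \<open>X\<close> itself may be any set.\<close>

lemma borel_on_induct [consumes 1, case_names basic compl union]: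
  assumes "A \<in> sets (borel_on X)"
    and op: "\<And>U. open U \<Longrightarrow> P (X \<inter> U)"
    and compl: "\<And>A. A \<in> sets (borel_on X) \<Longrightarrow> P A \<Longrightarrow> P (X - A)"
    and union: "\<And>A :: nat \<Rightarrow> _. disjoint_family A \<Longrightarrow> range A \<subseteq> sets (borel_on X) \<Longrightarrow>
      (\<And>i. P (A i)) \<Longrightarrow> P (\<Union>i. A i)"
  shows "P A"
proof -
  obtain B where B: "B \<in> sets borel" and A: "A = X \<inter> B"
    using assms(1) by (auto simp: sets_restrict_space)
  have istab: "Int_stable {S :: 'a set. open S}" "{S :: 'a set. open S} \<subseteq> Pow UNIV"
    by (auto simp: Int_stable_def)
  have "P (X \<inter> B)"
    using istab B[unfolded sets_borel]
  proof (induction rule: sigma_sets_induct_disjoint)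
    case (basic U)
    then show ?case by (simp add: op)
  next
    case empty
    show ?case using op[of "{}"] by simp
  next
    case (compl B)
    then have "X \<inter> B \<in> sets (borel_on X)"
      by (auto simp: sets_restrict_space sets_borel)
    moreover have "X \<inter> (UNIV - B) = X - X \<inter> B" by auto
    ultimately show ?case
      using assms(3) compl.IH by simp
  next
    case (union B)
    have "X \<inter> (\<Union>i. B i) = (\<Union>i. X \<inter> B i)" by auto
    moreover have "P (\<Union>i. X \<inter> B i)"
    proof (rule assms(4))
      show "range (\<lambda>i. X \<inter> B i) \<subseteq> sets (borel_on X)"
        using union.hyps unfolding sets_restrict_space sets_borel by blast
    qed (use union in \<open>auto simp: disjoint_family_on_def\<close>)
    ultimately show ?case by simp
  qed
  then show ?thesis by (simp add: A)
qed

lemma space_eq_borel_on: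
  "sets M = sets (borel_on X) \<Longrightarrow> space M = X"
  by (auto dest: sets_eq_imp_space_eq simp: space_restrict_space)

lemma measurable_borel_onI:
  assumes "continuous_on X f" "f \<in> X \<rightarrow> Y"
  shows "f \<in> measurable (borel_on X) (borel_on Y)"
  using assms by (intro measurable_restrict_space2 borel_measurable_continuous_on_restrict)
    (auto simp: space_restrict_space)

lemma borel_measurable_borel_onI:
  assumes "continuous_on X f" "sets M = sets (borel_on X)"
  shows "f \<in> borel_measurable M"
  using borel_measurable_continuous_on_restrict[OF assms(1)] measurable_cong_sets[OF assms(2) refl]
  by blast

text \<open>Second countability enters through \<open>borel_prod\<close>. Both inclusions express
  that the identity map is measurable, which can be checked on coordinates.\<close>

lemma sets_borel_on_times:
  fixes X :: "'a::second_countable_topology set" and Y :: "'b::second_countable_topology set"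
  shows "sets (borel_on X \<Otimes>\<^sub>M borel_on Y) = sets (borel_on (X \<times> Y))"
proof
  have "(\<lambda>p. (fst p, snd p)) \<in> measurable (borel_on (X \<times> Y)) (borel_on X \<Otimes>\<^sub>M borel_on Y)"
    by (intro measurable_Pair measurable_borel_onI) (auto intro!: continuous_intros)
  then have "(\<lambda>p. p) \<in> measurable (borel_on (X \<times> Y)) (borel_on X \<Otimes>\<^sub>M borel_on Y)"
    by simp
  from measurable_sets[OF this]
  show "sets (borel_on X \<Otimes>\<^sub>M borel_on Y) \<subseteq> sets (borel_on (X \<times> Y))"
    using sets.sets_into_space[of _ "borel_on X \<Otimes>\<^sub>M borel_on Y"]
    by (auto simp: space_restrict_space space_pair_measure Int_absorb2)
next
  have "(\<lambda>p. (fst p, snd p)) \<in> measurable (borel_on X \<Otimes>\<^sub>M borel_on Y) (borel \<Otimes>\<^sub>M borel)"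
    by (intro measurable_Pair measurable_compose[OF measurable_fst] measurable_compose[OF measurable_snd])
      (auto intro!: measurable_restrict_space1)
  then have id: "(\<lambda>p. p) \<in> measurable (borel_on X \<Otimes>\<^sub>M borel_on Y) borel"
    by (simp add: borel_prod)
  show "sets (borel_on (X \<times> Y)) \<subseteq> sets (borel_on X \<Otimes>\<^sub>M borel_on Y)"
    using measurable_sets[OF id]
    by (auto simp: sets_restrict_space space_restrict_space space_pair_measure Int_commute)
qed

lemma sets_pair_borel_on:
  fixes X :: "'a::second_countable_topology set" and Y :: "'b::second_countable_topology set"
  assumes "sets M = sets (borel_on X)" "sets N = sets (borel_on Y)"
  shows "sets (M \<Otimes>\<^sub>M N) = sets (borel_on (X \<times> Y))"
  using sets_pair_measure_cong[OF assms] by (simp add: sets_borel_on_times)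

lemma open_indicator_limit:
  fixes U :: "'a::metric_space set"
  assumes "open U"
  obtains f :: "nat \<Rightarrow> 'a \<Rightarrow> real" where
    "\<And>k. continuous_on UNIV (f k)" "\<And>k x. \<bar>f k x\<bar> \<le> 1" "\<And>x. (\<lambda>k. f k x) \<longlonglongrightarrow> indicator U x"
\<comment> \<open>The whole space is treated apart because \<open>infdist x {}\<close> is 0 by
  convention, which would make every approximating function vanish.\<close>
proof (cases "U = UNIV")
  case True
  then show thesis
    by (intro that[of "\<lambda>_ _. 1"]) auto
next
  case False
  define f :: "nat \<Rightarrow> 'a \<Rightarrow> real" where "f k x = min 1 (real k * infdist x (- U))" for k x
  have "(\<lambda>k. f k x) \<longlonglongrightarrow> indicator U x" for x
  proof (cases "x \<in> U")
    case True
    then have pos: "infdist x (- U) > 0"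
      using False assms in_closed_iff_infdist_zero[of "- U" x] infdist_nonneg[of x "- U"]
      by (metis Compl_UNIV_eq ComplD closed_Compl compl_eq_compl_iff less_eq_real_def)
    have "eventually (\<lambda>k. f k x = 1) sequentially"
      using eventually_ge_at_top[of "nat \<lceil>1 / infdist x (- U)\<rceil>"]
    proof eventually_elim
      case (elim k)
      then have "1 / infdist x (- U) \<le> real k" by linarith
      with pos show ?case by (simp add: f_def field_simps)
    qed
    with True show ?thesis
      by (simp add: tendsto_eventually)
  qed (simp add: f_def)
  moreover have "continuous_on UNIV (f k)" for k
    unfolding f_def by (intro continuous_intros)
  moreover have "\<bar>f k x\<bar> \<le> 1" for k x
    by (auto simp: f_def infdist_nonneg)
  ultimately show thesis by (intro that)
qed

text \<open>One sequence serves all measures at once. This uniformity is what lets measurability in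
  a parameter pass to the limit in \<open>borel_measurable_kernel\<close>.\<close>

lemma integral_open_indicator_limit:
  fixes X :: "'a::metric_space set"
  assumes "open U"
  obtains f :: "nat \<Rightarrow> 'a \<Rightarrow> real" where
    "\<And>k. continuous_on X (f k)"
    "\<And>M. finite_measure M \<Longrightarrow> sets M = sets (borel_on X) \<Longrightarrow>
      (\<lambda>k. \<integral>x. f k x \<partial>M) \<longlonglongrightarrow> measure M (X \<inter> U)"
proof -
  obtain f :: "nat \<Rightarrow> 'a \<Rightarrow> real" where f: "\<And>k. continuous_on UNIV (f k)" "\<And>k x. \<bar>f k x\<bar> \<le> 1"
    "\<And>x. (\<lambda>k. f k x) \<longlonglongrightarrow> indicator U x"
    using open_indicator_limit[OF assms] by blast
  have cont: "continuous_on X (f k)" for k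
    using f(1) continuous_on_subset by blast
  moreover have "(\<lambda>k. \<integral>x. f k x \<partial>M) \<longlonglongrightarrow> measure M (X \<inter> U)"
    if M: "finite_measure M" "sets M = sets (borel_on X)" for M
  proof -
    interpret finite_measure M by fact
    have sp: "space M = X" using M(2) by (rule space_eq_borel_on)
    have U: "X \<inter> U \<in> sets M"
      using assms by (simp add: M(2) sets_restrict_space)
    have "(\<lambda>k. \<integral>x. f k x \<partial>M) \<longlonglongrightarrow> (\<integral>x. indicator (X \<inter> U) x \<partial>M)"
    proof (rule integral_dominated_convergence[where w="\<lambda>_. 1"])
      show "AE x in M. (\<lambda>k. f k x) \<longlonglongrightarrow> indicator (X \<inter> U) x"
        using f(3) by (intro AE_I2) (simp add: sp indicator_def)
    qed (use f(2) U in \<open>auto intro: borel_measurable_borel_onI[OF cont M(2)]\<close>)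
    with U show ?thesis by (simp add: sp Int_absorb2)
  qed
  ultimately show thesis by (rule that)
qed

lemma finite_measure_eqI:
  assumes "finite_measure M" "finite_measure N" "sets M = sets N"
    "\<And>A. A \<in> sets M \<Longrightarrow> measure M A = measure N A"
  shows "M = N"
  using assms by (intro measure_eqI) (auto simp: finite_measure.emeasure_eq_measure)

text \<open>Continuous functions approximate indicators of open sets, and
  \<open>borel_on_induct\<close> does the rest; the open set \<open>UNIV\<close> supplies the equal
  total masses for complements.\<close>

lemma measure_eqI_continuous:
  fixes X :: "'a::metric_space set"
  assumes M: "finite_measure M" "sets M = sets (borel_on X)"
    and N: "finite_measure N" "sets N = sets (borel_on X)"
    and eq: "\<And>\<phi> :: 'a \<Rightarrow> real. continuous_on X \<phi> \<Longrightarrow> (\<integral>x. \<phi> x \<partial>M) = (\<integral>x. \<phi> x \<partial>N)"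
  shows "M = N"
proof (rule finite_measure_eqI[OF M(1) N(1)])
  show "sets M = sets N" using M N by simp
  have sp: "space M = X" "space N = X" using M(2) N(2) by (auto dest: space_eq_borel_on)
  have open_eq: "measure M (X \<inter> U) = measure N (X \<inter> U)" if U: "open U" for U
  proof -
    obtain f :: "nat \<Rightarrow> 'a \<Rightarrow> real" where f: "\<And>k. continuous_on X (f k)"
      "\<And>M. finite_measure M \<Longrightarrow> sets M = sets (borel_on X) \<Longrightarrow>
        (\<lambda>k. \<integral>x. f k x \<partial>M) \<longlonglongrightarrow> measure M (X \<inter> U)"
      using integral_open_indicator_limit[OF U] by blast
    show ?thesis
      using f(2)[OF M] f(2)[OF N] LIMSEQ_unique eq[OF f(1)] by simp
  qed
  fix A assume "A \<in> sets M"
  then have "A \<in> sets (borel_on X)" using M by simp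
  then show "measure M A = measure N A"
  proof (induction rule: borel_on_induct)
    case (compl A)
    then show ?case
      using open_eq[of UNIV] M N
      by (metis Int_UNIV_right finite_measure.finite_measure_compl open_UNIV sp)
  next
    case (union A)
    have "(\<lambda>i. measure M (A i)) sums measure M (\<Union>i. A i)"
      "(\<lambda>i. measure N (A i)) sums measure N (\<Union>i. A i)"
      using union.hyps M N by (simp_all add: finite_measure.finite_measure_UNION)
    then show ?case by (simp add: union.IH sums_iff)
  qed (rule open_eq)
qed

text \<open>Turns weak measurability, and so in particular weak continuity in the parameter, into
  the kernel property. The measure of a relatively open set is a pointwise limit of measurable
  functions of z.\<close>

lemma borel_measurable_kernel:
  fixes X :: "'a::metric_space set"
  assumes K: "\<And>z. z \<in> space W \<Longrightarrow> finite_measure (K z)"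
      "\<And>z. z \<in> space W \<Longrightarrow> sets (K z) = sets (borel_on X)"
    and meas: "\<And>\<phi> :: 'a \<Rightarrow> real. continuous_on X \<phi> \<Longrightarrow> (\<lambda>z. \<integral>x. \<phi> x \<partial>K z) \<in> borel_measurable W"
    and "A \<in> sets (borel_on X)"
  shows "(\<lambda>z. measure (K z) A) \<in> borel_measurable W"
proof -
  have sp: "space (K z) = X" if "z \<in> space W" for z
    using K(2)[OF that] by (rule space_eq_borel_on)
  have open_meas: "(\<lambda>z. measure (K z) (X \<inter> U)) \<in> borel_measurable W" if U: "open U" for U
  proof -
    obtain f :: "nat \<Rightarrow> 'a \<Rightarrow> real" where f: "\<And>k. continuous_on X (f k)"
      "\<And>M. finite_measure M \<Longrightarrow> sets M = sets (borel_on X) \<Longrightarrow>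
        (\<lambda>k. \<integral>x. f k x \<partial>M) \<longlonglongrightarrow> measure M (X \<inter> U)"
      using integral_open_indicator_limit[OF U] by blast
    show ?thesis
      by (rule borel_measurable_LIMSEQ_metric[OF meas[OF f(1)]]) (rule f(2)[OF K])
  qed
  show ?thesis using assms(4)
  proof (induction rule: borel_on_induct)
    case (compl A)
    have "measure (K z) (X - A) = measure (K z) (X \<inter> UNIV) - measure (K z) A" if "z \<in> space W" for z
      using finite_measure.finite_measure_compl[OF K(1)[OF that], of A] compl K(2)[OF that] sp[OF that]
      by simp
    then show ?case
      using borel_measurable_diff[OF open_meas[OF open_UNIV] compl.IH]
      by (simp cong: measurable_cong)
  next
    case (union A)
    have "(\<lambda>i. measure (K z) (A i)) sums measure (K z) (\<Union>i. A i)" if "z \<in> space W" for z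
      using union K that by (intro finite_measure.finite_measure_UNION) auto
    then have "measure (K z) (\<Union>i. A i) = (\<Sum>i. measure (K z) (A i))" if "z \<in> space W" for z
      using sums_unique that by blast
    then show ?case
      using borel_measurable_suminf[OF union.IH] by (simp cong: measurable_cong)
  qed (rule open_meas)
qed

section \<open>Weak sequential compactness\<close>

text \<open>The base-3 digits of \<open>s x\<close> record which members of a countable base contain
  x. In base 3 the first digit in which two codes differ outweighs all later ones, so close codes
  have equal initial digits. The code is in general discontinuous; only its inverse is
  controlled.\<close>

lemma compact_coding:
  fixes X :: "'a::{metric_space, second_countable_topology} set"
  assumes "compact X"
  obtains s :: "'a \<Rightarrow> real" where "s \<in> borel_measurable borel" "\<And>x. s x \<in> {0..2}"
    "\<And>e. 0 < e \<Longrightarrow> \<exists>d>0. \<forall>x\<in>X. \<forall>y\<in>X. \<bar>s x - s y\<bar> < d \<longrightarrow> dist x y < e"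
proof -
  obtain \<B> :: "'a set set" where \<B>: "countable \<B>" "topological_basis \<B>"
    using ex_countable_basis by blast
  have ne: "\<B> \<noteq> {}"
    using topological_basisE[OF \<B>(2) open_UNIV UNIV_I] by blast
  define B where "B = from_nat_into \<B>"
  have range_B: "range B = \<B>"
    using range_from_nat_into[OF ne \<B>(1)] by (simp add: B_def)
  have open_B: "open (B i)" for i
    using range_B topological_basis_open[OF \<B>(2)] by blast
  define s :: "'a \<Rightarrow> real" where "s x = (\<Sum>i. indicator (B i) x * (1/3) ^ i)" for x
  have geo: "summable (\<lambda>i. (1/3::real) ^ i)" "(\<Sum>i. (1/3::real) ^ i) = 3/2"
    by (auto simp: summable_geometric suminf_geometric)
  have summ: "summable (\<lambda>i. indicator (B i) x * (1/3::real) ^ i)" for x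
    by (rule summable_comparison_test[OF _ geo(1)]) (auto simp: indicator_def)
  have "s \<in> borel_measurable borel"
    unfolding s_def using open_B by (intro borel_measurable_suminf borel_measurable_times) auto
  moreover have "s x \<in> {0..2}" for x
  proof -
    have "0 \<le> s x" unfolding s_def by (intro suminf_nonneg summ) auto
    moreover have "s x \<le> 3/2"
      unfolding s_def geo(2)[symmetric] by (intro suminf_le summ geo) (auto simp: indicator_def)
    ultimately show ?thesis by simp
  qed
  moreover have "\<exists>d>0. \<forall>x\<in>X. \<forall>y\<in>X. \<bar>s x - s y\<bar> < d \<longrightarrow> dist x y < e" if e: "0 < e" for e
  proof -
    \<comment> \<open>Base sets whose points are pairwise closer than e. Finitely many of them cover
      \<open>X\<close>, and two codes that agree up to the largest index m used put their points
      into a common one.\<close>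
    define I where "I = {i. \<forall>x\<in>B i. \<forall>y\<in>B i. dist x y < e}"
    have "X \<subseteq> \<Union> (B ` I)"
    proof
      fix x assume "x \<in> X"
      obtain b where b: "b \<in> \<B>" "x \<in> b" "b \<subseteq> ball x (e/2)"
        using topological_basisE[OF \<B>(2) open_ball, of x x "e/2"] e centre_in_ball half_gt_zero
        by metis
      obtain i where i: "b = B i" using b range_B by auto
      have "dist y z < e" if "y \<in> B i" "z \<in> B i" for y z
      proof -
        have "dist x y < e/2" "dist x z < e/2" using b i that by auto
        then show ?thesis using dist_triangle_half_r by blast
      qed
      then show "x \<in> \<Union> (B ` I)" using b i by (auto simp: I_def)
    qed
    then obtain J where J: "J \<subseteq> I" "finite J" "X \<subseteq> \<Union> (B ` J)"
      using compactE_image[OF assms, of I B] open_B by metis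
    define m where "m = Max (insert 0 J)"
    have m: "j \<le> m" if "j \<in> J" for j
      using J that by (simp add: m_def)
    have "dist x y < e" if xy: "x \<in> X" "y \<in> X" "\<bar>s x - s y\<bar> < (1/3) ^ m / 2" for x y
    proof -
      define \<delta> :: "nat \<Rightarrow> real" where "\<delta> i = indicator (B i) x - indicator (B i) y" for i
      have \<delta>_le: "\<bar>\<delta> i\<bar> \<le> 1" for i by (auto simp: \<delta>_def indicator_def)
      have s_diff: "s x - s y = (\<Sum>i. \<delta> i * (1/3) ^ i)"
        unfolding s_def suminf_diff[OF summ summ] \<delta>_def by (simp add: algebra_simps)
      have summ_\<delta>: "summable (\<lambda>i. \<delta> i * (1/3) ^ i)"
        by (rule summable_comparison_test[OF _ geo(1)])
          (use \<delta>_le in \<open>auto simp: abs_mult intro!: exI[of _ 0] mult_left_le_one_le\<close>)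
      have zero: "\<delta> i = 0" if "i \<le> m" for i
      proof (rule ccontr)
        assume "\<delta> i \<noteq> 0"
        \<comment> \<open>First differing digit. It contributes exactly \<open>(1/3) ^ k\<close> to
          the difference of the codes, while the tail contributes at most half of that.\<close>
        define k where "k = (LEAST i. \<delta> i \<noteq> 0)"
        have k: "\<delta> k \<noteq> 0" "k \<le> i" "\<And>j. j < k \<Longrightarrow> \<delta> j = 0"
          unfolding k_def using LeastI[of "\<lambda>i. \<delta> i \<noteq> 0", OF \<open>\<delta> i \<noteq> 0\<close>]
            Least_le[of "\<lambda>i. \<delta> i \<noteq> 0", OF \<open>\<delta> i \<noteq> 0\<close>] not_less_Least[of _ "\<lambda>i. \<delta> i \<noteq> 0"] by blast+
        then have abs_k: "\<bar>\<delta> k\<bar> = 1" by (auto simp: \<delta>_def indicator_def split: if_splits)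
        define tail where "tail = (\<Sum>i. \<delta> (i + Suc k) * (1/3) ^ (i + Suc k))"
        have "s x - s y = tail + (\<Sum>i<Suc k. \<delta> i * (1/3) ^ i)"
          unfolding s_diff tail_def by (rule suminf_split_initial_segment[OF summ_\<delta>])
        also have "(\<Sum>i<Suc k. \<delta> i * (1/3) ^ i) = \<delta> k * (1/3) ^ k"
          using k(3) by simp
        finally have eq: "s x - s y = tail + \<delta> k * (1/3) ^ k" .
        have "\<bar>\<delta> (i + Suc k) * (1/3) ^ (i + Suc k)\<bar> \<le> (1/3) ^ Suc k * (1/3) ^ i" for i
          using mult_right_mono[OF \<delta>_le[of "i + Suc k"], of "(1/3) ^ (i + Suc k)"]
          by (simp add: abs_mult power_add mult_ac)
        moreover have "summable (\<lambda>i. (1/3::real) ^ Suc k * (1/3) ^ i)"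
          by (intro summable_mult geo)
        \<comment> \<open>The geometric series has sum 3/2, so this bound equals
          \<open>(1/3) ^ k / 2\<close>.\<close>
        ultimately have "\<bar>tail\<bar> \<le> (\<Sum>i. (1/3) ^ Suc k * (1/3) ^ i)"
          unfolding tail_def real_norm_def[symmetric] by (intro norm_suminf_le) auto
        also have "\<dots> = (1/3) ^ k / 2"
          by (subst suminf_mult[OF geo(1)]) (simp add: geo(2))
        finally have tail: "\<bar>tail\<bar> \<le> (1/3) ^ k / 2" .
        have "\<bar>\<delta> k * (1/3) ^ k\<bar> = (1/3) ^ k"
          by (simp add: abs_mult abs_k)
        with tail have "\<bar>s x - s y\<bar> \<ge> (1/3) ^ k / 2"
          unfolding eq by linarith
        moreover have "(1/3::real) ^ m \<le> (1/3) ^ k"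
          using k(2) that by (intro power_decreasing) auto
        ultimately show False using xy(3) by simp
      qed
      obtain j where "j \<in> J" "x \<in> B j" using J xy by auto
      then have "y \<in> B j"
        using zero[OF m[of j]] by (auto simp: \<delta>_def indicator_def split: if_splits)
      then show ?thesis
        using \<open>j \<in> J\<close> \<open>x \<in> B j\<close> J by (auto simp: I_def)
    qed
    then show ?thesis
      by (intro exI[of _ "(1/3) ^ m / 2"]) auto
  qed
  ultimately show thesis by (rule that)
qed

text \<open>Helly's selection theorem is transported from the line along an injective Borel code whose
  inverse is uniformly continuous, hence extends to the closure of the set of codes.\<close>

lemma prob_weakly_convergent_subsequence:
  fixes X :: "'a::polish_space set" and \<mu> :: "nat \<Rightarrow> 'a measure"
  assumes X: "compact X" and prob: "\<And>k. prob_space (\<mu> k)"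
    and sets: "\<And>k. sets (\<mu> k) = sets (borel_on X)"
  obtains r \<nu> where "strict_mono (r :: nat \<Rightarrow> nat)" "prob_space \<nu>" "sets \<nu> = sets (borel_on X)"
    "\<And>\<phi> :: 'a \<Rightarrow> real. continuous_on X \<phi> \<Longrightarrow> (\<lambda>k. \<integral>x. \<phi> x \<partial>\<mu> (r k)) \<longlonglongrightarrow> (\<integral>x. \<phi> x \<partial>\<nu>)"
proof -
  obtain s :: "'a \<Rightarrow> real" where s: "s \<in> borel_measurable borel" "\<And>x. s x \<in> {0..2}"
    "\<And>e. 0 < e \<Longrightarrow> \<exists>d>0. \<forall>x\<in>X. \<forall>y\<in>X. \<bar>s x - s y\<bar> < d \<longrightarrow> dist x y < e"
    using compact_coding[OF X] by blast
  have sp: "space (\<mu> k) = X" for k using sets by (rule space_eq_borel_on)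
  have s_meas: "s \<in> borel_measurable (\<mu> k)" for k
    using measurable_restrict_space1[OF s(1), of X] measurable_cong_sets[OF sets refl] by blast
  have inj: "inj_on s X"
  proof (rule inj_onI, rule ccontr)
    fix x y assume xy: "x \<in> X" "y \<in> X" "s x = s y" "x \<noteq> y"
    then obtain d where "d > 0" "\<forall>u\<in>X. \<forall>v\<in>X. \<bar>s u - s v\<bar> < d \<longrightarrow> dist u v < dist x y"
      using s(3)[of "dist x y"] by auto
    with xy show False by force
  qed
  define h where "h = inv_into X s"
  have h: "h (s x) = x" if "x \<in> X" for x
    using inj that by (simp add: h_def)
  have "uniformly_continuous_on (s ` X) h"
    unfolding uniformly_continuous_on_def ball_simps dist_real_def
  proof (intro allI impI)
    fix e :: real assume "0 < e"
    then obtain d where d: "d > 0" "\<forall>x\<in>X. \<forall>y\<in>X. \<bar>s x - s y\<bar> < d \<longrightarrow> dist x y < e"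
      using s(3) by blast
    then show "\<exists>d>0. \<forall>x\<in>X. \<forall>y\<in>X. \<bar>s y - s x\<bar> < d \<longrightarrow> dist (h (s y)) (h (s x)) < e"
      using h by (intro exI[of _ d]) simp
  qed
  then obtain g where g: "uniformly_continuous_on (closure (s ` X)) g"
      "\<And>z. z \<in> s ` X \<Longrightarrow> h z = g z"
    using uniformly_continuous_on_extension_on_closure by metis
  \<comment> \<open>The set of codes need not be closed, so the limit law on the line may charge
    points that are not codes. The extension \<open>g\<close> still decodes them, with values in
    \<open>X\<close> because \<open>X\<close> is closed.\<close>
  define C where "C = closure (s ` X)"
  have s_C: "s x \<in> C" if "x \<in> X" for x
    using that by (auto simp: C_def closure_subset[THEN subsetD])
  have closed_C: "closed C" by (simp add: C_def)
  have g_cont: "continuous_on C g"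
    using g(1) by (simp add: C_def uniformly_continuous_imp_continuous)
  have g_s: "g (s x) = x" if "x \<in> X" for x
    using g(2)[of "s x"] h that by simp
  have g_C: "g z \<in> X" if "z \<in> C" for z
  proof -
    have "g ` closure (s ` X) \<subseteq> closure (g ` s ` X)"
      using g_cont by (intro image_closure_subset) (auto simp: C_def closure_subset)
    also have "g ` s ` X = X" using g_s by force
    also have "closure X = X" using compact_imp_closed[OF X] by simp
    finally show ?thesis using that by (auto simp: C_def)
  qed
  have "X \<noteq> {}"
    using prob_space.not_empty[OF prob] sp by metis
  then obtain x0 where x0: "x0 \<in> X" by auto
  \<comment> \<open>Tightness is trivial since all codes lie in \<open>{0..2}\<close>. The left end
    -1 is chosen because the intervals are open on the left and 0 may be a code.\<close>
  have "tight (\<lambda>k. distr (\<mu> k) borel s)"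
    unfolding tight_def
  proof (intro conjI allI impI)
    fix k show "real_distribution (distr (\<mu> k) borel s)"
      using prob_space.real_distribution_distr[OF prob s_meas] .
  next
    fix \<epsilon> :: real assume "\<epsilon> > 0"
    have "measure (distr (\<mu> k) borel s) {-1<..2} = 1" for k
    proof -
      have "s -` {-1<..2} \<inter> space (\<mu> k) = space (\<mu> k)"
        using s(2) by (force simp: less_le_trans[of "-1" 0])
      then show ?thesis
        using prob_space.prob_space[OF prob] s_meas by (simp add: measure_distr)
    qed
    then show "\<exists>a b. a < b \<and> (\<forall>k. 1 - \<epsilon> < measure (distr (\<mu> k) borel s) {a<..b})"
      using \<open>\<epsilon> > 0\<close> by (intro exI[of _ "-1"] exI[of _ 2]) auto
  qed
  then obtain r M where r: "strict_mono (r :: nat \<Rightarrow> nat)" and M: "real_distribution M"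
    and conv: "weak_conv_m ((\<lambda>k. distr (\<mu> k) borel s) \<circ> id \<circ> r) M"
    using tight_imp_convergent_subsubsequence[OF _ strict_mono_id] by blast
  interpret M: real_distribution M by fact
  have lim: "(\<lambda>k. \<integral>x. F (s x) \<partial>\<mu> (r k)) \<longlonglongrightarrow> (\<integral>z. F z \<partial>M)"
    if F: "continuous_on UNIV F" "\<And>z. norm (F z) \<le> B" for F :: "real \<Rightarrow> real" and B
  proof -
    have F_meas: "F \<in> borel_measurable borel"
      using F(1) by (rule borel_measurable_continuous_onI)
    have "(\<lambda>k. \<integral>z. F z \<partial>distr (\<mu> (r k)) borel s) \<longlonglongrightarrow> (\<integral>z. F z \<partial>M)"
      using weak_conv_imp_integral_bdd_continuous_conv[OF _ M conv, of F B] F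
        prob_space.real_distribution_distr[OF prob s_meas]
      by (simp add: continuous_on_eq_continuous_at)
    then show ?thesis
      by (simp add: integral_distr[OF s_meas F_meas])
  qed
  \<comment> \<open>The distance to \<open>C\<close>, truncated at 1 to be a bounded test function,
    vanishes on all codes, so its integral against the limit law is 0.\<close>
  have AE_C: "AE z in M. z \<in> C"
  proof -
    define F where "F z = min 1 (infdist z C)" for z
    have F: "continuous_on UNIV F" unfolding F_def by (intro continuous_intros)
    have F_nonneg: "0 \<le> F z" for z by (simp add: F_def infdist_nonneg)
    have F_bdd: "norm (F z) \<le> 1" for z by (auto simp: F_def infdist_nonneg)
    have "(\<integral>x. F (s x) \<partial>\<mu> (r k)) = 0" for k
    proof -
      have "(\<integral>x. F (s x) \<partial>\<mu> (r k)) = (\<integral>x. 0 \<partial>\<mu> (r k))"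
        using s_C by (intro Bochner_Integration.integral_cong) (auto simp: F_def sp)
      then show ?thesis by simp
    qed
    with lim[OF F F_bdd] have "(\<integral>z. F z \<partial>M) = 0"
      by (simp add: LIMSEQ_const_iff)
    moreover have "integrable M F"
      using borel_measurable_continuous_onI[OF F] F_bdd by (intro M.integrable_const_bound[of _ 1]) auto
    ultimately have "AE z in M. F z = 0"
      using integral_nonneg_eq_0_iff_AE[of M F] F_nonneg by simp
    then show ?thesis
    proof eventually_elim
      case (elim z)
      then have "infdist z C = 0" by (auto simp: F_def min_def split: if_splits)
      moreover have "C \<noteq> {}" using s_C[OF x0] by auto
      ultimately show ?case using in_closed_iff_infdist_zero[OF closed_C] by blast
    qed
  qed
  \<comment> \<open>The value off \<open>C\<close> is arbitrary, as that set is null for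
    \<open>M\<close>; it only keeps \<open>G\<close> total with values in \<open>X\<close>.\<close>
  define G where "G z = (if z \<in> C then g z else x0)" for z
  have G_borel: "G \<in> borel_measurable borel"
    unfolding G_def using closed_C g_cont by (intro borel_measurable_continuous_on_if) auto
  have G: "G \<in> measurable M (borel_on X)"
    using G_borel g_C x0 by (intro measurable_restrict_space2) (auto simp: G_def)
  define \<nu> where "\<nu> = distr M (borel_on X) G"
  have "(\<lambda>k. \<integral>x. \<phi> x \<partial>\<mu> (r k)) \<longlonglongrightarrow> (\<integral>x. \<phi> x \<partial>\<nu>)" if \<phi>: "continuous_on X \<phi>" for \<phi> :: "'a \<Rightarrow> real"
  proof -
    obtain B where B: "B \<ge> 0" "\<And>x. x \<in> X \<Longrightarrow> norm (\<phi> x) \<le> B"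
    proof -
      have "bounded (\<phi> ` X)" using \<phi> X compact_continuous_image compact_imp_bounded by blast
      then obtain B where "\<forall>x\<in>X. norm (\<phi> x) \<le> B" unfolding bounded_iff by auto
      then show thesis using that[of B] x0 norm_ge_zero order_trans by blast
    qed
    have "continuous_on C (\<lambda>z. \<phi> (g z))"
      using continuous_on_compose2[OF \<phi> g_cont] g_C by blast
    \<comment> \<open>Weak convergence on the line can be tested only with functions on all of the
      line, so \<open>\<phi>\<close> composed with the decoding is extended by Tietze's theorem with
      the same bound. On codes \<open>F (s x)\<close> is \<open>\<phi> x\<close>.\<close>
    then obtain F where F: "continuous_on UNIV F" "\<And>z. z \<in> C \<Longrightarrow> F z = \<phi> (g z)" "\<And>z. norm (F z) \<le> B"
      using Tietze[of C "\<lambda>z. \<phi> (g z)" UNIV B] B g_C closed_C by (metis UNIV_I closed_closedin subtopology_UNIV)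
    have "(\<integral>x. F (s x) \<partial>\<mu> (r k)) = (\<integral>x. \<phi> x \<partial>\<mu> (r k))" for k
      using s_C F(2) g_s by (intro Bochner_Integration.integral_cong) (auto simp: sp)
    moreover have "(\<integral>z. F z \<partial>M) = (\<integral>x. \<phi> x \<partial>\<nu>)"
    proof -
      have \<phi>_meas: "\<phi> \<in> borel_measurable (borel_on X)"
        using \<phi> by (rule borel_measurable_continuous_on_restrict)
      have "(\<integral>x. \<phi> x \<partial>\<nu>) = (\<integral>z. \<phi> (G z) \<partial>M)"
        unfolding \<nu>_def by (rule integral_distr[OF G \<phi>_meas])
      also have "\<dots> = (\<integral>z. F z \<partial>M)"
        using AE_C borel_measurable_continuous_onI[OF F(1)] measurable_compose[OF G \<phi>_meas]
        by (intro integral_cong_AE) (auto simp: G_def F(2))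
      finally show ?thesis by simp
    qed
    ultimately show ?thesis using lim[OF F(1,3)] by simp
  qed
  moreover have "prob_space \<nu>"
    unfolding \<nu>_def using G by (rule M.prob_space_distr)
  ultimately show thesis
    using r by (intro that[of r \<nu>]) (auto simp: \<nu>_def)
qed

text \<open>Dividing by the common mass c reduces to probability measures. The case c = 0, which
  contains the case of empty \<open>X\<close>, has to be separate; there all measures are the null
  measure.\<close>

lemma weakly_convergent_subsequence:
  fixes X :: "'a::polish_space set" and \<mu> :: "nat \<Rightarrow> 'a measure"
  assumes X: "compact X" and fin: "\<And>k. finite_measure (\<mu> k)"
    and sets: "\<And>k. sets (\<mu> k) = sets (borel_on X)"
    and mass: "\<And>k. measure (\<mu> k) X = c"
  obtains r \<nu> where "strict_mono (r :: nat \<Rightarrow> nat)" "finite_measure \<nu>" "sets \<nu> = sets (borel_on X)"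
    "\<And>\<phi> :: 'a \<Rightarrow> real. continuous_on X \<phi> \<Longrightarrow> (\<lambda>k. \<integral>x. \<phi> x \<partial>\<mu> (r k)) \<longlonglongrightarrow> (\<integral>x. \<phi> x \<partial>\<nu>)"
proof (cases "c = 0")
  case True
  have sp: "space (\<mu> k) = X" for k using sets by (rule space_eq_borel_on)
  have "\<mu> k = null_measure (borel_on X)" for k
  proof (rule finite_measure_eqI[OF fin])
    show "finite_measure (null_measure (borel_on X))"
      by (intro finite_measureI) simp
    fix A assume "A \<in> sets (\<mu> k)"
    then have "measure (\<mu> k) A \<le> measure (\<mu> k) (space (\<mu> k))"
      by (intro finite_measure.bounded_measure fin)
    then have "measure (\<mu> k) A = 0"
      using mass[of k] True sp[of k] measure_nonneg[of "\<mu> k" A] by simp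
    then show "measure (\<mu> k) A = measure (null_measure (borel_on X)) A"
      by (simp add: measure_def[of "null_measure _"])
  qed (simp add: sets)
  then show thesis
    using fin[of 0] by (intro that[of id "null_measure (borel_on X)"]) (auto simp: strict_mono_id)
next
  case False
  have sp: "space (\<mu> k) = X" for k using sets by (rule space_eq_borel_on)
  have c: "c > 0" using False mass[of 0] measure_nonneg[of "\<mu> 0" X] by linarith
  define \<mu>' where "\<mu>' k = density (\<mu> k) (\<lambda>_. ennreal (1 / c))" for k
  have "prob_space (\<mu>' k)" for k
  proof (rule prob_spaceI)
    have "emeasure (\<mu>' k) (space (\<mu>' k)) = ennreal (1 / c) * emeasure (\<mu> k) X"
      using emeasure_density_const[OF sets.top[of "\<mu> k"]] by (simp add: \<mu>'_def sp)
    also have "\<dots> = 1"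
      using c mass[of k] finite_measure.emeasure_eq_measure[OF fin, of k X]
      by (simp add: ennreal_mult[symmetric])
    finally show "emeasure (\<mu>' k) (space (\<mu>' k)) = 1" .
  qed
  moreover have "sets (\<mu>' k) = sets (borel_on X)" for k
    by (simp add: \<mu>'_def sets)
  ultimately obtain r \<nu> where r: "strict_mono (r :: nat \<Rightarrow> nat)" and \<nu>: "prob_space \<nu>" "sets \<nu> = sets (borel_on X)"
    and lim: "\<And>\<phi> :: 'a \<Rightarrow> real. continuous_on X \<phi> \<Longrightarrow>
      (\<lambda>k. \<integral>x. \<phi> x \<partial>\<mu>' (r k)) \<longlonglongrightarrow> (\<integral>x. \<phi> x \<partial>\<nu>)"
    using prob_weakly_convergent_subsequence[OF X, of \<mu>'] by metis
  define \<nu>' where "\<nu>' = density \<nu> (\<lambda>_. ennreal c)"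
  interpret \<nu>: prob_space \<nu> by fact
  have "finite_measure \<nu>'"
    by (intro finite_measureI)
      (simp add: \<nu>'_def emeasure_density_const \<nu>.emeasure_space_1)
  moreover have "(\<lambda>k. \<integral>x. \<phi> x \<partial>\<mu> (r k)) \<longlonglongrightarrow> (\<integral>x. \<phi> x \<partial>\<nu>')" if \<phi>: "continuous_on X \<phi>" for \<phi> :: "'a \<Rightarrow> real"
  proof -
    have "(\<integral>x. \<phi> x \<partial>\<mu>' k) = (1 / c) * (\<integral>x. \<phi> x \<partial>\<mu> k)" for k
      unfolding \<mu>'_def using c borel_measurable_borel_onI[OF \<phi> sets] by (subst integral_density) auto
    moreover have "(\<integral>x. \<phi> x \<partial>\<nu>') = c * (\<integral>x. \<phi> x \<partial>\<nu>)"
      unfolding \<nu>'_def using c borel_measurable_borel_onI[OF \<phi> \<nu>(2)] by (subst integral_density) auto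
    ultimately show ?thesis
      using tendsto_mult_left[OF lim[OF \<phi>], of c] c by simp
  qed
  ultimately show thesis
    using r \<nu>(2) by (intro that[of r \<nu>']) (auto simp: \<nu>'_def)
qed

section \<open>Kernels and mixtures\<close>

lemma measure_pair_measure_section:
  assumes "finite_measure W" "finite_measure \<mu>" and F: "F \<in> sets (W \<Otimes>\<^sub>M \<mu>)"
  shows "measure (W \<Otimes>\<^sub>M \<mu>) F = (\<integral>z. measure \<mu> (Pair z -` F) \<partial>W)"
proof -
  interpret \<mu>: finite_measure \<mu> by fact
  have meas: "(\<lambda>z. emeasure \<mu> (Pair z -` F)) \<in> borel_measurable W"
    using F by (rule \<mu>.measurable_emeasure_Pair)
  have "measure (W \<Otimes>\<^sub>M \<mu>) F = enn2real (\<integral>\<^sup>+z. emeasure \<mu> (Pair z -` F) \<partial>W)"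
    unfolding measure_def using \<mu>.emeasure_pair_measure_alt[OF F] by simp
  also have "\<dots> = enn2real (\<integral>\<^sup>+z. ennreal (measure \<mu> (Pair z -` F)) \<partial>W)"
    by (simp add: \<mu>.emeasure_eq_measure)
  also have "\<dots> = (\<integral>z. measure \<mu> (Pair z -` F) \<partial>W)"
    by (rule integral_eq_nn_integral[symmetric])
      (use meas in \<open>simp_all add: measure_def borel_measurable_enn2real\<close>)
  finally show ?thesis .
qed

lemma measure_distr_pair:
  assumes "finite_measure W" "finite_measure \<mu>"
    and T: "T \<in> measurable (W \<Otimes>\<^sub>M \<mu>) N" and E: "E \<in> sets N"
  shows "measure (distr (W \<Otimes>\<^sub>M \<mu>) N T) E = (\<integral>z. measure \<mu> {y \<in> space \<mu>. T (z, y) \<in> E} \<partial>W)"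
proof -
  have "measure (distr (W \<Otimes>\<^sub>M \<mu>) N T) E = (\<integral>z. measure \<mu> (Pair z -` (T -` E \<inter> space (W \<Otimes>\<^sub>M \<mu>))) \<partial>W)"
    unfolding measure_distr[OF T E]
    by (rule measure_pair_measure_section[OF assms(1,2) measurable_sets[OF T E]])
  also have "\<dots> = (\<integral>z. measure \<mu> {y \<in> space \<mu>. T (z, y) \<in> E} \<partial>W)"
    by (intro Bochner_Integration.integral_cong arg_cong[where f="measure \<mu>"])
      (auto simp: space_pair_measure)
  finally show ?thesis .
qed

text \<open>Fubini with \<open>W\<close> integrated first. For the Radon transform \<open>W\<close>
  is the law of the directions, and the inner integral is then the adjoint
  \<open>Rd_adj\<close>.\<close>

lemma integral_distr_pair:
  fixes \<phi> :: "_ \<Rightarrow> real"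
  assumes "finite_measure W" "finite_measure \<mu>"
    and T: "T \<in> measurable (W \<Otimes>\<^sub>M \<mu>) N" and \<phi>: "\<phi> \<in> borel_measurable N"
    and B: "\<And>x. x \<in> space N \<Longrightarrow> \<bar>\<phi> x\<bar> \<le> B"
  shows "(\<integral>x. \<phi> x \<partial>distr (W \<Otimes>\<^sub>M \<mu>) N T) = (\<integral>y. \<integral>z. \<phi> (T (z, y)) \<partial>W \<partial>\<mu>)"
proof -
  interpret W: finite_measure W by fact
  interpret \<mu>: finite_measure \<mu> by fact
  interpret pair_sigma_finite W \<mu> ..
  interpret P: finite_measure "W \<Otimes>\<^sub>M \<mu>"
    using assms(2,1) by (rule finite_measure_pair_measure)
  have "integrable (W \<Otimes>\<^sub>M \<mu>) (\<lambda>p. \<phi> (T p))"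
    using measurable_compose[OF T \<phi>] B measurable_space[OF T]
    by (intro P.integrable_const_bound[of _ B]) auto
  then have "(\<integral>y. \<integral>z. \<phi> (T (z, y)) \<partial>W \<partial>\<mu>) = (\<integral>p. \<phi> (T p) \<partial>(W \<Otimes>\<^sub>M \<mu>))"
    by (subst integral_snd) (auto simp: case_prod_beta')
  then show ?thesis by (simp add: integral_distr[OF T \<phi>])
qed

text \<open>Measurability in z and the formula are proved in one induction, because the sum and
  monotone limit steps for the formula use measurability of the inner integrals.\<close>

lemma nn_integral_mixture:
  assumes sets: "\<And>z. z \<in> space W \<Longrightarrow> sets (K z) = sets M"
    and meas: "\<And>A. A \<in> sets M \<Longrightarrow> (\<lambda>z. emeasure (K z) A) \<in> borel_measurable W"
    and mix: "\<And>A. A \<in> sets M \<Longrightarrow> emeasure M A = (\<integral>\<^sup>+z. emeasure (K z) A \<partial>W)"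
    and "f \<in> borel_measurable M"
  shows "(\<lambda>z. \<integral>\<^sup>+x. f x \<partial>K z) \<in> borel_measurable W \<and>
    (\<integral>\<^sup>+x. f x \<partial>M) = (\<integral>\<^sup>+z. \<integral>\<^sup>+x. f x \<partial>K z \<partial>W)"
  using assms(4)
proof (induction rule: borel_measurable_induct)
  case (cong f g)
  have sp: "space (K z) = space M" if "z \<in> space W" for z
    using sets[OF that] by (rule sets_eq_imp_space_eq)
  have "(\<integral>\<^sup>+x. f x \<partial>K z) = (\<integral>\<^sup>+x. g x \<partial>K z)" if "z \<in> space W" for z
    using cong.hyps sp[OF that] by (intro nn_integral_cong) simp
  moreover have "(\<integral>\<^sup>+x. f x \<partial>M) = (\<integral>\<^sup>+x. g x \<partial>M)"
    using cong.hyps by (intro nn_integral_cong) simp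
  ultimately show ?case
    using cong.IH by (simp cong: measurable_cong nn_integral_cong)
next
  case (set A)
  have "(\<integral>\<^sup>+x. indicator A x \<partial>K z) = emeasure (K z) A" if "z \<in> space W" for z
    using set sets[OF that] by simp
  then show ?case
    using set meas[OF set] mix[OF set] by (simp cong: measurable_cong nn_integral_cong)
next
  case (mult u c)
  have "(\<integral>\<^sup>+x. c * u x \<partial>K z) = c * (\<integral>\<^sup>+x. u x \<partial>K z)" if "z \<in> space W" for z
    using mult.hyps measurable_cong_sets[OF sets[OF that] refl] by (intro nn_integral_cmult) blast
  then show ?case
    using mult by (simp add: nn_integral_cmult borel_measurable_times_ennreal cong: measurable_cong nn_integral_cong)
next
  case (add u v)
  have "(\<integral>\<^sup>+x. v x + u x \<partial>K z) = (\<integral>\<^sup>+x. v x \<partial>K z) + (\<integral>\<^sup>+x. u x \<partial>K z)" if "z \<in> space W" for z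
    using add.hyps measurable_cong_sets[OF sets[OF that] refl] by (intro nn_integral_add) blast+
  then show ?case
    using add by (simp add: nn_integral_add borel_measurable_add cong: measurable_cong nn_integral_cong)
next
  case (seq U)
  have "(\<integral>\<^sup>+x. (SUP i. U i) x \<partial>K z) = (SUP i. \<integral>\<^sup>+x. U i x \<partial>K z)" if "z \<in> space W" for z
    unfolding SUP_apply
    using seq.hyps measurable_cong_sets[OF sets[OF that] refl]
    by (intro nn_integral_monotone_convergence_SUP) blast+
  moreover have "incseq (\<lambda>i z. \<integral>\<^sup>+x. U i x \<partial>K z)"
    using seq.hyps by (auto simp: incseq_def le_fun_def intro!: nn_integral_mono)
  moreover have "(\<integral>\<^sup>+x. (SUP i. U i) x \<partial>M) = (SUP i. \<integral>\<^sup>+x. U i x \<partial>M)"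
    unfolding SUP_apply using seq.hyps by (intro nn_integral_monotone_convergence_SUP) blast+
  ultimately show ?case
    using seq.IH
    by (simp add: nn_integral_monotone_convergence_SUP borel_measurable_SUP cong: measurable_cong nn_integral_cong)
qed

text \<open>Used for time averages, whose mixture property is known on sets and is needed for
  integrals. Adding the bound B makes the integrand nonnegative; the mass added in this way is
  itself a mixture and is subtracted at the end.\<close>

lemma integral_mixture:
  fixes \<phi> :: "_ \<Rightarrow> real"
  assumes W: "finite_measure W" and M: "finite_measure M"
    and K: "\<And>z. z \<in> space W \<Longrightarrow> finite_measure (K z)"
    and sets: "\<And>z. z \<in> space W \<Longrightarrow> sets (K z) = sets M"
    and mass: "\<And>z. z \<in> space W \<Longrightarrow> measure (K z) (space M) \<le> c"
    and meas: "\<And>A. A \<in> sets M \<Longrightarrow> (\<lambda>z. measure (K z) A) \<in> borel_measurable W"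
    and mix: "\<And>A. A \<in> sets M \<Longrightarrow> measure M A = (\<integral>z. measure (K z) A \<partial>W)"
    and \<phi>: "\<phi> \<in> borel_measurable M" and B: "\<And>x. x \<in> space M \<Longrightarrow> \<bar>\<phi> x\<bar> \<le> B"
  shows "(\<integral>x. \<phi> x \<partial>M) = (\<integral>z. \<integral>x. \<phi> x \<partial>K z \<partial>W)"
proof -
  interpret W: finite_measure W by fact
  interpret M: finite_measure M by fact
  have sp: "space (K z) = space M" if "z \<in> space W" for z
    using sets[OF that] by (rule sets_eq_imp_space_eq)
  have K_meas: "f \<in> borel_measurable (K z)" if "f \<in> borel_measurable M" "z \<in> space W"
    for f :: "_ \<Rightarrow> real" and z
    using that measurable_cong_sets[OF sets refl] by blast
  have emeas: "(\<lambda>z. emeasure (K z) A) \<in> borel_measurable W" if "A \<in> sets M" for A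
    using meas[OF that] by (simp add: finite_measure.emeasure_eq_measure[OF K] cong: measurable_cong)
  have K_le: "measure (K z) A \<le> c" if "z \<in> space W" for z A
    using finite_measure.bounded_measure[OF K[OF that], of A] mass[OF that] sp[OF that] by simp
  have K_int: "integrable W (\<lambda>z. measure (K z) A)" if "A \<in> sets M" for A
    using meas[OF that] K_le by (intro W.integrable_const_bound[of _ c]) auto
  have emix: "emeasure M A = (\<integral>\<^sup>+z. emeasure (K z) A \<partial>W)" if "A \<in> sets M" for A
  proof -
    have "emeasure M A = ennreal (\<integral>z. measure (K z) A \<partial>W)"
      using mix[OF that] by (simp add: M.emeasure_eq_measure)
    also have "\<dots> = (\<integral>\<^sup>+z. ennreal (measure (K z) A) \<partial>W)"
      by (rule nn_integral_eq_integral[symmetric]) (use K_int[OF that] in auto)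
    finally show ?thesis
      by (simp add: finite_measure.emeasure_eq_measure[OF K] cong: nn_integral_cong)
  qed
  have int_K: "integrable (K z) \<phi>" if "z \<in> space W" for z
    using B K_meas[OF \<phi> that] sp[OF that]
    by (intro finite_measure.integrable_const_bound[OF K[OF that], of _ B]) auto
  have int_M: "integrable M \<phi>"
    using B \<phi> by (intro M.integrable_const_bound[of _ B]) auto
  define f where "f x = \<phi> x + B" for x
  have f_meas: "f \<in> borel_measurable M" unfolding f_def using \<phi> by simp
  have f_nonneg: "0 \<le> f x" "f x \<le> 2 * B" if "x \<in> space M" for x
    using B[OF that] by (auto simp: f_def)
  have nn: "(\<lambda>z. \<integral>\<^sup>+x. ennreal (f x) \<partial>K z) \<in> borel_measurable W"
    "(\<integral>\<^sup>+x. ennreal (f x) \<partial>M) = (\<integral>\<^sup>+z. \<integral>\<^sup>+x. ennreal (f x) \<partial>K z \<partial>W)"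
    using nn_integral_mixture[OF sets emeas emix measurable_compose[OF f_meas measurable_ennreal]]
    by blast+
  have int_Kf: "integrable (K z) f" if "z \<in> space W" for z
    unfolding f_def
    by (intro Bochner_Integration.integrable_add int_K that finite_measure.integrable_const K)
  have nn_K: "(\<integral>\<^sup>+x. ennreal (f x) \<partial>K z) = ennreal (\<integral>x. f x \<partial>K z)" if "z \<in> space W" for z
    using f_nonneg sp[OF that] int_Kf[OF that] by (intro nn_integral_eq_integral) auto
  have Kf_nonneg: "0 \<le> (\<integral>x. f x \<partial>K z)" if "z \<in> space W" for z
    using f_nonneg sp[OF that] by (intro integral_nonneg_AE AE_I2) auto
  have Kf_meas: "(\<lambda>z. \<integral>x. f x \<partial>K z) \<in> borel_measurable W"
  proof -
    have "(\<lambda>z. enn2real (\<integral>\<^sup>+x. ennreal (f x) \<partial>K z)) \<in> borel_measurable W"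
      by (rule measurable_compose[OF nn(1)]) simp
    then show ?thesis
      by (simp add: nn_K Kf_nonneg cong: measurable_cong)
  qed
  have "(\<integral>x. f x \<partial>M) = enn2real (\<integral>\<^sup>+x. ennreal (f x) \<partial>M)"
    using f_meas f_nonneg by (intro integral_eq_nn_integral) auto
  also have "\<dots> = enn2real (\<integral>\<^sup>+z. ennreal (\<integral>x. f x \<partial>K z) \<partial>W)"
    using nn(2) by (simp add: nn_K cong: nn_integral_cong)
  also have "\<dots> = (\<integral>z. \<integral>x. f x \<partial>K z \<partial>W)"
    using Kf_meas Kf_nonneg by (intro integral_eq_nn_integral[symmetric]) auto
  finally have f_eq: "(\<integral>x. f x \<partial>M) = (\<integral>z. \<integral>x. f x \<partial>K z \<partial>W)" .
  have Kf: "(\<integral>x. f x \<partial>K z) = (\<integral>x. \<phi> x \<partial>K z) + B * measure (K z) (space M)" if "z \<in> space W" for z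
    unfolding f_def using sp[OF that]
    by (subst Bochner_Integration.integral_add[OF int_K[OF that] finite_measure.integrable_const[OF K[OF that]]])
      simp
  have "integrable W (\<lambda>z. \<integral>x. f x \<partial>K z)"
  \<comment> \<open>The absolute value is there because B may be negative if \<open>space M\<close>
    is empty.\<close>
  proof (rule W.integrable_const_bound[of _ "2 * \<bar>B\<bar> * c"])
    show "AE z in W. norm (\<integral>x. f x \<partial>K z) \<le> 2 * \<bar>B\<bar> * c"
    proof (rule AE_I2)
      fix z assume z: "z \<in> space W"
      have "f x \<le> 2 * \<bar>B\<bar>" if "x \<in> space M" for x
        using f_nonneg(2)[OF that] by linarith
      then have "(\<integral>x. f x \<partial>K z) \<le> (\<integral>x. 2 * \<bar>B\<bar> \<partial>K z)"
        using sp[OF z] by (intro integral_mono int_Kf[OF z] finite_measure.integrable_const K z) auto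
      also have "\<dots> = 2 * \<bar>B\<bar> * measure (K z) (space M)" using sp[OF z] by simp
      also have "\<dots> \<le> 2 * \<bar>B\<bar> * c" using mass[OF z] by (intro mult_left_mono) auto
      finally show "norm (\<integral>x. f x \<partial>K z) \<le> 2 * \<bar>B\<bar> * c" using Kf_nonneg[OF z] by simp
    qed
  qed (rule Kf_meas)
  moreover have "integrable W (\<lambda>z. B * measure (K z) (space M))"
    using K_int by auto
  ultimately have "(\<integral>z. (\<integral>x. f x \<partial>K z) - B * measure (K z) (space M) \<partial>W) =
      (\<integral>z. \<integral>x. f x \<partial>K z \<partial>W) - B * measure M (space M)"
    using mix[OF sets.top] by simp
  then have "(\<integral>z. \<integral>x. \<phi> x \<partial>K z \<partial>W) = (\<integral>x. f x \<partial>M) - B * measure M (space M)"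
    unfolding f_eq by (simp add: Kf cong: Bochner_Integration.integral_cong)
  also have "\<dots> = (\<integral>x. \<phi> x \<partial>M)"
    unfolding f_def using int_M by simp
  finally show ?thesis by simp
qed

text \<open>Dominated convergence along sequences; continuity of f in each variable separately is
  enough, since the bound B is uniform.\<close>

lemma continuous_on_integral_parameter:
  fixes f :: "'a::metric_space \<Rightarrow> 'b::topological_space \<Rightarrow> real"
  assumes M: "finite_measure M" "sets M = sets (borel_on Y)"
    and f: "\<And>s. s \<in> S \<Longrightarrow> continuous_on Y (f s)" "\<And>y. y \<in> Y \<Longrightarrow> continuous_on S (\<lambda>s. f s y)"
    and B: "\<And>s y. s \<in> S \<Longrightarrow> y \<in> Y \<Longrightarrow> \<bar>f s y\<bar> \<le> B"
  shows "continuous_on S (\<lambda>s. \<integral>y. f s y \<partial>M)"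
  unfolding continuous_on_sequentially comp_def
proof (intro allI ballI impI)
  interpret finite_measure M by fact
  fix s a assume a: "a \<in> S" and s: "(\<forall>n::nat. s n \<in> S) \<and> s \<longlonglongrightarrow> a"
  have sp: "space M = Y" using M(2) by (rule space_eq_borel_on)
  have "(\<lambda>n. f (s n) y) \<longlonglongrightarrow> f a y" if "y \<in> Y" for y
    using f(2)[OF that] a s unfolding continuous_on_sequentially comp_def by blast
  then show "(\<lambda>n. \<integral>y. f (s n) y \<partial>M) \<longlonglongrightarrow> (\<integral>y. f a y \<partial>M)"
    using a s B sp
    by (intro integral_dominated_convergence[where w="\<lambda>_. B"] borel_measurable_borel_onI[OF f(1) M(2)]) auto
qed

text \<open>At a point of the support the neighbourhoods are not null sets, for which
  \<open>uniform_measure\<close> is a junk value.\<close>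

lemma integral_uniform_ball_tendsto:
  fixes a :: "'a::metric_space \<Rightarrow> real"
  assumes H: "finite_measure H" "sets H = sets (borel_on Z)" and z: "z \<in> msupport H"
    and a: "continuous_on Z a" and bdd: "\<And>s. s \<in> Z \<Longrightarrow> \<bar>a s\<bar> \<le> B"
  shows "(\<lambda>k. \<integral>s. a s \<partial>uniform_measure H (Z \<inter> ball z (1 / Suc k))) \<longlonglongrightarrow> a z"
proof (rule LIMSEQ_I)
  fix e :: real assume "0 < e"
  interpret finite_measure H by fact
  have sp: "space H = Z" using H(2) by (rule space_eq_borel_on)
  have zZ: "z \<in> Z" using z sp by (simp add: msupport_def)
  \<comment> \<open>Half of e, because averaging turns the strict bound into a non-strict
    one.\<close>
  obtain d where d: "d > 0" "\<And>s. s \<in> Z \<Longrightarrow> dist s z < d \<Longrightarrow> \<bar>a s - a z\<bar> < e / 2"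
    using a zZ \<open>0 < e\<close> unfolding continuous_on_iff dist_real_def by (metis half_gt_zero)
  obtain k0 :: nat where k0: "1 / Suc k0 < d" using d(1) nat_approx_posE by blast
  have "norm ((\<integral>s. a s \<partial>uniform_measure H (Z \<inter> ball z (1 / Suc k))) - a z) < e" if "k \<ge> k0" for k
  proof -
    let ?B = "Z \<inter> ball z (1 / Suc k)"
    have B: "?B \<in> sets H" by (simp add: H(2) sets_restrict_space)
    have pos: "emeasure H ?B > 0"
      using z unfolding msupport_def sp Int_commute[of Z]
      by (auto elim!: allE[of _ "ball z (1 / Suc k)"])
    interpret U: prob_space "uniform_measure H ?B"
      using pos by (intro prob_space_uniform_measure) auto
    have "1 / real (Suc k) \<le> 1 / Suc k0" using that by (simp add: frac_le)
    then have "\<bar>a s - a z\<bar> < e / 2" if "s \<in> ?B" for s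
      using that d(2)[of s] k0 by (simp add: dist_commute)
    then have close: "AE s in uniform_measure H ?B. \<bar>a s - a z\<bar> < e / 2"
      using B by (intro AE_uniform_measureI) auto
    have int: "integrable (uniform_measure H ?B) a"
      using bdd borel_measurable_borel_onI[OF a] H(2)
      by (intro U.integrable_const_bound[of _ B]) (auto simp: sp)
    have "AE s in uniform_measure H ?B. a s \<le> a z + e / 2"
      using close by eventually_elim linarith
    then have "(\<integral>s. a s \<partial>uniform_measure H ?B) \<le> a z + e / 2"
      by (intro U.integral_le_const int)
    moreover have "AE s in uniform_measure H ?B. a z - e / 2 \<le> a s"
      using close by eventually_elim linarith
    then have "(\<integral>s. a s \<partial>uniform_measure H ?B) \<ge> a z - e / 2"
      by (intro U.integral_ge_const int)
    ultimately show ?thesis using \<open>0 < e\<close> by (simp add: abs_le_iff abs_less_iff)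
  qed
  then show "\<exists>k0. \<forall>k\<ge>k0. norm ((\<integral>s. a s \<partial>uniform_measure H (Z \<inter> ball z (1 / Suc k))) - a z) < e"
    by blast
qed

text \<open>Rectangles form an intersection-stable generator, and a section of A \<times> C is A or
  empty according to whether z lies in C. Finiteness of the kernel handles complements.\<close>

lemma borel_measurable_kernel_section:
  assumes K: "\<And>z. z \<in> space W \<Longrightarrow> finite_measure (K z)"
      "\<And>z. z \<in> space W \<Longrightarrow> sets (K z) = sets N"
    and meas: "\<And>A. A \<in> sets N \<Longrightarrow> (\<lambda>z. measure (K z) A) \<in> borel_measurable W"
    and Q: "Q \<in> sets (N \<Otimes>\<^sub>M W)"
  shows "(\<lambda>z. measure (K z) {x. (x, z) \<in> Q}) \<in> borel_measurable W"
  using Int_stable_pair_measure_generator pair_measure_closed Q[unfolded sets_pair_measure]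
proof (induction rule: sigma_sets_induct_disjoint)
  case (basic Q)
  then obtain A C where AC: "Q = A \<times> C" "A \<in> sets N" "C \<in> sets W" by blast
  have "measure (K z) {x. (x, z) \<in> Q} = measure (K z) A * indicator C z" for z
    by (auto simp: AC indicator_def)
  then show ?case using meas[OF AC(2)] AC(3) by simp
next
  case (compl Q)
  have sp: "space (K z) = space N" if "z \<in> space W" for z
    using K(2)[OF that] by (rule sets_eq_imp_space_eq)
  have "measure (K z) {x. (x, z) \<in> space N \<times> space W - Q} =
      measure (K z) (space N) - measure (K z) {x. (x, z) \<in> Q}" if z: "z \<in> space W" for z
  proof -
    have Q: "Q \<in> sets (N \<Otimes>\<^sub>M W)" using compl.hyps by (simp add: sets_pair_measure)
    have "{x. (x, z) \<in> Q} = (\<lambda>x. (x, z)) -` Q" by auto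
    then have "{x. (x, z) \<in> Q} \<in> sets (K z)"
      using sets_Pair2[OF Q, of z] K(2)[OF z] by simp
    moreover have "{x. (x, z) \<in> space N \<times> space W - Q} = space N - {x. (x, z) \<in> Q}" using z by auto
    ultimately show ?thesis
      using finite_measure.finite_measure_compl[OF K(1)[OF z]] sp[OF z] by metis
  qed
  then show ?case
    using compl.IH meas[OF sets.top] by (simp cong: measurable_cong)
next
  case (union Q)
  have "measure (K z) {x. (x, z) \<in> (\<Union>i. Q i)} = (\<Sum>i. measure (K z) {x. (x, z) \<in> Q i})"
    if z: "z \<in> space W" for z
  proof -
    have "{x. (x, z) \<in> Q i} \<in> sets (K z)" for i
    proof -
      have Q: "Q i \<in> sets (N \<Otimes>\<^sub>M W)" using union.hyps by (auto simp: sets_pair_measure)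
      have "{x. (x, z) \<in> Q i} = (\<lambda>x. (x, z)) -` Q i" by auto
      then show ?thesis using sets_Pair2[OF Q, of z] K(2)[OF z] by simp
    qed
    moreover have "disjoint_family (\<lambda>i. {x. (x, z) \<in> Q i})"
      using union.hyps by (auto simp: disjoint_family_on_def)
    ultimately have "(\<lambda>i. measure (K z) {x. (x, z) \<in> Q i}) sums measure (K z) (\<Union>i. {x. (x, z) \<in> Q i})"
      by (intro finite_measure.finite_measure_UNION K z) auto
    moreover have "(\<Union>i. {x. (x, z) \<in> Q i}) = {x. (x, z) \<in> (\<Union>i. Q i)}" by auto
    ultimately show ?thesis by (simp add: sums_iff)
  qed
  then show ?case
    using borel_measurable_suminf[OF union.IH] by (simp cong: measurable_cong)
qed simp

lemma integral_uniform_measure: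
  fixes f :: "'a \<Rightarrow> real"
  assumes "finite_measure H" and B: "B \<in> sets H" "measure H B > 0" and f: "f \<in> borel_measurable H"
  shows "(\<integral>x. f x \<partial>uniform_measure H B) = (\<integral>x. indicator B x * f x \<partial>H) / measure H B"
proof -
  interpret finite_measure H by fact
  have eq: "uniform_measure H B = density H (\<lambda>x. ennreal (indicator B x / measure H B))"
    unfolding uniform_measure_def using B(2)
    by (auto intro!: arg_cong2[where f=density] simp: emeasure_eq_measure indicator_def divide_ennreal
        simp flip: ennreal_1)
  have "(\<lambda>x. indicator B x / measure H B :: real) \<in> borel_measurable H"
    using B by simp
  then show ?thesis
    unfolding eq using f by (subst integral_density) (auto simp: mult.commute)
qed

section \<open>Slices, rectangles and products on Borel subspaces\<close>

lemma sections_borel_on: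
  fixes X :: "'a::second_countable_topology set" and Y :: "'b::second_countable_topology set"
  assumes E: "E \<in> sets (borel_on (X \<times> Y))"
  shows section_left_borel_on: "{y. (x, y) \<in> E} \<in> sets (borel_on Y)"
    and section_right_borel_on: "{x. (x, y) \<in> E} \<in> sets (borel_on X)"
proof -
  have E': "E \<in> sets (borel_on X \<Otimes>\<^sub>M borel_on Y)"
    using E by (simp add: sets_borel_on_times)
  show "{y. (x, y) \<in> E} \<in> sets (borel_on Y)"
    using sets_Pair1[OF E', of x] by (simp add: vimage_def)
  show "{x. (x, y) \<in> E} \<in> sets (borel_on X)"
    using sets_Pair2[OF E', of y] by (simp add: vimage_def)
qed

lemma Times_borel_on:
  fixes X :: "'a::second_countable_topology set" and Y :: "'b::second_countable_topology set"
  assumes "A \<in> sets (borel_on X)" "B \<in> sets (borel_on Y)"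
  shows "A \<times> B \<in> sets (borel_on (X \<times> Y))"
  using pair_measureI[OF assms] by (simp add: sets_borel_on_times)

lemma vimage_borel_on:
  assumes "continuous_on X f" "f \<in> X \<rightarrow> Y" "E \<in> sets (borel_on Y)"
  shows "f -` E \<inter> X \<in> sets (borel_on X)"
  using measurable_sets[OF measurable_borel_onI[OF assms(1,2)] assms(3)]
  by (simp add: space_restrict_space)

lemma borel_on_subset: "A \<in> sets (borel_on X) \<Longrightarrow> A \<subseteq> X"
  using sets.sets_into_space[of A "borel_on X"] by (simp add: space_restrict_space)

text \<open>Restriction of u to the times in B, projected to space. With c = 1 it serves the
  injectivity of \<open>Rd_bar\<close>, with c the reciprocal of the mass of B it is the time
  average over B.\<close>

lemma slice_in_nonneg_measures:
  fixes X :: "'a::second_countable_topology set" and Z :: "'b::second_countable_topology set"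
  assumes u: "u \<in> nonneg_measures (X \<times> Z)" and B: "B \<in> sets (borel_on Z)" and c: "0 \<le> c"
  shows "(\<lambda>A. if A \<in> sets (borel_on X) then c * u (A \<times> B) else 0) \<in> nonneg_measures X"
  unfolding nonneg_measures_def signed_measures_def mem_Collect_eq
proof (intro conjI allI impI)
  fix A :: "nat \<Rightarrow> 'a set"
  assume A: "range A \<subseteq> sets (borel_on X)" "disjoint_family A"
  have "range (\<lambda>i. A i \<times> B) \<subseteq> sets (borel_on (X \<times> Z))"
    using A(1) B by (auto intro!: Times_borel_on)
  moreover have "disjoint_family (\<lambda>i. A i \<times> B)"
    using A(2) by (auto simp: disjoint_family_on_def)
  ultimately have "(\<lambda>i. u (A i \<times> B)) sums u (\<Union>i. A i \<times> B)"
    using u by (simp add: nonneg_measures_def signed_measures_def)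
  moreover have "(\<Union>i. A i \<times> B) = (\<Union>i. A i) \<times> B" by auto
  moreover have "A i \<in> sets (borel_on X)" for i using A(1) by auto
  moreover have "(\<Union>i. A i) \<in> sets (borel_on X)" using A(1) by blast
  ultimately show "(\<lambda>i. if A i \<in> sets (borel_on X) then c * u (A i \<times> B) else 0) sums
      (if (\<Union>i. A i) \<in> sets (borel_on X) then c * u ((\<Union>i. A i) \<times> B) else 0)"
    using sums_mult[of "\<lambda>i. u (A i \<times> B)" _ c] by simp
qed (use u c in \<open>auto simp: nonneg_measures_def\<close>)

lemma nonneg_measures_eqI_rectangles:
  fixes X :: "'a::second_countable_topology set" and Z :: "'b::second_countable_topology set"
  assumes u: "u \<in> nonneg_measures (X \<times> Z)" and v: "v \<in> nonneg_measures (X \<times> Z)"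
    and eq: "\<And>A B. A \<in> sets (borel_on X) \<Longrightarrow> B \<in> sets (borel_on Z) \<Longrightarrow> u (A \<times> B) = v (A \<times> B)"
  shows "u = v"
proof -
  obtain \<mu> where \<mu>: "finite_measure \<mu>" "sets \<mu> = sets (borel_on (X \<times> Z))" "u = measure \<mu>"
    using nonneg_measures_ex_measure[OF u] by blast
  obtain \<nu> where \<nu>: "finite_measure \<nu>" "sets \<nu> = sets (borel_on (X \<times> Z))" "v = measure \<nu>"
    using nonneg_measures_ex_measure[OF v] by blast
  let ?G = "{A \<times> B | A B. A \<in> sets (borel_on X) \<and> B \<in> sets (borel_on Z)}"
  have gen: "sets (borel_on (X \<times> Z)) = sigma_sets (X \<times> Z) ?G"
    unfolding sets_borel_on_times[symmetric] sets_pair_measure by (simp add: space_restrict_space)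
  have "\<mu> = \<nu>"
  proof (rule measure_eqI_generator_eq)
    show "Int_stable ?G" by (rule Int_stable_pair_measure_generator)
    show "?G \<subseteq> Pow (X \<times> Z)" by (auto dest: borel_on_subset)
    show "sets \<mu> = sigma_sets (X \<times> Z) ?G" "sets \<nu> = sigma_sets (X \<times> Z) ?G"
      using \<mu> \<nu> gen by auto
    show "emeasure \<mu> E = emeasure \<nu> E" if "E \<in> ?G" for E
      using that eq \<mu> \<nu> by (auto simp: finite_measure.emeasure_eq_measure)
    show "range (\<lambda>i::nat. X \<times> Z) \<subseteq> ?G"
      using sets.top[of "borel_on X"] sets.top[of "borel_on Z"] by (auto simp: space_restrict_space)
    show "emeasure \<mu> (X \<times> Z) \<noteq> \<infinity>"
      using \<mu> by (simp add: finite_measure.emeasure_eq_measure)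
  qed simp
  then show ?thesis using \<mu> \<nu> by simp
qed

lemma borel_measurable_kernel_section_borel_on:
  fixes Y :: "'y::second_countable_topology set" and Z :: "'z::second_countable_topology set"
  assumes W: "sets W = sets (borel_on Z)"
    and K: "\<And>z. z \<in> Z \<Longrightarrow> finite_measure (K z)" "\<And>z. z \<in> Z \<Longrightarrow> sets (K z) = sets (borel_on Y)"
    and meas: "\<And>A. A \<in> sets (borel_on Y) \<Longrightarrow> (\<lambda>z. measure (K z) A) \<in> borel_measurable W"
    and E: "E \<in> sets (borel_on (Y \<times> Z))"
  shows "(\<lambda>z. measure (K z) {y. (y, z) \<in> E}) \<in> borel_measurable W"
proof (rule borel_measurable_kernel_section[where N="borel_on Y"])
  show "E \<in> sets (borel_on Y \<Otimes>\<^sub>M W)"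
    using E sets_pair_borel_on[OF refl W] by blast
qed (use K meas space_eq_borel_on[OF W] in auto)

text \<open>Countable additivity is dominated convergence: the sections of disjoint sets are
  disjoint, so all partial sums of their measures stay below the uniform mass bound c.\<close>

lemma prod_left_in_nonneg_measures:
  fixes Y :: "'y::second_countable_topology set" and Z :: "'z::second_countable_topology set"
  assumes W: "finite_measure W" "sets W = sets (borel_on Z)"
    and K: "\<And>z. z \<in> Z \<Longrightarrow> finite_measure (K z)" "\<And>z. z \<in> Z \<Longrightarrow> sets (K z) = sets (borel_on Y)"
    and mass: "\<And>z. z \<in> Z \<Longrightarrow> measure (K z) Y \<le> c"
    and meas: "\<And>A. A \<in> sets (borel_on Y) \<Longrightarrow> (\<lambda>z. measure (K z) A) \<in> borel_measurable W"
  shows "prod_left Y (\<lambda>z. measure (K z)) W \<in> nonneg_measures (Y \<times> Z)"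
proof -
  interpret W: finite_measure W by fact
  have spW: "space W = Z" using W(2) by (rule space_eq_borel_on)
  have sp: "space (K z) = Y" if "z \<in> Z" for z using K(2)[OF that] by (rule space_eq_borel_on)
  have le: "measure (K z) A \<le> c" if "z \<in> Z" for z A
    using finite_measure.bounded_measure[OF K(1)[OF that], of A] mass[OF that] sp[OF that] by simp
  have sec_meas: "(\<lambda>z. measure (K z) {y. (y, z) \<in> E}) \<in> borel_measurable W"
    if "E \<in> sets (borel_on (Y \<times> Z))" for E
    using borel_measurable_kernel_section_borel_on[OF W(2) K meas that] .
  show ?thesis
    unfolding nonneg_measures_def signed_measures_def mem_Collect_eq
  proof (intro conjI allI impI)
    fix A :: "nat \<Rightarrow> ('y \<times> 'z) set"
    assume A: "range A \<subseteq> sets (borel_on (Y \<times> Z))" "disjoint_family A"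
    have Ai: "A i \<in> sets (borel_on (Y \<times> Z))" for i using A(1) by auto
    have UA: "(\<Union>i. A i) \<in> sets (borel_on (Y \<times> Z))" using A(1) by blast
    define a where "a i z = measure (K z) {y. (y, z) \<in> A i}" for i z
    have a_sums: "(\<lambda>i. a i z) sums measure (K z) {y. (y, z) \<in> (\<Union>i. A i)}" if z: "z \<in> Z" for z
    proof -
      have "(\<lambda>i. measure (K z) {y. (y, z) \<in> A i}) sums measure (K z) (\<Union>i. {y. (y, z) \<in> A i})"
        using A(2) section_right_borel_on[OF Ai] K(2)[OF z]
        by (intro finite_measure.finite_measure_UNION K z) (auto simp: disjoint_family_on_def)
      moreover have "(\<Union>i. {y. (y, z) \<in> A i}) = {y. (y, z) \<in> (\<Union>i. A i)}" by auto
      ultimately show ?thesis by (simp add: a_def)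
    qed
    have a_meas: "a i \<in> borel_measurable W" for i
      unfolding a_def using sec_meas[OF Ai] .
    have a_int: "integrable W (a i)" for i
      using a_meas le by (intro W.integrable_const_bound[of _ c]) (auto simp: a_def spW)
    have "(\<lambda>n. \<integral>z. (\<Sum>i<n. a i z) \<partial>W) \<longlonglongrightarrow> (\<integral>z. measure (K z) {y. (y, z) \<in> (\<Union>i. A i)} \<partial>W)"
    proof (rule integral_dominated_convergence[where w="\<lambda>_. c"])
      show "(\<lambda>z. measure (K z) {y. (y, z) \<in> (\<Union>i. A i)}) \<in> borel_measurable W"
        using sec_meas[OF UA] .
      show "AE z in W. (\<lambda>n. \<Sum>i<n. a i z) \<longlonglongrightarrow> measure (K z) {y. (y, z) \<in> (\<Union>i. A i)}"
        using a_sums by (intro AE_I2) (simp add: spW sums_def)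
      show "AE z in W. norm (\<Sum>i<n. a i z) \<le> c" for n
      proof (rule AE_I2)
        fix z assume "z \<in> space W"
        then have z: "z \<in> Z" by (simp add: spW)
        have "(\<Sum>i<n. a i z) \<le> measure (K z) {y. (y, z) \<in> (\<Union>i. A i)}"
          unfolding sums_unique[OF a_sums[OF z]]
          by (intro sum_le_suminf sums_summable[OF a_sums[OF z]]) (auto simp: a_def)
        also have "\<dots> \<le> c" using le[OF z] .
        finally show "norm (\<Sum>i<n. a i z) \<le> c" by (simp add: sum_nonneg a_def)
      qed
    qed (use a_meas in auto)
    then have "(\<lambda>i. \<integral>z. a i z \<partial>W) sums (\<integral>z. measure (K z) {y. (y, z) \<in> (\<Union>i. A i)} \<partial>W)"
      using a_int by (simp add: sums_def)
    then show "(\<lambda>i. prod_left Y (\<lambda>z. measure (K z)) W (A i)) sums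
        prod_left Y (\<lambda>z. measure (K z)) W (\<Union>i. A i)"
      using Ai UA by (simp add: prod_left_def spW a_def)
  qed (auto simp: prod_left_def spW)
qed

lemma prod_left_cong:
  assumes "\<And>z. z \<in> space W \<Longrightarrow> K z = L z"
  shows "prod_left Y K W = prod_left Y L W"
  unfolding prod_left_def using assms
  by (intro ext if_cong refl Bochner_Integration.integral_cong) simp

lemma compact_continuous_bounded:
  fixes \<phi> :: "'a::topological_space \<Rightarrow> real"
  assumes "compact X" "continuous_on X \<phi>"
  obtains B where "\<And>x. x \<in> X \<Longrightarrow> \<bar>\<phi> x\<bar> \<le> B"
  using compact_imp_bounded[OF compact_continuous_image[OF assms(2,1)]]
  unfolding bounded_iff by (auto simp: real_norm_def)

text \<open>Prepares the sub-subsequence principle: a subsequence that stays away from l is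
  contradicted by compactness once every possible limit is known to be l.\<close>

lemma not_LIMSEQ_subseq:
  fixes a :: "nat \<Rightarrow> 'a::metric_space"
  assumes "\<not> a \<longlonglongrightarrow> l"
  obtains e r where "e > 0" "strict_mono (r :: nat \<Rightarrow> nat)" "\<And>k. e \<le> dist (a (r k)) l"
proof -
  obtain e where e: "e > 0" "\<And>N. \<exists>n\<ge>N. e \<le> dist (a n) l"
    using assms unfolding lim_sequentially by (meson not_le)
  then have "infinite {n. e \<le> dist (a n) l}"
    unfolding infinite_nat_iff_unbounded_le by auto
  then obtain r :: "nat \<Rightarrow> nat" where "strict_mono r" "\<And>k. r k \<in> {n. e \<le> dist (a n) l}"
    using infinite_enumerate by blast
  with e(1) that show thesis by blast
qed

section \<open>The Radon transform and the move operator\<close>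

locale radon_setting =
  fixes \<Omega> \<Theta> :: "(real^'n) set" and \<Sigma> :: "real set"
    and H\<Sigma> :: "real measure" and H\<Theta> :: "(real^'n) measure"
  assumes compact_\<Omega>: "compact \<Omega>" and compact_\<Sigma>: "compact \<Sigma>" and compact_\<Theta>: "compact \<Theta>"
    and prob_\<Sigma>: "prob_space H\<Sigma>" and sets_\<Sigma>: "sets H\<Sigma> = sets (borel_on \<Sigma>)"
    and supp_\<Sigma>: "msupport H\<Sigma> = \<Sigma>"
    and prob_\<Theta>: "prob_space H\<Theta>" and sets_\<Theta>: "sets H\<Theta> = sets (borel_on \<Theta>)"
    and inj_Rd: "inj_on (Rd \<Omega> \<Theta> H\<Theta>) (signed_measures \<Omega>)"
begin

abbreviation "\<Xi> \<equiv> Xi \<Omega> \<Theta>"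
abbreviation "\<Gamma> \<equiv> Gam \<Omega> \<Sigma> \<Theta>"

sublocale S: prob_space H\<Sigma> by (rule prob_\<Sigma>)
sublocale T: prob_space H\<Theta> by (rule prob_\<Theta>)

lemma space_\<Sigma>: "space H\<Sigma> = \<Sigma>" using sets_\<Sigma> by (rule space_eq_borel_on)
lemma space_\<Theta>: "space H\<Theta> = \<Theta>" using sets_\<Theta> by (rule space_eq_borel_on)

lemma compact_\<Theta>\<Xi>: "compact (\<Theta> \<times> \<Xi>)"
proof -
  have "\<Xi> = (\<lambda>(\<theta>, x). \<theta> \<bullet> x) ` (\<Theta> \<times> \<Omega>)" by (force simp: Xi_def)
  moreover have "continuous_on (\<Theta> \<times> \<Omega>) (\<lambda>(\<theta>, x). \<theta> \<bullet> x)"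
    unfolding case_prod_beta' by (intro continuous_intros)
  ultimately have "compact \<Xi>"
    using compact_continuous_image compact_Times[OF compact_\<Theta> compact_\<Omega>] by metis
  then show ?thesis using compact_Times[OF compact_\<Theta>] by blast
qed

lemma Xi_I: "\<theta> \<in> \<Theta> \<Longrightarrow> x \<in> \<Omega> \<Longrightarrow> \<theta> \<bullet> x \<in> \<Xi>"
  by (auto simp: Xi_def)

lemma Gam_move: "(x, v) \<in> \<Gamma> \<Longrightarrow> t \<in> \<Sigma> \<Longrightarrow> x + t * v \<in> \<Xi>"
  by (force simp: Gam_def Lam_def Xi_def inner_add_right)

lemma Rd_apply:
  assumes E: "E \<in> sets (borel_on (\<Theta> \<times> \<Xi>))"
  shows "Rd \<Omega> \<Theta> H\<Theta> \<nu> E = (\<integral>\<theta>. \<nu> {x \<in> \<Omega>. (\<theta>, \<theta> \<bullet> x) \<in> E} \<partial>H\<Theta>)"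
  using E section_left_borel_on[OF E]
  by (simp add: Rd_def prod_right_def Rd_dir_def pushforward_def space_\<Theta> vimage_def Int_def conj_commute)

lemma Rd_bar_apply:
  assumes E: "E \<in> sets (borel_on (\<Theta> \<times> \<Xi> \<times> \<Sigma>))"
  shows "Rd_bar \<Omega> \<Sigma> \<Theta> H\<Theta> u E = (\<integral>\<theta>. u {(x, t). x \<in> \<Omega> \<and> t \<in> \<Sigma> \<and> (\<theta>, \<theta> \<bullet> x, t) \<in> E} \<partial>H\<Theta>)"
proof -
  have "(\<lambda>(x, t). (\<theta> \<bullet> x, t)) -` {y. (\<theta>, y) \<in> E} \<inter> \<Omega> \<times> \<Sigma> =
      {(x, t). x \<in> \<Omega> \<and> t \<in> \<Sigma> \<and> (\<theta>, \<theta> \<bullet> x, t) \<in> E}" for \<theta>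
    by auto
  then show ?thesis
    using E section_left_borel_on[OF E]
    by (simp add: Rd_bar_def prod_right_def Rd_bar_dir_def pushforward_def space_\<Theta>)
qed

lemma Mv_bar_apply:
  assumes E: "E \<in> sets (borel_on (\<Theta> \<times> \<Xi> \<times> \<Sigma>))"
  shows "Mv_bar \<Omega> \<Sigma> \<Theta> H\<Sigma> \<gamma> E = (\<integral>t. Mv_dir \<Omega> \<Sigma> \<Theta> t \<gamma> {(\<theta>, s). (\<theta>, s, t) \<in> E} \<partial>H\<Sigma>)"
proof -
  let ?g = "\<lambda>((\<theta>, s), t). (\<theta>, s, t) :: (real^'n) \<times> real \<times> real"
  have "?g -` E \<inter> (\<Theta> \<times> \<Xi>) \<times> \<Sigma> \<in> sets (borel_on ((\<Theta> \<times> \<Xi>) \<times> \<Sigma>))"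
    by (rule vimage_borel_on[OF _ _ E]) (auto simp: case_prod_beta' intro!: continuous_intros)
  moreover have "{y. (y, t) \<in> ?g -` E \<inter> (\<Theta> \<times> \<Xi>) \<times> \<Sigma>} = {(\<theta>, s). (\<theta>, s, t) \<in> E}" for t
    using borel_on_subset[OF E] by auto
  ultimately show ?thesis
    using E by (simp add: Mv_bar_def pushforward_def prod_left_def space_\<Sigma>)
qed

text \<open>With \<open>MvM\<close>, the counterpart of \<open>Rd\<close> and \<open>Mv_dir\<close>
  on library measures. The fibrewise product with \<open>H\<Theta>\<close> is written as one
  pushforward of a product measure, so that Fubini and change of variables apply.\<close>

definition RdM :: "(real^'n) measure \<Rightarrow> ((real^'n) \<times> real) measure" where
  "RdM \<mu> = distr (H\<Theta> \<Otimes>\<^sub>M \<mu>) (borel_on (\<Theta> \<times> \<Xi>)) (\<lambda>(\<theta>, x). (\<theta>, \<theta> \<bullet> x))"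

definition MvM :: "real \<Rightarrow> ((real^'n) \<times> real \<times> real) measure \<Rightarrow> ((real^'n) \<times> real) measure" where
  "MvM t \<gamma> = distr \<gamma> (borel_on (\<Theta> \<times> \<Xi>)) (\<lambda>(\<theta>, x, v). (\<theta>, x + t * v))"

text \<open>Backprojection, the formal adjoint of the Radon transform: \<phi> paired with
  \<open>RdM \<mu>\<close> equals \<open>Rd_adj \<phi>\<close> paired with \<mu>.\<close>

definition Rd_adj :: "((real^'n) \<times> real \<Rightarrow> real) \<Rightarrow> (real^'n) \<Rightarrow> real" where
  "Rd_adj \<phi> x = (\<integral>\<theta>. \<phi> (\<theta>, \<theta> \<bullet> x) \<partial>H\<Theta>)"

lemma sets_RdM: "sets (RdM \<mu>) = sets (borel_on (\<Theta> \<times> \<Xi>))"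
  and sets_MvM: "sets (MvM t \<gamma>) = sets (borel_on (\<Theta> \<times> \<Xi>))"
  by (simp_all add: RdM_def MvM_def)

lemma space_RdM: "space (RdM \<mu>) = \<Theta> \<times> \<Xi>"
  by (simp add: RdM_def space_restrict_space)

section \<open>The Radon transform of a finite measure\<close>

context
  fixes \<mu> :: "(real^'n) measure"
  assumes \<mu>: "finite_measure \<mu>" "sets \<mu> = sets (borel_on \<Omega>)"
begin

lemma Rd_measurable:
  "(\<lambda>(\<theta>, x). (\<theta>, \<theta> \<bullet> x)) \<in> measurable (H\<Theta> \<Otimes>\<^sub>M \<mu>) (borel_on (\<Theta> \<times> \<Xi>))"
proof -
  have "(\<lambda>(\<theta>, x). (\<theta>, \<theta> \<bullet> x)) \<in> measurable (borel_on (\<Theta> \<times> \<Omega>)) (borel_on (\<Theta> \<times> \<Xi>))"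
    by (rule measurable_borel_onI) (auto simp: case_prod_beta' Xi_I intro!: continuous_intros)
  then show ?thesis
    using measurable_cong_sets[OF sets_pair_borel_on[OF sets_\<Theta> \<mu>(2)] refl] by blast
qed

lemma finite_measure_RdM: "finite_measure (RdM \<mu>)"
  unfolding RdM_def
  using finite_measure_pair_measure[OF \<mu>(1) T.finite_measure_axioms] Rd_measurable
  by (rule finite_measure.finite_measure_distr)

lemma measure_RdM:
  assumes "E \<in> sets (borel_on (\<Theta> \<times> \<Xi>))"
  shows "measure (RdM \<mu>) E = (\<integral>\<theta>. measure \<mu> {x \<in> \<Omega>. (\<theta>, \<theta> \<bullet> x) \<in> E} \<partial>H\<Theta>)"
  unfolding RdM_def measure_distr_pair[OF T.finite_measure_axioms \<mu>(1) Rd_measurable assms]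
  by (simp add: space_eq_borel_on[OF \<mu>(2)])

lemma Rd_measure: "Rd \<Omega> \<Theta> H\<Theta> (measure \<mu>) = measure (RdM \<mu>)"
proof
  fix E show "Rd \<Omega> \<Theta> H\<Theta> (measure \<mu>) E = measure (RdM \<mu>) E"
  proof (cases "E \<in> sets (borel_on (\<Theta> \<times> \<Xi>))")
    case True
    then show ?thesis by (simp add: Rd_apply measure_RdM)
  next
    case False
    then show ?thesis
      by (simp add: Rd_def prod_right_def space_\<Theta> measure_notin_sets sets_RdM)
  qed
qed

text \<open>For each direction the section of the full target is all of \<Omega>, and
  \<open>H\<Theta>\<close> has mass 1. Masses can therefore be read off after the transform, which
  provides the fixed mass for compactness.\<close>

lemma mass_RdM: "measure (RdM \<mu>) (\<Theta> \<times> \<Xi>) = measure \<mu> \<Omega>"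
proof -
  have "measure (RdM \<mu>) (\<Theta> \<times> \<Xi>) = (\<integral>\<theta>. measure \<mu> {x \<in> \<Omega>. (\<theta>, \<theta> \<bullet> x) \<in> \<Theta> \<times> \<Xi>} \<partial>H\<Theta>)"
    using sets.top[of "borel_on (\<Theta> \<times> \<Xi>)"] by (intro measure_RdM) (simp add: space_restrict_space)
  also have "\<dots> = (\<integral>\<theta>. measure \<mu> \<Omega> \<partial>H\<Theta>)"
    by (intro Bochner_Integration.integral_cong refl arg_cong[where f="measure \<mu>"])
      (auto simp: space_\<Theta> Xi_I)
  finally show ?thesis by (simp add: T.prob_space)
qed

lemma integral_RdM:
  assumes \<phi>: "continuous_on (\<Theta> \<times> \<Xi>) \<phi>"
  shows "(\<integral>p. \<phi> p \<partial>RdM \<mu>) = (\<integral>x. Rd_adj \<phi> x \<partial>\<mu>)"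
proof -
  obtain B where "\<And>p. p \<in> \<Theta> \<times> \<Xi> \<Longrightarrow> \<bar>\<phi> p\<bar> \<le> B"
    using compact_continuous_bounded[OF compact_\<Theta>\<Xi> \<phi>] by blast
  then show ?thesis
    unfolding RdM_def Rd_adj_def
    by (subst integral_distr_pair[OF T.finite_measure_axioms \<mu>(1) Rd_measurable
          borel_measurable_continuous_on_restrict[OF \<phi>], of B])
      (auto simp: space_restrict_space)
qed

end

lemma RdM_inj:
  assumes \<mu>: "finite_measure \<mu>" "sets \<mu> = sets (borel_on \<Omega>)"
    and \<nu>: "finite_measure \<nu>" "sets \<nu> = sets (borel_on \<Omega>)"
    and eq: "RdM \<mu> = RdM \<nu>"
  shows "\<mu> = \<nu>"
proof -
  have "Rd \<Omega> \<Theta> H\<Theta> (measure \<mu>) = Rd \<Omega> \<Theta> H\<Theta> (measure \<nu>)"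
    by (simp add: Rd_measure[OF \<mu>] Rd_measure[OF \<nu>] eq)
  moreover have "measure \<mu> \<in> signed_measures \<Omega>" "measure \<nu> \<in> signed_measures \<Omega>"
    using measure_in_nonneg_measures[OF \<mu>] measure_in_nonneg_measures[OF \<nu>]
    by (auto simp: nonneg_measures_def)
  ultimately have "measure \<mu> = measure \<nu>"
    using inj_Rd by (auto dest: inj_onD)
  then show ?thesis
    using \<mu> \<nu> by (intro finite_measure_eqI) auto
qed

text \<open>This makes the Radon transform weakly continuous: a test function for the transforms
  pulls back to a test function on \<Omega>.\<close>

lemma continuous_on_Rd_adj:
  assumes \<phi>: "continuous_on (\<Theta> \<times> \<Xi>) \<phi>"
  shows "continuous_on \<Omega> (Rd_adj \<phi>)"
proof -
  obtain B where B: "\<And>p. p \<in> \<Theta> \<times> \<Xi> \<Longrightarrow> \<bar>\<phi> p\<bar> \<le> B"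
    using compact_continuous_bounded[OF compact_\<Theta>\<Xi> \<phi>] by blast
  have "continuous_on \<Omega> (\<lambda>x. \<integral>\<theta>. \<phi> (\<theta>, \<theta> \<bullet> x) \<partial>H\<Theta>)"
  proof (rule continuous_on_integral_parameter[OF T.finite_measure_axioms sets_\<Theta>, where B=B])
    show "continuous_on \<Theta> (\<lambda>\<theta>. \<phi> (\<theta>, \<theta> \<bullet> x))" if "x \<in> \<Omega>" for x
      by (rule continuous_on_compose2[OF \<phi>]) (auto intro!: continuous_intros Xi_I that)
    show "continuous_on \<Omega> (\<lambda>x. \<phi> (\<theta>, \<theta> \<bullet> x))" if "\<theta> \<in> \<Theta>" for \<theta>
      by (rule continuous_on_compose2[OF \<phi>]) (auto intro!: continuous_intros Xi_I that)
  qed (use B Xi_I in auto)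
  then show ?thesis by (simp add: Rd_adj_def[abs_def])
qed

section \<open>The move operator on a finite measure\<close>

context
  fixes \<gamma> :: "((real^'n) \<times> real \<times> real) measure"
  assumes \<gamma>: "finite_measure \<gamma>" "sets \<gamma> = sets (borel_on (\<Theta> \<times> \<Gamma>))"
begin

lemma space_\<gamma>: "space \<gamma> = \<Theta> \<times> \<Gamma>"
  using \<gamma>(2) by (rule space_eq_borel_on)

lemma Mv_measurable:
  assumes t: "t \<in> \<Sigma>"
  shows "(\<lambda>(\<theta>, x, v). (\<theta>, x + t * v)) \<in> measurable \<gamma> (borel_on (\<Theta> \<times> \<Xi>))"
proof -
  have "(\<lambda>(\<theta>, x, v). (\<theta>, x + t * v)) \<in> measurable (borel_on (\<Theta> \<times> \<Gamma>)) (borel_on (\<Theta> \<times> \<Xi>))"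
    by (rule measurable_borel_onI)
      (auto simp: case_prod_beta' Gam_move[OF _ t] intro!: continuous_intros)
  then show ?thesis using measurable_cong_sets[OF \<gamma>(2) refl] by blast
qed

lemma finite_measure_MvM: "t \<in> \<Sigma> \<Longrightarrow> finite_measure (MvM t \<gamma>)"
  unfolding MvM_def using \<gamma>(1) Mv_measurable by (rule finite_measure.finite_measure_distr)

lemma Mv_dir_measure:
  assumes t: "t \<in> \<Sigma>"
  shows "Mv_dir \<Omega> \<Sigma> \<Theta> t (measure \<gamma>) = measure (MvM t \<gamma>)"
proof
  fix E show "Mv_dir \<Omega> \<Sigma> \<Theta> t (measure \<gamma>) E = measure (MvM t \<gamma>) E"
  proof (cases "E \<in> sets (borel_on (\<Theta> \<times> \<Xi>))")
    case True
    then show ?thesis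
      unfolding MvM_def using measure_distr[OF Mv_measurable[OF t] True]
      by (simp add: Mv_dir_def pushforward_def space_\<gamma>)
  next
    case False
    then show ?thesis
      by (simp add: Mv_dir_def pushforward_def measure_notin_sets sets_MvM)
  qed
qed

text \<open>For t in \<Sigma> the move maps all of \<Theta> \<times> \<Gamma> into \<Theta> \<times>
  \<Xi>, so nothing is lost and the mass does not depend on t.\<close>

lemma mass_MvM: "t \<in> \<Sigma> \<Longrightarrow> measure (MvM t \<gamma>) (\<Theta> \<times> \<Xi>) = measure \<gamma> (\<Theta> \<times> \<Gamma>)"
  unfolding MvM_def using sets.top[of "borel_on (\<Theta> \<times> \<Xi>)"]
  by (subst measure_distr[OF Mv_measurable])
    (auto simp: space_restrict_space space_\<gamma> Gam_move intro!: arg_cong[where f="measure \<gamma>"])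

text \<open>After a change of variables t occurs only in the integrand, continuously and with a
  uniform bound, while the measure \<gamma> is fixed.\<close>

lemma continuous_on_integral_MvM:
  assumes \<phi>: "continuous_on (\<Theta> \<times> \<Xi>) \<phi>"
  shows "continuous_on \<Sigma> (\<lambda>t. \<integral>p. \<phi> p \<partial>MvM t \<gamma> :: real)"
proof -
  obtain B where B: "\<And>p. p \<in> \<Theta> \<times> \<Xi> \<Longrightarrow> \<bar>\<phi> p\<bar> \<le> B"
    using compact_continuous_bounded[OF compact_\<Theta>\<Xi> \<phi>] by blast
  have "continuous_on \<Sigma> (\<lambda>t. \<integral>q. \<phi> (fst q, fst (snd q) + t * snd (snd q)) \<partial>\<gamma>)"
  proof (rule continuous_on_integral_parameter[OF \<gamma>, where B=B])
    show "continuous_on (\<Theta> \<times> \<Gamma>) (\<lambda>q. \<phi> (fst q, fst (snd q) + t * snd (snd q)))" if "t \<in> \<Sigma>" for t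
      by (rule continuous_on_compose2[OF \<phi>]) (auto intro!: continuous_intros Gam_move that)
    show "continuous_on \<Sigma> (\<lambda>t. \<phi> (fst q, fst (snd q) + t * snd (snd q)))" if "q \<in> \<Theta> \<times> \<Gamma>" for q
      using that by (intro continuous_on_compose2[OF \<phi>]) (auto intro!: continuous_intros Gam_move)
  qed (use B Gam_move in auto)
  moreover have "(\<integral>p. \<phi> p \<partial>MvM t \<gamma>) = (\<integral>q. \<phi> (fst q, fst (snd q) + t * snd (snd q)) \<partial>\<gamma>)"
    if "t \<in> \<Sigma>" for t
    unfolding MvM_def
    by (subst integral_distr[OF Mv_measurable[OF that] borel_measurable_continuous_on_restrict[OF \<phi>]])
      (simp add: case_prod_beta')
  ultimately show ?thesis by (simp cong: continuous_on_cong)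
qed

end

text \<open>Identifies weak limits by their transform. It is applied along times converging to t,
  which gives weak continuity of preimages, and along shrinking time averages, which gives their
  existence.\<close>

lemma RdM_weak_limit:
  assumes \<mu>: "\<And>k. finite_measure (\<mu> k)" "\<And>k. sets (\<mu> k) = sets (borel_on \<Omega>)"
    and \<nu>: "finite_measure \<nu>" "sets \<nu> = sets (borel_on \<Omega>)"
    and M: "finite_measure M" "sets M = sets (borel_on (\<Theta> \<times> \<Xi>))"
    and weak: "\<And>\<psi> :: _ \<Rightarrow> real. continuous_on \<Omega> \<psi> \<Longrightarrow> (\<lambda>k. \<integral>x. \<psi> x \<partial>\<mu> k) \<longlonglongrightarrow> (\<integral>x. \<psi> x \<partial>\<nu>)"
    and lim: "\<And>\<phi> :: _ \<Rightarrow> real. continuous_on (\<Theta> \<times> \<Xi>) \<phi> \<Longrightarrow>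
      (\<lambda>k. \<integral>p. \<phi> p \<partial>RdM (\<mu> k)) \<longlonglongrightarrow> (\<integral>p. \<phi> p \<partial>M)"
  shows "RdM \<nu> = M"
proof (rule measure_eqI_continuous[OF finite_measure_RdM[OF \<nu>] sets_RdM M])
  fix \<phi> :: "(real^'n) \<times> real \<Rightarrow> real" assume \<phi>: "continuous_on (\<Theta> \<times> \<Xi>) \<phi>"
  have "(\<lambda>k. \<integral>p. \<phi> p \<partial>RdM (\<mu> k)) \<longlonglongrightarrow> (\<integral>p. \<phi> p \<partial>RdM \<nu>)"
    using weak[OF continuous_on_Rd_adj[OF \<phi>]]
    by (simp add: integral_RdM[OF \<mu> \<phi>] integral_RdM[OF \<nu> \<phi>])
  then show "(\<integral>p. \<phi> p \<partial>RdM \<nu>) = (\<integral>p. \<phi> p \<partial>M)"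
    using lim[OF \<phi>] LIMSEQ_unique by blast
qed

text \<open>Weak sequential compactness together with injectivity of the Radon transform forces
  the weak continuity of any family of preimages of \<open>MvM t \<gamma>\<close>.\<close>

context
  fixes \<gamma> :: "((real^'n) \<times> real \<times> real) measure" and K :: "real \<Rightarrow> (real^'n) measure"
  assumes \<gamma>: "finite_measure \<gamma>" "sets \<gamma> = sets (borel_on (\<Theta> \<times> \<Gamma>))"
    and K: "\<And>t. t \<in> \<Sigma> \<Longrightarrow> finite_measure (K t)" "\<And>t. t \<in> \<Sigma> \<Longrightarrow> sets (K t) = sets (borel_on \<Omega>)"
    and RdM_K: "\<And>t. t \<in> \<Sigma> \<Longrightarrow> RdM (K t) = MvM t \<gamma>"
begin

lemma mass_preimage: "t \<in> \<Sigma> \<Longrightarrow> measure (K t) \<Omega> = measure \<gamma> (\<Theta> \<times> \<Gamma>)"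
  using mass_RdM[OF K] mass_MvM[OF \<gamma>] RdM_K by simp

lemma continuous_on_integral_preimage:
  fixes \<psi> :: "real^'n \<Rightarrow> real"
  assumes \<psi>: "continuous_on \<Omega> \<psi>"
  shows "continuous_on \<Sigma> (\<lambda>t. \<integral>x. \<psi> x \<partial>K t)"
  unfolding continuous_on_sequentially comp_def
proof (intro allI ballI impI, rule ccontr)
  fix s t assume t: "t \<in> \<Sigma>" and s: "(\<forall>n::nat. s n \<in> \<Sigma>) \<and> s \<longlonglongrightarrow> t"
    and not_lim: "\<not> (\<lambda>n. \<integral>x. \<psi> x \<partial>K (s n)) \<longlonglongrightarrow> (\<integral>x. \<psi> x \<partial>K t)"
  obtain e p where e: "e > 0" and p: "strict_mono (p :: nat \<Rightarrow> nat)"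
    and far: "\<And>k. e \<le> dist (\<integral>x. \<psi> x \<partial>K (s (p k))) (\<integral>x. \<psi> x \<partial>K t)"
    using not_LIMSEQ_subseq[OF not_lim] by blast
  have sp: "s (p k) \<in> \<Sigma>" for k using s by blast
  \<comment> \<open>A further subsequence of the one that stays e away from the expected limit. Its
    weak limit has the same transform as \<open>K t\<close>, hence equals it, which is incompatible
    with the distance e.\<close>
  obtain r \<nu> where r: "strict_mono (r :: nat \<Rightarrow> nat)" and \<nu>: "finite_measure \<nu>" "sets \<nu> = sets (borel_on \<Omega>)"
    and lim: "\<And>\<psi> :: _ \<Rightarrow> real. continuous_on \<Omega> \<psi> \<Longrightarrow>
      (\<lambda>k. \<integral>x. \<psi> x \<partial>K (s (p (r k)))) \<longlonglongrightarrow> (\<integral>x. \<psi> x \<partial>\<nu>)"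
    using weakly_convergent_subsequence[of \<Omega> "\<lambda>k. K (s (p k))",
        OF compact_\<Omega> K(1)[OF sp] K(2)[OF sp] mass_preimage[OF sp]] by metis
  have "RdM \<nu> = MvM t \<gamma>"
  proof (rule RdM_weak_limit[OF K(1)[OF sp] K(2)[OF sp] \<nu> finite_measure_MvM[OF \<gamma> t] sets_MvM lim])
    fix \<phi> :: "(real^'n) \<times> real \<Rightarrow> real" assume \<phi>: "continuous_on (\<Theta> \<times> \<Xi>) \<phi>"
    have "(\<lambda>k. s (p (r k))) \<longlonglongrightarrow> t"
      using s LIMSEQ_subseq_LIMSEQ[OF LIMSEQ_subseq_LIMSEQ[OF _ p] r] by (auto simp: comp_def)
    then have "(\<lambda>k. \<integral>q. \<phi> q \<partial>MvM (s (p (r k))) \<gamma>) \<longlonglongrightarrow> (\<integral>q. \<phi> q \<partial>MvM t \<gamma>)"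
      using continuous_on_integral_MvM[OF \<gamma> \<phi>, unfolded continuous_on_sequentially comp_def,
          rule_format, OF t, of "\<lambda>k. s (p (r k))"] sp by simp
    then show "(\<lambda>k. \<integral>q. \<phi> q \<partial>RdM (K (s (p (r k))))) \<longlonglongrightarrow> (\<integral>q. \<phi> q \<partial>MvM t \<gamma>)"
      by (simp add: RdM_K[OF sp])
  qed
  then have "K t = \<nu>"
    using RdM_inj[OF K(1)[OF t] K(2)[OF t] \<nu>] RdM_K[OF t] by simp
  then have "(\<lambda>k. \<integral>x. \<psi> x \<partial>K (s (p (r k)))) \<longlonglongrightarrow> (\<integral>x. \<psi> x \<partial>K t)"
    using lim[OF \<psi>] by simp
  then obtain k where "dist (\<integral>x. \<psi> x \<partial>K (s (p (r k)))) (\<integral>x. \<psi> x \<partial>K t) < e"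
    using e unfolding lim_sequentially by blast
  with far[of "r k"] show False by simp
qed

lemma kernel_preimage:
  assumes "A \<in> sets (borel_on \<Omega>)"
  shows "(\<lambda>t. measure (K t) A) \<in> borel_measurable H\<Sigma>"
  by (rule borel_measurable_kernel[OF _ _ _ assms])
    (auto simp: space_\<Sigma> K intro!: borel_measurable_borel_onI[OF continuous_on_integral_preimage sets_\<Sigma>])

lemma prod_left_preimage: "prod_left \<Omega> (\<lambda>t. measure (K t)) H\<Sigma> \<in> nonneg_measures (\<Omega> \<times> \<Sigma>)"
  by (rule prod_left_in_nonneg_measures[OF S.finite_measure_axioms sets_\<Sigma> K _ kernel_preimage])
    (auto simp: mass_preimage)

lemma Mv_bar_eq_Rd_bar_preimage:
  "Mv_bar \<Omega> \<Sigma> \<Theta> H\<Sigma> (measure \<gamma>) = Rd_bar \<Omega> \<Sigma> \<Theta> H\<Theta> (prod_left \<Omega> (\<lambda>t. measure (K t)) H\<Sigma>)"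
proof
  fix E
  show "Mv_bar \<Omega> \<Sigma> \<Theta> H\<Sigma> (measure \<gamma>) E =
    Rd_bar \<Omega> \<Sigma> \<Theta> H\<Theta> (prod_left \<Omega> (\<lambda>t. measure (K t)) H\<Sigma>) E"
  proof (cases "E \<in> sets (borel_on (\<Theta> \<times> \<Xi> \<times> \<Sigma>))")
    case False
    then show ?thesis
      by (simp add: Mv_bar_def pushforward_def Rd_bar_def prod_right_def space_\<Theta>)
  next
    case True
    let ?F = "\<lambda>\<theta> t. measure (K t) {x \<in> \<Omega>. (\<theta>, \<theta> \<bullet> x, t) \<in> E}"
    have "Rd_bar \<Omega> \<Sigma> \<Theta> H\<Theta> (prod_left \<Omega> (\<lambda>t. measure (K t)) H\<Sigma>) E = (\<integral>\<theta>. \<integral>t. ?F \<theta> t \<partial>H\<Sigma> \<partial>H\<Theta>)"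
      unfolding Rd_bar_apply[OF True]
    proof (intro Bochner_Integration.integral_cong refl)
      fix \<theta> assume "\<theta> \<in> space H\<Theta>"
      then have \<theta>: "\<theta> \<in> \<Theta>" by (simp add: space_\<Theta>)
      let ?Q = "{(x, t). x \<in> \<Omega> \<and> t \<in> \<Sigma> \<and> (\<theta>, \<theta> \<bullet> x, t) \<in> E}"
      have "(\<lambda>p. (\<theta>, \<theta> \<bullet> fst p, snd p)) -` E \<inter> \<Omega> \<times> \<Sigma> \<in> sets (borel_on (\<Omega> \<times> \<Sigma>))"
        by (rule vimage_borel_on[OF _ _ True]) (auto intro!: continuous_intros simp: Xi_I \<theta>)
      moreover have "(\<lambda>p. (\<theta>, \<theta> \<bullet> fst p, snd p)) -` E \<inter> \<Omega> \<times> \<Sigma> = ?Q" by auto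
      ultimately have "prod_left \<Omega> (\<lambda>t. measure (K t)) H\<Sigma> ?Q = (\<integral>t. measure (K t) {x. (x, t) \<in> ?Q} \<partial>H\<Sigma>)"
        by (simp add: prod_left_def space_\<Sigma>)
      also have "\<dots> = (\<integral>t. ?F \<theta> t \<partial>H\<Sigma>)"
        by (intro Bochner_Integration.integral_cong refl) (auto simp: space_\<Sigma>)
      finally show "prod_left \<Omega> (\<lambda>t. measure (K t)) H\<Sigma> ?Q = (\<integral>t. ?F \<theta> t \<partial>H\<Sigma>)" .
    qed
    also have "\<dots> = (\<integral>t. \<integral>\<theta>. ?F \<theta> t \<partial>H\<Theta> \<partial>H\<Sigma>)"
    proof -
      interpret pair_sigma_finite H\<Theta> H\<Sigma> ..
      interpret P: finite_measure "H\<Theta> \<Otimes>\<^sub>M H\<Sigma>"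
        using S.finite_measure_axioms T.finite_measure_axioms by (rule finite_measure_pair_measure)
      have sets_P: "sets (H\<Theta> \<Otimes>\<^sub>M H\<Sigma>) = sets (borel_on (\<Theta> \<times> \<Sigma>))"
        using sets_\<Theta> sets_\<Sigma> by (rule sets_pair_borel_on)
      \<comment> \<open>Joint measurability in \<theta> and t is the condition of Fubini that is not
        immediate. K is regarded as a kernel over the pairs (\<theta>, t) that ignores \<theta>; the
        space variable x comes first because sections are taken in the first component.\<close>
      have "(\<lambda>(x, \<theta>, t). (\<theta>, \<theta> \<bullet> x, t)) -` E \<inter> \<Omega> \<times> \<Theta> \<times> \<Sigma> \<in> sets (borel_on (\<Omega> \<times> \<Theta> \<times> \<Sigma>))"
        by (rule vimage_borel_on[OF _ _ True])
          (auto intro!: continuous_intros simp: Xi_I case_prod_beta')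
      then have "(\<lambda>z. measure (K (snd z)) {x. (x, z) \<in> (\<lambda>(x, \<theta>, t). (\<theta>, \<theta> \<bullet> x, t)) -` E \<inter> \<Omega> \<times> \<Theta> \<times> \<Sigma>})
          \<in> borel_measurable (H\<Theta> \<Otimes>\<^sub>M H\<Sigma>)"
        by (intro borel_measurable_kernel_section_borel_on[OF sets_P, where Y=\<Omega>])
          (auto simp: K intro: measurable_compose[OF measurable_snd kernel_preimage])
      moreover have "{x. (x, z) \<in> (\<lambda>(x, \<theta>, t). (\<theta>, \<theta> \<bullet> x, t)) -` E \<inter> \<Omega> \<times> \<Theta> \<times> \<Sigma>} =
          {x \<in> \<Omega>. (fst z, fst z \<bullet> x, snd z) \<in> E}" if "z \<in> space (H\<Theta> \<Otimes>\<^sub>M H\<Sigma>)" for z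
        using that by (auto simp: space_pair_measure space_\<Theta> space_\<Sigma>)
      ultimately have "case_prod ?F \<in> borel_measurable (H\<Theta> \<Otimes>\<^sub>M H\<Sigma>)"
        by (simp add: case_prod_beta' cong: measurable_cong)
      then have "integrable (H\<Theta> \<Otimes>\<^sub>M H\<Sigma>) (case_prod ?F)"
      proof (rule P.integrable_const_bound[rotated])
        show "AE z in H\<Theta> \<Otimes>\<^sub>M H\<Sigma>. norm (case_prod ?F z) \<le> measure \<gamma> (\<Theta> \<times> \<Gamma>)"
        proof (rule AE_I2)
          fix z assume "z \<in> space (H\<Theta> \<Otimes>\<^sub>M H\<Sigma>)"
          then have t: "snd z \<in> \<Sigma>" by (auto simp: space_pair_measure space_\<Sigma>)
          show "norm (case_prod ?F z) \<le> measure \<gamma> (\<Theta> \<times> \<Gamma>)"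
            unfolding mass_preimage[OF t, symmetric] case_prod_beta'
            using finite_measure.bounded_measure[OF K(1)[OF t]] space_eq_borel_on[OF K(2)[OF t]] by simp
        qed
      qed
      then show ?thesis by (rule Fubini_integral[symmetric])
    qed
    also have "\<dots> = Mv_bar \<Omega> \<Sigma> \<Theta> H\<Sigma> (measure \<gamma>) E"
      unfolding Mv_bar_apply[OF True]
    proof (intro Bochner_Integration.integral_cong refl)
      fix t assume "t \<in> space H\<Sigma>"
      then have t: "t \<in> \<Sigma>" by (simp add: space_\<Sigma>)
      have "(\<lambda>(\<theta>, s). (\<theta>, s, t)) -` E \<inter> \<Theta> \<times> \<Xi> \<in> sets (borel_on (\<Theta> \<times> \<Xi>))"
        by (rule vimage_borel_on[OF _ _ True]) (auto intro!: continuous_intros simp: t case_prod_beta')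
      moreover have "(\<lambda>(\<theta>, s). (\<theta>, s, t)) -` E \<inter> \<Theta> \<times> \<Xi> = {(\<theta>, s). (\<theta>, s, t) \<in> E}"
        using borel_on_subset[OF True] by auto
      ultimately have "{(\<theta>, s). (\<theta>, s, t) \<in> E} \<in> sets (borel_on (\<Theta> \<times> \<Xi>))" by simp
      then show "(\<integral>\<theta>. ?F \<theta> t \<partial>H\<Theta>) = Mv_dir \<Omega> \<Sigma> \<Theta> t (measure \<gamma>) {(\<theta>, s). (\<theta>, s, t) \<in> E}"
        unfolding Mv_dir_measure[OF \<gamma> t] RdM_K[OF t, symmetric]
        by (subst measure_RdM[OF K(1)[OF t] K(2)[OF t]]) auto
    qed
    finally show ?thesis by simp
  qed
qed

end

text \<open>The projections act on space only, so restricting to the times in B commutes with the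
  Radon transform: transforming a slice amounts to testing \<open>Rd_bar u\<close> on sets that are
  a product in time.\<close>

lemma Rd_slice:
  assumes B: "B \<in> sets (borel_on \<Sigma>)" and E: "E \<in> sets (borel_on (\<Theta> \<times> \<Xi>))"
  defines "E' \<equiv> {(\<theta>, s, t). (\<theta>, s) \<in> E \<and> t \<in> B}"
  shows "Rd \<Omega> \<Theta> H\<Theta> (\<lambda>A. if A \<in> sets (borel_on \<Omega>) then c * u (A \<times> B) else 0) E =
      c * Rd_bar \<Omega> \<Sigma> \<Theta> H\<Theta> u E'"
    and "E' \<in> sets (borel_on (\<Theta> \<times> \<Xi> \<times> \<Sigma>))"
proof -
  have "(\<lambda>(\<theta>, s, t). ((\<theta>, s), t)) -` (E \<times> B) \<inter> \<Theta> \<times> \<Xi> \<times> \<Sigma> \<in> sets (borel_on (\<Theta> \<times> \<Xi> \<times> \<Sigma>))"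
    by (rule vimage_borel_on[OF _ _ Times_borel_on[OF E B]])
      (auto intro!: continuous_intros simp: case_prod_beta')
  moreover have "(\<lambda>(\<theta>, s, t). ((\<theta>, s), t)) -` (E \<times> B) \<inter> \<Theta> \<times> \<Xi> \<times> \<Sigma> = E'"
    using borel_on_subset[OF E] borel_on_subset[OF B] by (auto simp: E'_def)
  ultimately show E': "E' \<in> sets (borel_on (\<Theta> \<times> \<Xi> \<times> \<Sigma>))" by simp
  have "{x \<in> \<Omega>. (\<theta>, \<theta> \<bullet> x) \<in> E} \<in> sets (borel_on \<Omega>)" if "\<theta> \<in> \<Theta>" for \<theta>
  proof -
    have "(\<lambda>x. (\<theta>, \<theta> \<bullet> x)) -` E \<inter> \<Omega> \<in> sets (borel_on \<Omega>)"
      by (rule vimage_borel_on[OF _ _ E]) (auto intro!: continuous_intros simp: Xi_I that)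
    moreover have "(\<lambda>x. (\<theta>, \<theta> \<bullet> x)) -` E \<inter> \<Omega> = {x \<in> \<Omega>. (\<theta>, \<theta> \<bullet> x) \<in> E}" by auto
    ultimately show ?thesis by simp
  qed
  moreover have "{x \<in> \<Omega>. (\<theta>, \<theta> \<bullet> x) \<in> E} \<times> B = {(x, t). x \<in> \<Omega> \<and> t \<in> \<Sigma> \<and> (\<theta>, \<theta> \<bullet> x, t) \<in> E'}" for \<theta>
    using borel_on_subset[OF B] by (auto simp: E'_def)
  ultimately show "Rd \<Omega> \<Theta> H\<Theta> (\<lambda>A. if A \<in> sets (borel_on \<Omega>) then c * u (A \<times> B) else 0) E =
      c * Rd_bar \<Omega> \<Sigma> \<Theta> H\<Theta> u E'"
    unfolding Rd_apply[OF E] Rd_bar_apply[OF E'] integral_mult_right_zero[symmetric]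
    by (intro Bochner_Integration.integral_cong refl) (simp add: space_\<Theta>)
qed

text \<open>For fixed B the slice of u over B is determined by its Radon transform, which
  \<open>Rd_bar u\<close> determines. Ranging over B recovers u on all rectangles.\<close>

lemma inj_Rd_bar:
  assumes u: "u \<in> nonneg_measures (\<Omega> \<times> \<Sigma>)" and v: "v \<in> nonneg_measures (\<Omega> \<times> \<Sigma>)"
    and eq: "Rd_bar \<Omega> \<Sigma> \<Theta> H\<Theta> u = Rd_bar \<Omega> \<Sigma> \<Theta> H\<Theta> v"
  shows "u = v"
proof (rule nonneg_measures_eqI_rectangles[OF u v])
  fix A B assume A: "A \<in> sets (borel_on \<Omega>)" and B: "B \<in> sets (borel_on \<Sigma>)"
  \<comment> \<open>The factor 1 is kept so that the slice is literally the instance c = 1 of the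
    preceding lemmas.\<close>
  define slice :: "_ \<Rightarrow> (real^'n) set \<Rightarrow> real" where
    "slice w = (\<lambda>A. if A \<in> sets (borel_on \<Omega>) then 1 * w (A \<times> B) else 0)" for w
  have "Rd \<Omega> \<Theta> H\<Theta> (slice u) = Rd \<Omega> \<Theta> H\<Theta> (slice v)"
  proof
    fix E show "Rd \<Omega> \<Theta> H\<Theta> (slice u) E = Rd \<Omega> \<Theta> H\<Theta> (slice v) E"
    proof (cases "E \<in> sets (borel_on (\<Theta> \<times> \<Xi>))")
      case True
      then show ?thesis unfolding slice_def using Rd_slice(1)[OF B True] eq by simp
    next
      case False
      then show ?thesis by (simp add: Rd_def prod_right_def space_\<Theta>)
    qed
  qed
  moreover have "slice u \<in> signed_measures \<Omega>" "slice v \<in> signed_measures \<Omega>"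
    using slice_in_nonneg_measures[OF u B, of 1] slice_in_nonneg_measures[OF v B, of 1]
    by (auto simp: slice_def nonneg_measures_def)
  ultimately have "slice u = slice v" using inj_Rd by (auto dest: inj_onD)
  then have "slice u A = slice v A" by simp
  then show "u (A \<times> B) = v (A \<times> B)" using A by (simp add: slice_def)
qed

section \<open>Averages over shrinking time windows\<close>

abbreviation "nbhd t k \<equiv> \<Sigma> \<inter> ball t (1 / Suc k)"

lemma nbhd_sets: "nbhd t k \<in> sets (borel_on \<Sigma>)"
  by (simp add: sets_restrict_space)

lemma nbhd_pos: "t \<in> \<Sigma> \<Longrightarrow> measure H\<Sigma> (nbhd t k) > 0"
proof -
  assume "t \<in> \<Sigma>"
  then have "t \<in> msupport H\<Sigma>" by (simp add: supp_\<Sigma>)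
  then have "0 < emeasure H\<Sigma> (ball t (1 / Suc k) \<inter> \<Sigma>)"
    unfolding msupport_def space_\<Sigma> mem_Collect_eq
    by (metis centre_in_ball divide_pos_pos of_nat_0_less_iff open_ball zero_less_Suc zero_less_one)
  then show ?thesis by (simp add: S.emeasure_eq_measure Int_commute)
qed

lemma prob_space_nbhd: "t \<in> \<Sigma> \<Longrightarrow> prob_space (uniform_measure H\<Sigma> (nbhd t k))"
  using nbhd_pos[of t k] by (intro prob_space_uniform_measure) (auto simp: S.emeasure_eq_measure)

text \<open>The averages are specified through u alone and not through a decomposition. This allows
  two decompositions of u to be compared along one sequence.\<close>

lemma ex_time_average:
  assumes u: "u \<in> nonneg_measures (\<Omega> \<times> \<Sigma>)" and t: "t \<in> \<Sigma>"
  shows "\<exists>\<mu>. \<forall>k. finite_measure (\<mu> k) \<and> sets (\<mu> k) = sets (borel_on \<Omega>) \<and>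
    measure (\<mu> k) = (\<lambda>A. if A \<in> sets (borel_on \<Omega>)
      then (1 / measure H\<Sigma> (nbhd t k)) * u (A \<times> nbhd t k) else 0)"
proof (rule choice, rule allI)
  fix k
  have c: "0 \<le> 1 / measure H\<Sigma> (nbhd t k)" by simp
  obtain \<mu> where "finite_measure \<mu>" "sets \<mu> = sets (borel_on \<Omega>)"
    "(\<lambda>A. if A \<in> sets (borel_on \<Omega>)
      then (1 / measure H\<Sigma> (nbhd t k)) * u (A \<times> nbhd t k) else 0) = measure \<mu>"
    by (rule nonneg_measures_ex_measure[OF slice_in_nonneg_measures[OF u nbhd_sets[of t k] c]])
  then show "\<exists>\<mu>. finite_measure \<mu> \<and> sets \<mu> = sets (borel_on \<Omega>) \<and>
    measure \<mu> = (\<lambda>A. if A \<in> sets (borel_on \<Omega>)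
      then (1 / measure H\<Sigma> (nbhd t k)) * u (A \<times> nbhd t k) else 0)"
    by (intro exI[of _ \<mu>]) simp
qed

text \<open>The transform of the average over a window is the average of
  \<open>MvM s \<gamma>\<close> over that window. Since \<open>MvM s \<gamma>\<close> is weakly
  continuous in s, these transforms converge to \<open>MvM t \<gamma>\<close>, and any weak limit of
  the averages is the desired preimage.\<close>

lemma ex_preimage:
  assumes \<gamma>: "finite_measure \<gamma>" "sets \<gamma> = sets (borel_on (\<Theta> \<times> \<Gamma>))"
    and u: "u \<in> nonneg_measures (\<Omega> \<times> \<Sigma>)"
    and eq: "Mv_bar \<Omega> \<Sigma> \<Theta> H\<Sigma> (measure \<gamma>) = Rd_bar \<Omega> \<Sigma> \<Theta> H\<Theta> u" and t: "t \<in> \<Sigma>"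
  obtains \<nu> where "finite_measure \<nu>" "sets \<nu> = sets (borel_on \<Omega>)" "RdM \<nu> = MvM t \<gamma>"
proof -
  define h where "h k = measure H\<Sigma> (nbhd t k)" for k
  define W where "W k = uniform_measure H\<Sigma> (nbhd t k)" for k
  have prob_W: "prob_space (W k)" for k unfolding W_def using prob_space_nbhd[OF t] .
  have space_W: "space (W k) = \<Sigma>" for k by (simp add: W_def space_\<Sigma>)
  have fin_W: "finite_measure (W k)" for k
    using prob_W[of k] by (simp add: prob_space_def)
  obtain \<mu> where all: "\<forall>k. finite_measure (\<mu> k) \<and> sets (\<mu> k) = sets (borel_on \<Omega>) \<and>
    measure (\<mu> k) = (\<lambda>A. if A \<in> sets (borel_on \<Omega>) then (1 / h k) * u (A \<times> nbhd t k) else 0)"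
    unfolding h_def by (rule exE[OF ex_time_average[OF u t]])
  have \<mu>: "finite_measure (\<mu> k)" "sets (\<mu> k) = sets (borel_on \<Omega>)"
    and measure_\<mu>: "measure (\<mu> k) =
      (\<lambda>A. if A \<in> sets (borel_on \<Omega>) then (1 / h k) * u (A \<times> nbhd t k) else 0)" for k
    by (rule all[rule_format, THEN conjunct1], rule all[rule_format, THEN conjunct2, THEN conjunct1],
      rule all[rule_format, THEN conjunct2, THEN conjunct2])
  have Mv_meas: "(\<lambda>s. measure (MvM s \<gamma>) E) \<in> borel_measurable H\<Sigma>"
    if E: "E \<in> sets (borel_on (\<Theta> \<times> \<Xi>))" for E
    by (rule borel_measurable_kernel[OF _ _ _ E])
      (auto simp: space_\<Sigma> finite_measure_MvM[OF \<gamma>] sets_MvM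
        intro!: borel_measurable_borel_onI[OF continuous_on_integral_MvM[OF \<gamma>] sets_\<Sigma>])
  \<comment> \<open>The integrated constraint evaluated on the product of E with the window; the
    factor \<open>1 / h k\<close> turns restriction to the window into the conditional law
    \<open>W k\<close>.\<close>
  have mix: "measure (RdM (\<mu> k)) E = (\<integral>s. measure (MvM s \<gamma>) E \<partial>W k)"
    if E: "E \<in> sets (borel_on (\<Theta> \<times> \<Xi>))" for E k
  proof -
    let ?E = "{(\<theta>, s, t'). (\<theta>, s) \<in> E \<and> t' \<in> nbhd t k}"
    note slice = Rd_slice[OF nbhd_sets[of t k] E]
    have "measure (RdM (\<mu> k)) E = (1 / h k) * Mv_bar \<Omega> \<Sigma> \<Theta> H\<Sigma> (measure \<gamma>) ?E"
      unfolding Rd_measure[OF \<mu>, symmetric] measure_\<mu> slice(1) eq ..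
    also have "Mv_bar \<Omega> \<Sigma> \<Theta> H\<Sigma> (measure \<gamma>) ?E = (\<integral>s. indicator (nbhd t k) s * measure (MvM s \<gamma>) E \<partial>H\<Sigma>)"
      unfolding Mv_bar_apply[OF slice(2)]
    proof (intro Bochner_Integration.integral_cong refl)
      fix s assume "s \<in> space H\<Sigma>"
      then have s: "s \<in> \<Sigma>" by (simp add: space_\<Sigma>)
      have "{(\<theta>, s'). (\<theta>, s', s) \<in> ?E} = (if s \<in> nbhd t k then E else {})" by auto
      then show "Mv_dir \<Omega> \<Sigma> \<Theta> s (measure \<gamma>) {(\<theta>, s'). (\<theta>, s', s) \<in> ?E} =
          indicator (nbhd t k) s * measure (MvM s \<gamma>) E"
        by (simp add: Mv_dir_measure[OF \<gamma> s] indicator_def)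
    qed
    also have "(1 / h k) * \<dots> = (\<integral>s. measure (MvM s \<gamma>) E \<partial>W k)"
      unfolding W_def using nbhd_pos[OF t, of k] Mv_meas[OF E] nbhd_sets[of t k]
      by (subst integral_uniform_measure[OF S.finite_measure_axioms]) (auto simp: sets_\<Sigma> h_def)
    finally show ?thesis .
  qed
  \<comment> \<open>The case E = \<Theta> \<times> \<Xi> of \<open>mix\<close>, in which the
    integrand is constant; this is what makes weak compactness applicable.\<close>
  have mass: "measure (\<mu> k) \<Omega> = measure \<gamma> (\<Theta> \<times> \<Gamma>)" for k
  proof -
    interpret W: prob_space "W k" by (rule prob_W)
    have "measure (\<mu> k) \<Omega> = (\<integral>s. measure (MvM s \<gamma>) (\<Theta> \<times> \<Xi>) \<partial>W k)"
      unfolding mass_RdM[OF \<mu>, symmetric] using sets.top[of "borel_on (\<Theta> \<times> \<Xi>)"]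
      by (intro mix) (simp add: space_restrict_space)
    also have "\<dots> = (\<integral>s. measure \<gamma> (\<Theta> \<times> \<Gamma>) \<partial>W k)"
      by (intro Bochner_Integration.integral_cong) (auto simp: space_W mass_MvM[OF \<gamma>])
    finally show ?thesis by (simp add: W.prob_space)
  qed
  obtain r \<nu> where r: "strict_mono (r :: nat \<Rightarrow> nat)" and \<nu>: "finite_measure \<nu>" "sets \<nu> = sets (borel_on \<Omega>)"
    and lim: "\<And>\<psi> :: _ \<Rightarrow> real. continuous_on \<Omega> \<psi> \<Longrightarrow>
      (\<lambda>k. \<integral>x. \<psi> x \<partial>\<mu> (r k)) \<longlonglongrightarrow> (\<integral>x. \<psi> x \<partial>\<nu>)"
    using weakly_convergent_subsequence[of \<Omega> \<mu>, OF compact_\<Omega> \<mu> mass] by metis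
  have "RdM \<nu> = MvM t \<gamma>"
  proof (rule RdM_weak_limit[OF \<mu> \<nu> finite_measure_MvM[OF \<gamma> t] sets_MvM lim])
    fix \<phi> :: "(real^'n) \<times> real \<Rightarrow> real" assume \<phi>: "continuous_on (\<Theta> \<times> \<Xi>) \<phi>"
    obtain B where B: "\<And>p. p \<in> \<Theta> \<times> \<Xi> \<Longrightarrow> \<bar>\<phi> p\<bar> \<le> B"
      using compact_continuous_bounded[OF compact_\<Theta>\<Xi> \<phi>] by blast
    have cont: "continuous_on \<Sigma> (\<lambda>s. \<integral>p. \<phi> p \<partial>MvM s \<gamma>)"
      by (rule continuous_on_integral_MvM[OF \<gamma> \<phi>])
    obtain C where C: "\<And>s. s \<in> \<Sigma> \<Longrightarrow> \<bar>\<integral>p. \<phi> p \<partial>MvM s \<gamma>\<bar> \<le> C"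
      using compact_continuous_bounded[OF compact_\<Sigma> cont] by blast
    have "(\<integral>p. \<phi> p \<partial>RdM (\<mu> k)) = (\<integral>s. \<integral>p. \<phi> p \<partial>MvM s \<gamma> \<partial>W k)" for k
    proof (rule integral_mixture[OF fin_W finite_measure_RdM[OF \<mu>]])
      show "(\<lambda>s. measure (MvM s \<gamma>) A) \<in> borel_measurable (W k)" if "A \<in> sets (RdM (\<mu> k))" for A
        using Mv_meas that by (simp add: W_def sets_RdM cong: measurable_cong_sets)
      show "measure (MvM s \<gamma>) (space (RdM (\<mu> k))) \<le> measure \<gamma> (\<Theta> \<times> \<Gamma>)" if "s \<in> space (W k)" for s
        using that by (simp add: space_W space_RdM mass_MvM[OF \<gamma>])
    qed (use B mix finite_measure_MvM[OF \<gamma>] in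
        \<open>auto simp: space_W sets_RdM sets_MvM space_RdM intro!: borel_measurable_borel_onI[OF \<phi>]\<close>)
    moreover have "(\<lambda>k. \<integral>s. \<integral>p. \<phi> p \<partial>MvM s \<gamma> \<partial>W k) \<longlonglongrightarrow> (\<integral>p. \<phi> p \<partial>MvM t \<gamma>)"
      unfolding W_def using t supp_\<Sigma> C
      by (intro integral_uniform_ball_tendsto[OF S.finite_measure_axioms sets_\<Sigma> _ cont]) auto
    ultimately have "(\<lambda>k. \<integral>p. \<phi> p \<partial>RdM (\<mu> k)) \<longlonglongrightarrow> (\<integral>p. \<phi> p \<partial>MvM t \<gamma>)" by simp
    then show "(\<lambda>k. \<integral>p. \<phi> p \<partial>RdM (\<mu> (r k))) \<longlonglongrightarrow> (\<integral>p. \<phi> p \<partial>MvM t \<gamma>)"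
      using LIMSEQ_subseq_LIMSEQ[OF _ r] by (auto simp: comp_def)
  qed
  with \<nu> show thesis by (rule that)
qed

text \<open>Here the decomposition is arbitrary and no \<gamma> is at hand, so continuity in time is
  available only behind the Radon transform. For this reason the averages are tested with
  backprojections \<open>Rd_adj \<phi>\<close> only. The left side depends on u alone, the right
  side on the decomposition.\<close>

lemma time_average_tendsto:
  assumes dec: "is_decomposition \<Omega> \<Sigma> \<Theta> H\<Sigma> H\<Theta> u ut" and t: "t \<in> \<Sigma>"
    and \<mu>: "\<forall>k. finite_measure (\<mu> k) \<and> sets (\<mu> k) = sets (borel_on \<Omega>) \<and>
      measure (\<mu> k) = (\<lambda>A. if A \<in> sets (borel_on \<Omega>)
        then (1 / measure H\<Sigma> (nbhd t k)) * u (A \<times> nbhd t k) else 0)"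
    and \<phi>: "continuous_on (\<Theta> \<times> \<Xi>) \<phi>"
  shows "(\<lambda>k. \<integral>x. Rd_adj \<phi> x \<partial>\<mu> k) \<longlonglongrightarrow> sintegral (\<Theta> \<times> \<Xi>) (Rd \<Omega> \<Theta> H\<Theta> (ut t)) \<phi>"
proof -
  have "\<forall>s\<in>\<Sigma>. \<exists>\<kappa>. finite_measure \<kappa> \<and> sets \<kappa> = sets (borel_on \<Omega>) \<and> ut s = measure \<kappa>"
  proof
    fix s assume "s \<in> \<Sigma>"
    then have "ut s \<in> nonneg_measures \<Omega>" using dec by (auto simp: is_decomposition_def)
    then show "\<exists>\<kappa>. finite_measure \<kappa> \<and> sets \<kappa> = sets (borel_on \<Omega>) \<and> ut s = measure \<kappa>"
      by (rule nonneg_measures_ex_measure) blast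
  qed
  then obtain K where all: "\<forall>s\<in>\<Sigma>. finite_measure (K s) \<and> sets (K s) = sets (borel_on \<Omega>) \<and> ut s = measure (K s)"
    by (rule bchoice[THEN exE])
  have K: "finite_measure (K s)" "sets (K s) = sets (borel_on \<Omega>)" and ut: "ut s = measure (K s)"
    if "s \<in> \<Sigma>" for s
    using all that by auto
  have sint: "sintegral (\<Theta> \<times> \<Xi>) (Rd \<Omega> \<Theta> H\<Theta> (ut s)) \<psi> = (\<integral>p. \<psi> p \<partial>RdM (K s))" if "s \<in> \<Sigma>" for s and \<psi> :: "_ \<Rightarrow> real"
    unfolding ut[OF that] Rd_measure[OF K[OF that]]
    by (rule sintegral_measure[OF finite_measure_RdM[OF K[OF that]] sets_RdM])
  have cont: "continuous_on \<Sigma> (\<lambda>s. \<integral>p. \<psi> p \<partial>RdM (K s))" if "continuous_on (\<Theta> \<times> \<Xi>) \<psi>"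
    for \<psi> :: "_ \<Rightarrow> real"
  proof -
    have "continuous_on \<Sigma> (\<lambda>s. sintegral (\<Theta> \<times> \<Xi>) (Rd \<Omega> \<Theta> H\<Theta> (ut s)) \<psi>)"
      using dec that by (simp add: is_decomposition_def)
    then show ?thesis by (simp add: sint cong: continuous_on_cong)
  qed
  \<comment> \<open>The constant 1 is an admissible test function and the transform preserves mass.
    So the masses of the family are continuous in time, hence bounded on the compact \<Sigma>, as
    the mixture formula requires.\<close>
  define m :: "real \<Rightarrow> real" where "m s = (\<integral>p. 1 \<partial>RdM (K s))" for s
  have mass: "measure (K s) \<Omega> = m s" if "s \<in> \<Sigma>" for s
    using mass_RdM[OF K[OF that]] by (simp add: m_def space_RdM)
  have m_cont: "continuous_on \<Sigma> m"
    unfolding m_def by (rule cont) (rule continuous_on_const)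
  obtain c where c: "\<And>s. s \<in> \<Sigma> \<Longrightarrow> \<bar>m s\<bar> \<le> c"
    using compact_continuous_bounded[OF compact_\<Sigma> m_cont] by blast
  have meas: "(\<lambda>s. measure (K s) A) \<in> borel_measurable H\<Sigma>" if "A \<in> sets (borel_on \<Omega>)" for A
  proof -
    have "(\<lambda>s. ut s A) \<in> borel_measurable H\<Sigma>"
      using dec that by (simp add: is_decomposition_def is_kernel_def)
    also have "?this \<longleftrightarrow> ?thesis"
      by (intro measurable_cong) (simp add: ut space_\<Sigma>)
    finally show ?thesis .
  qed
  have u: "u = prod_left \<Omega> (\<lambda>s. measure (K s)) H\<Sigma>"
    using dec prod_left_cong[of H\<Sigma> ut "\<lambda>s. measure (K s)" \<Omega>] by (simp add: is_decomposition_def ut space_\<Sigma>)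
  define W where "W k = uniform_measure H\<Sigma> (nbhd t k)" for k
  have fin_W: "finite_measure (W k)" for k
    unfolding W_def using prob_space_nbhd[OF t] by (simp add: prob_space_def)
  have space_W: "space (W k) = \<Sigma>" for k by (simp add: W_def space_\<Sigma>)
  have mix: "measure (\<mu> k) A = (\<integral>s. measure (K s) A \<partial>W k)" if A: "A \<in> sets (borel_on \<Omega>)" for A k
  proof -
    have "measure (\<mu> k) A = u (A \<times> nbhd t k) / measure H\<Sigma> (nbhd t k)"
      using \<mu> A by simp
    also have "u (A \<times> nbhd t k) = (\<integral>s. indicator (nbhd t k) s * measure (K s) A \<partial>H\<Sigma>)"
      unfolding u using prod_left_rectangle[OF sets_\<Sigma> A, of "nbhd t k" "\<lambda>s. measure (K s)"] nbhd_sets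
      by (simp add: sets_\<Sigma> set_lebesgue_integral_def)
    also have "\<dots> / measure H\<Sigma> (nbhd t k) = (\<integral>s. measure (K s) A \<partial>W k)"
      unfolding W_def using nbhd_pos[OF t] meas[OF A] nbhd_sets
      by (intro integral_uniform_measure[symmetric] S.finite_measure_axioms) (auto simp: sets_\<Sigma>)
    finally show ?thesis .
  qed
  let ?a = "\<lambda>s. \<integral>x. Rd_adj \<phi> x \<partial>K s"
  have a_eq: "(\<integral>p. \<phi> p \<partial>RdM (K s)) = ?a s" if "s \<in> \<Sigma>" for s
    by (rule integral_RdM[OF K[OF that] \<phi>])
  have a_cont: "continuous_on \<Sigma> ?a"
    using cont[OF \<phi>] by (simp add: a_eq cong: continuous_on_cong)
  obtain B where B: "\<And>x. x \<in> \<Omega> \<Longrightarrow> \<bar>Rd_adj \<phi> x\<bar> \<le> B"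
    using compact_continuous_bounded[OF compact_\<Omega> continuous_on_Rd_adj[OF \<phi>]] by blast
  obtain C where C: "\<And>s. s \<in> \<Sigma> \<Longrightarrow> \<bar>?a s\<bar> \<le> C"
    using compact_continuous_bounded[OF compact_\<Sigma> a_cont] by blast
  have "(\<integral>x. Rd_adj \<phi> x \<partial>\<mu> k) = (\<integral>s. ?a s \<partial>W k)" for k
  proof -
    have sets_\<mu>: "sets (\<mu> k) = sets (borel_on \<Omega>)" using \<mu> by blast
    have space_\<mu>: "space (\<mu> k) = \<Omega>" using sets_\<mu> by (rule space_eq_borel_on)
    show ?thesis
    proof (rule integral_mixture[OF fin_W])
      show "finite_measure (\<mu> k)" using \<mu> by blast
      show "measure (K s) (space (\<mu> k)) \<le> c" if "s \<in> space (W k)" for s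
        using c[of s] mass[of s] that by (simp add: space_\<mu> space_W)
      show "(\<lambda>s. measure (K s) A) \<in> borel_measurable (W k)" if "A \<in> sets (\<mu> k)" for A
        using meas that by (simp add: W_def sets_\<mu> cong: measurable_cong_sets)
    qed (use B mix K in \<open>auto simp: space_W sets_\<mu> space_\<mu>
        intro!: borel_measurable_borel_onI[OF continuous_on_Rd_adj[OF \<phi>]]\<close>)
  qed
  moreover have "(\<lambda>k. \<integral>s. ?a s \<partial>W k) \<longlonglongrightarrow> ?a t"
    unfolding W_def using t supp_\<Sigma> C
    by (intro integral_uniform_ball_tendsto[OF S.finite_measure_axioms sets_\<Sigma> _ a_cont]) auto
  ultimately show ?thesis by (simp add: sint[OF t] a_eq[OF t])
qed

lemma is_decomposition_unique:
  assumes u: "u \<in> nonneg_measures (\<Omega> \<times> \<Sigma>)"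
    and ut: "is_decomposition \<Omega> \<Sigma> \<Theta> H\<Sigma> H\<Theta> u ut" and vt: "is_decomposition \<Omega> \<Sigma> \<Theta> H\<Sigma> H\<Theta> u vt"
  shows "ut = vt"
proof (rule PiE_ext)
  show ut': "ut \<in> \<Sigma> \<rightarrow>\<^sub>E nonneg_measures \<Omega>" and vt': "vt \<in> \<Sigma> \<rightarrow>\<^sub>E nonneg_measures \<Omega>"
    using ut vt by (auto simp: is_decomposition_def)
  fix t assume t: "t \<in> \<Sigma>"
  obtain \<kappa> where \<kappa>: "finite_measure \<kappa>" "sets \<kappa> = sets (borel_on \<Omega>)" "ut t = measure \<kappa>"
    using nonneg_measures_ex_measure PiE_mem[OF ut' t] by blast
  obtain \<rho> where \<rho>: "finite_measure \<rho>" "sets \<rho> = sets (borel_on \<Omega>)" "vt t = measure \<rho>"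
    using nonneg_measures_ex_measure PiE_mem[OF vt' t] by blast
  \<comment> \<open>One sequence of averages serves both decompositions, and uniqueness of its
    limits equates their Radon transforms at t.\<close>
  obtain \<mu> where \<mu>: "\<forall>k. finite_measure (\<mu> k) \<and> sets (\<mu> k) = sets (borel_on \<Omega>) \<and>
      measure (\<mu> k) = (\<lambda>A. if A \<in> sets (borel_on \<Omega>)
        then (1 / measure H\<Sigma> (nbhd t k)) * u (A \<times> nbhd t k) else 0)"
    by (rule exE[OF ex_time_average[OF u t]])
  have "RdM \<kappa> = RdM \<rho>"
  proof (rule measure_eqI_continuous[OF finite_measure_RdM[OF \<kappa>(1,2)] sets_RdM
        finite_measure_RdM[OF \<rho>(1,2)] sets_RdM])
    fix \<phi> :: "(real^'n) \<times> real \<Rightarrow> real" assume \<phi>: "continuous_on (\<Theta> \<times> \<Xi>) \<phi>"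
    have "sintegral (\<Theta> \<times> \<Xi>) (Rd \<Omega> \<Theta> H\<Theta> (ut t)) \<phi> = sintegral (\<Theta> \<times> \<Xi>) (Rd \<Omega> \<Theta> H\<Theta> (vt t)) \<phi>"
      using time_average_tendsto[OF ut t \<mu> \<phi>] time_average_tendsto[OF vt t \<mu> \<phi>]
      by (rule LIMSEQ_unique)
    then show "(\<integral>p. \<phi> p \<partial>RdM \<kappa>) = (\<integral>p. \<phi> p \<partial>RdM \<rho>)"
      unfolding \<kappa>(3) \<rho>(3) Rd_measure[OF \<kappa>(1,2)] Rd_measure[OF \<rho>(1,2)]
        sintegral_measure[OF finite_measure_RdM[OF \<kappa>(1,2)] sets_RdM]
        sintegral_measure[OF finite_measure_RdM[OF \<rho>(1,2)] sets_RdM] .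
  qed
  then have "\<kappa> = \<rho>" by (rule RdM_inj[OF \<kappa>(1,2) \<rho>(1,2)])
  then show "ut t = vt t" using \<kappa>(3) \<rho>(3) by simp
qed

section \<open>Decompositions and the correspondence of feasible pairs\<close>

lemma decomposition_eq:
  assumes "u \<in> nonneg_measures (\<Omega> \<times> \<Sigma>)" "is_decomposition \<Omega> \<Sigma> \<Theta> H\<Sigma> H\<Theta> u ut"
  shows "decomposition \<Omega> \<Sigma> \<Theta> H\<Sigma> H\<Theta> u = ut"
  unfolding decomposition_def using assms is_decomposition_unique by (intro the_equality) auto

text \<open>Common core of both directions: the family may be given as feasible or be assembled from
  the preimages of \<open>ex_preimage\<close>. K carries the measures in library form, while
  \<open>ut\<close> is the extensional family of set functions.\<close>

lemma preimage_family:
  assumes \<gamma>: "finite_measure \<gamma>" "sets \<gamma> = sets (borel_on (\<Theta> \<times> \<Gamma>))"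
    and K: "\<And>t. t \<in> \<Sigma> \<Longrightarrow> finite_measure (K t)" "\<And>t. t \<in> \<Sigma> \<Longrightarrow> sets (K t) = sets (borel_on \<Omega>)"
    and RdM_K: "\<And>t. t \<in> \<Sigma> \<Longrightarrow> RdM (K t) = MvM t \<gamma>"
    and ut: "ut \<in> extensional \<Sigma>" "\<And>t. t \<in> \<Sigma> \<Longrightarrow> ut t = measure (K t)"
  shows "is_decomposition \<Omega> \<Sigma> \<Theta> H\<Sigma> H\<Theta> (prod_left \<Omega> ut H\<Sigma>) ut"
    and "prod_left \<Omega> ut H\<Sigma> \<in> nonneg_measures (\<Omega> \<times> \<Sigma>)"
    and "Mv_bar \<Omega> \<Sigma> \<Theta> H\<Sigma> (measure \<gamma>) = Rd_bar \<Omega> \<Sigma> \<Theta> H\<Theta> (prod_left \<Omega> ut H\<Sigma>)"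
proof -
  have u: "prod_left \<Omega> ut H\<Sigma> = prod_left \<Omega> (\<lambda>t. measure (K t)) H\<Sigma>"
    by (rule prod_left_cong) (simp add: space_\<Sigma> ut(2))
  show "prod_left \<Omega> ut H\<Sigma> \<in> nonneg_measures (\<Omega> \<times> \<Sigma>)"
    unfolding u using \<gamma> K RdM_K by (rule prod_left_preimage)
  show "Mv_bar \<Omega> \<Sigma> \<Theta> H\<Sigma> (measure \<gamma>) = Rd_bar \<Omega> \<Sigma> \<Theta> H\<Theta> (prod_left \<Omega> ut H\<Sigma>)"
    unfolding u using \<gamma> K RdM_K by (rule Mv_bar_eq_Rd_bar_preimage)
  have "(\<lambda>t. ut t A) \<in> borel_measurable H\<Sigma>" if "A \<in> sets (borel_on \<Omega>)" for A
  proof -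
    have "(\<lambda>t. measure (K t) A) \<in> borel_measurable H\<Sigma>"
      using \<gamma> K RdM_K that by (rule kernel_preimage)
    also have "?this \<longleftrightarrow> ?thesis"
      by (intro measurable_cong) (simp add: ut(2) space_\<Sigma>)
    finally show ?thesis .
  qed
  moreover have "continuous_on \<Sigma> (\<lambda>t. sintegral (\<Theta> \<times> \<Xi>) (Rd \<Omega> \<Theta> H\<Theta> (ut t)) \<phi>)"
    if \<phi>: "continuous_on (\<Theta> \<times> \<Xi>) \<phi>" for \<phi>
  proof -
    have "sintegral (\<Theta> \<times> \<Xi>) (Rd \<Omega> \<Theta> H\<Theta> (ut t)) \<phi> = (\<integral>p. \<phi> p \<partial>MvM t \<gamma>)" if t: "t \<in> \<Sigma>" for t
      unfolding ut(2)[OF t] Rd_measure[OF K[OF t]] RdM_K[OF t]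
      by (rule sintegral_measure[OF finite_measure_MvM[OF \<gamma> t] sets_MvM])
    then show ?thesis
      using continuous_on_integral_MvM[OF \<gamma> \<phi>] by (simp cong: continuous_on_cong)
  qed
  moreover have "ut \<in> \<Sigma> \<rightarrow>\<^sub>E nonneg_measures \<Omega>"
    using ut(1) measure_in_nonneg_measures[OF K] by (auto simp: PiE_def ut(2))
  ultimately show "is_decomposition \<Omega> \<Sigma> \<Theta> H\<Sigma> H\<Theta> (prod_left \<Omega> ut H\<Sigma>) ut"
    by (auto simp: is_decomposition_def is_kernel_def)
qed

lemma family_imp_decomposition:
  assumes "\<gamma> \<in> nonneg_measures (\<Theta> \<times> \<Gamma>)" and ut: "ut \<in> \<Sigma> \<rightarrow>\<^sub>E nonneg_measures \<Omega>"
    and eq: "\<And>t. t \<in> \<Sigma> \<Longrightarrow> Mv_dir \<Omega> \<Sigma> \<Theta> t \<gamma> = Rd \<Omega> \<Theta> H\<Theta> (ut t)"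
  shows "is_decomposition \<Omega> \<Sigma> \<Theta> H\<Sigma> H\<Theta> (prod_left \<Omega> ut H\<Sigma>) ut"
    and "prod_left \<Omega> ut H\<Sigma> \<in> nonneg_measures (\<Omega> \<times> \<Sigma>)"
    and "Mv_bar \<Omega> \<Sigma> \<Theta> H\<Sigma> \<gamma> = Rd_bar \<Omega> \<Sigma> \<Theta> H\<Theta> (prod_left \<Omega> ut H\<Sigma>)"
proof -
  obtain g where g: "finite_measure g" "sets g = sets (borel_on (\<Theta> \<times> \<Gamma>))" "\<gamma> = measure g"
    using nonneg_measures_ex_measure[OF assms(1)] by blast
  have "\<forall>t\<in>\<Sigma>. \<exists>\<kappa>. finite_measure \<kappa> \<and> sets \<kappa> = sets (borel_on \<Omega>) \<and> ut t = measure \<kappa>"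
  proof
    fix t assume "t \<in> \<Sigma>"
    then have "ut t \<in> nonneg_measures \<Omega>" using ut by auto
    then show "\<exists>\<kappa>. finite_measure \<kappa> \<and> sets \<kappa> = sets (borel_on \<Omega>) \<and> ut t = measure \<kappa>"
      by (rule nonneg_measures_ex_measure) blast
  qed
  then obtain K where all: "\<forall>t\<in>\<Sigma>. finite_measure (K t) \<and> sets (K t) = sets (borel_on \<Omega>) \<and> ut t = measure (K t)"
    by (rule bchoice[THEN exE])
  have K: "finite_measure (K t)" "sets (K t) = sets (borel_on \<Omega>)" and ut_K: "ut t = measure (K t)"
    if "t \<in> \<Sigma>" for t
    using all that by auto
  have RdM_K: "RdM (K t) = MvM t g" if t: "t \<in> \<Sigma>" for t
  proof (rule finite_measure_eqI[OF finite_measure_RdM[OF K[OF t]] finite_measure_MvM[OF g(1,2) t]])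
    show "measure (RdM (K t)) A = measure (MvM t g) A" for A
      using eq[OF t] by (simp add: g(3) Mv_dir_measure[OF g(1,2) t] ut_K[OF t] Rd_measure[OF K[OF t]])
  qed (simp add: sets_RdM sets_MvM)
  have ext: "ut \<in> extensional \<Sigma>" using ut by (simp add: PiE_def)
  show "is_decomposition \<Omega> \<Sigma> \<Theta> H\<Sigma> H\<Theta> (prod_left \<Omega> ut H\<Sigma>) ut"
    and "prod_left \<Omega> ut H\<Sigma> \<in> nonneg_measures (\<Omega> \<times> \<Sigma>)"
    and "Mv_bar \<Omega> \<Sigma> \<Theta> H\<Sigma> \<gamma> = Rd_bar \<Omega> \<Sigma> \<Theta> H\<Theta> (prod_left \<Omega> ut H\<Sigma>)"
    unfolding g(3) using g(1,2) K RdM_K ext ut_K by (fact preimage_family)+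
qed

lemma ex_decomposition:
  assumes "\<gamma> \<in> nonneg_measures (\<Theta> \<times> \<Gamma>)" and u: "u \<in> nonneg_measures (\<Omega> \<times> \<Sigma>)"
    and eq: "Mv_bar \<Omega> \<Sigma> \<Theta> H\<Sigma> \<gamma> = Rd_bar \<Omega> \<Sigma> \<Theta> H\<Theta> u"
  obtains ut where "is_decomposition \<Omega> \<Sigma> \<Theta> H\<Sigma> H\<Theta> u ut"
    "\<And>t. t \<in> \<Sigma> \<Longrightarrow> Mv_dir \<Omega> \<Sigma> \<Theta> t \<gamma> = Rd \<Omega> \<Theta> H\<Theta> (ut t)"
proof -
  obtain g where g: "finite_measure g" "sets g = sets (borel_on (\<Theta> \<times> \<Gamma>))" "\<gamma> = measure g"
    using nonneg_measures_ex_measure[OF assms(1)] by blast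
  have "\<forall>t\<in>\<Sigma>. \<exists>\<kappa>. finite_measure \<kappa> \<and> sets \<kappa> = sets (borel_on \<Omega>) \<and> RdM \<kappa> = MvM t g"
  proof
    fix t assume t: "t \<in> \<Sigma>"
    show "\<exists>\<kappa>. finite_measure \<kappa> \<and> sets \<kappa> = sets (borel_on \<Omega>) \<and> RdM \<kappa> = MvM t g"
      using ex_preimage[OF g(1,2) u eq[unfolded g(3)] t] by blast
  qed
  then obtain K where all: "\<forall>t\<in>\<Sigma>. finite_measure (K t) \<and> sets (K t) = sets (borel_on \<Omega>) \<and> RdM (K t) = MvM t g"
    by (rule bchoice[THEN exE])
  have K: "finite_measure (K t)" "sets (K t) = sets (borel_on \<Omega>)" and RdM_K: "RdM (K t) = MvM t g"
    if "t \<in> \<Sigma>" for t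
    using all that by auto
  \<comment> \<open>The choice of K is uncontrolled off \<Sigma>; restricting gives the extensional
    family that \<open>is_decomposition\<close> asks for.\<close>
  define ut where "ut = restrict (\<lambda>t. measure (K t)) \<Sigma>"
  have ut: "ut \<in> extensional \<Sigma>" "\<And>t. t \<in> \<Sigma> \<Longrightarrow> ut t = measure (K t)" by (auto simp: ut_def)
  have fam: "is_decomposition \<Omega> \<Sigma> \<Theta> H\<Sigma> H\<Theta> (prod_left \<Omega> ut H\<Sigma>) ut"
    "prod_left \<Omega> ut H\<Sigma> \<in> nonneg_measures (\<Omega> \<times> \<Sigma>)"
    "Mv_bar \<Omega> \<Sigma> \<Theta> H\<Sigma> \<gamma> = Rd_bar \<Omega> \<Sigma> \<Theta> H\<Theta> (prod_left \<Omega> ut H\<Sigma>)"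
    unfolding g(3) using g(1,2) K RdM_K ut by (fact preimage_family)+
  have "prod_left \<Omega> ut H\<Sigma> = u"
    using fam(3) eq by (intro inj_Rd_bar fam(2) u) simp
  then have "is_decomposition \<Omega> \<Sigma> \<Theta> H\<Sigma> H\<Theta> u ut" using fam(1) by simp
  moreover have "Mv_dir \<Omega> \<Sigma> \<Theta> t \<gamma> = Rd \<Omega> \<Theta> H\<Theta> (ut t)" if t: "t \<in> \<Sigma>" for t
    by (simp add: g(3) Mv_dir_measure[OF g(1,2) t] ut(2)[OF t] Rd_measure[OF K[OF t]] RdM_K[OF t])
  ultimately show thesis by (rule that)
qed

text \<open>\<gamma> is kept and, by uniqueness, the decomposition chosen in \<open>Ob_bar\<close>
  is \<open>ut\<close> itself. Observations thus agree as functions, which settles the penalty for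
  \<alpha> > 0 and the data constraint for \<alpha> = 0 alike.\<close>

lemma P_feasible_imp_MP_feasible:
  assumes "P_feasible \<Omega> \<Sigma> \<Theta> H\<Theta> Ob \<alpha> \<T> f ut \<gamma>"
  shows "MP_feasible \<Omega> \<Sigma> \<Theta> H\<Sigma> H\<Theta> Ob \<alpha> \<T> f (prod_left \<Omega> ut H\<Sigma>) \<gamma>"
    and "is_decomposition \<Omega> \<Sigma> \<Theta> H\<Sigma> H\<Theta> (prod_left \<Omega> ut H\<Sigma>) ut"
    and "Ob_bar \<Omega> \<Sigma> \<Theta> H\<Sigma> H\<Theta> Ob (prod_left \<Omega> ut H\<Sigma>) = (\<lambda>t. Ob t (ut t))"
proof -
  have P: "\<gamma> \<in> nonneg_measures (\<Theta> \<times> \<Gamma>)" "ut \<in> \<Sigma> \<rightarrow>\<^sub>E nonneg_measures \<Omega>"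
    "\<And>t. t \<in> \<Sigma> \<Longrightarrow> Mv_dir \<Omega> \<Sigma> \<Theta> t \<gamma> = Rd \<Omega> \<Theta> H\<Theta> (ut t)"
    "data_constraint \<alpha> \<T> f (\<lambda>t. Ob t (ut t))"
    using assms by (auto simp: P_feasible_def)
  note fam = family_imp_decomposition[OF P(1-3)]
  show "is_decomposition \<Omega> \<Sigma> \<Theta> H\<Sigma> H\<Theta> (prod_left \<Omega> ut H\<Sigma>) ut"
    by (rule fam(1))
  show Ob: "Ob_bar \<Omega> \<Sigma> \<Theta> H\<Sigma> H\<Theta> Ob (prod_left \<Omega> ut H\<Sigma>) = (\<lambda>t. Ob t (ut t))"
    by (simp add: Ob_bar_def fun_eq_iff decomposition_eq[OF fam(2,1)])
  show "MP_feasible \<Omega> \<Sigma> \<Theta> H\<Sigma> H\<Theta> Ob \<alpha> \<T> f (prod_left \<Omega> ut H\<Sigma>) \<gamma>"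
    using P(1,4) fam(2,3) by (simp add: MP_feasible_def Ob)
qed

text \<open>\<open>ex_decomposition\<close> yields a decomposition that satisfies the constraint at
  every time; by uniqueness it is the one selected by \<open>decomposition\<close>, so the
  constraint holds for the selected family.\<close>

lemma MP_feasible_imp_P_feasible:
  assumes "MP_feasible \<Omega> \<Sigma> \<Theta> H\<Sigma> H\<Theta> Ob \<alpha> \<T> f u \<gamma>"
  shows "P_feasible \<Omega> \<Sigma> \<Theta> H\<Theta> Ob \<alpha> \<T> f (decomposition \<Omega> \<Sigma> \<Theta> H\<Sigma> H\<Theta> u) \<gamma>"
    and "\<exists>!ut. is_decomposition \<Omega> \<Sigma> \<Theta> H\<Sigma> H\<Theta> u ut"
proof -
  have M: "\<gamma> \<in> nonneg_measures (\<Theta> \<times> \<Gamma>)" "u \<in> nonneg_measures (\<Omega> \<times> \<Sigma>)"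
    "Mv_bar \<Omega> \<Sigma> \<Theta> H\<Sigma> \<gamma> = Rd_bar \<Omega> \<Sigma> \<Theta> H\<Theta> u"
    "data_constraint \<alpha> \<T> f (Ob_bar \<Omega> \<Sigma> \<Theta> H\<Sigma> H\<Theta> Ob u)"
    using assms by (auto simp: MP_feasible_def)
  obtain ut where ut: "is_decomposition \<Omega> \<Sigma> \<Theta> H\<Sigma> H\<Theta> u ut"
    "\<And>t. t \<in> \<Sigma> \<Longrightarrow> Mv_dir \<Omega> \<Sigma> \<Theta> t \<gamma> = Rd \<Omega> \<Theta> H\<Theta> (ut t)"
    using ex_decomposition[OF M(1-3)] by blast
  show "\<exists>!ut. is_decomposition \<Omega> \<Sigma> \<Theta> H\<Sigma> H\<Theta> u ut"
    using ut(1) is_decomposition_unique[OF M(2)] by blast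
  have "ut \<in> \<Sigma> \<rightarrow>\<^sub>E nonneg_measures \<Omega>" using ut(1) by (simp add: is_decomposition_def)
  then show "P_feasible \<Omega> \<Sigma> \<Theta> H\<Theta> Ob \<alpha> \<T> f (decomposition \<Omega> \<Sigma> \<Theta> H\<Sigma> H\<Theta> u) \<gamma>"
    using M(1,4) ut(2) by (simp add: P_feasible_def Ob_bar_def[abs_def] decomposition_eq[OF M(2) ut(1)])
qed

end

theorem proposition85:
  fixes \<Omega> \<Theta> :: "(real^'n) set" and \<Sigma> \<T> :: "real set"
    and H\<Sigma> :: "real measure" and H\<Theta> :: "(real^'n) measure"
    and Ob :: "real \<Rightarrow> ((real^'n) set \<Rightarrow> real) \<Rightarrow> 'h::{real_inner, complete_space}"
    and ObS :: "real \<Rightarrow> 'h \<Rightarrow> (real^'n) \<Rightarrow> real"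
    and f :: "real \<Rightarrow> 'h" and \<alpha> :: real
  assumes "compact \<Omega>" "compact \<Sigma>" "compact \<Theta>" "\<Theta> \<subseteq> sphere 0 1"
    and "finite \<T>" "\<T> \<noteq> {}" "\<T> \<subseteq> \<Sigma>"
    and "prob_space H\<Sigma>" "sets H\<Sigma> = sets (borel_on \<Sigma>)" "msupport H\<Sigma> = \<Sigma>"
    and "prob_space H\<Theta>" "sets H\<Theta> = sets (borel_on \<Theta>)" "msupport H\<Theta> = \<Theta>"
    and "\<And>t. t \<in> \<T> \<Longrightarrow> bounded_linear_to_C \<Omega> (ObS t)"
    and "\<And>t. t \<in> \<T> \<Longrightarrow> is_dual_operator \<Omega> (Ob t) (ObS t)"
    and "inj_on (Rd \<Omega> \<Theta> H\<Theta>) (signed_measures \<Omega>)"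
    and "0 \<le> \<alpha>"
  shows "(\<forall>ut \<gamma>. P_solves \<Omega> \<Sigma> \<Theta> H\<Theta> Ob \<alpha> \<T> f ut \<gamma> \<longrightarrow>
            is_kernel \<Omega> ut H\<Sigma> \<and>
            prod_left \<Omega> ut H\<Sigma> \<in> nonneg_measures (\<Omega> \<times> \<Sigma>) \<and>
            MP_solves \<Omega> \<Sigma> \<Theta> H\<Sigma> H\<Theta> Ob \<alpha> \<T> f (prod_left \<Omega> ut H\<Sigma>) \<gamma>)
       \<and> (\<forall>u \<gamma>. MP_solves \<Omega> \<Sigma> \<Theta> H\<Sigma> H\<Theta> Ob \<alpha> \<T> f u \<gamma> \<longrightarrow>
            (\<exists>!ut. is_decomposition \<Omega> \<Sigma> \<Theta> H\<Sigma> H\<Theta> u ut) \<and>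
            P_solves \<Omega> \<Sigma> \<Theta> H\<Theta> Ob \<alpha> \<T> f (decomposition \<Omega> \<Sigma> \<Theta> H\<Sigma> H\<Theta> u) \<gamma>)"
proof -
  interpret radon_setting \<Omega> \<Theta> \<Sigma> H\<Sigma> H\<Theta>
    using assms by (intro radon_setting.intro)
  note to_MP = P_feasible_imp_MP_feasible[where Ob=Ob and \<alpha>=\<alpha> and \<T>=\<T> and f=f]
  note to_P = MP_feasible_imp_P_feasible[where Ob=Ob and \<alpha>=\<alpha> and \<T>=\<T> and f=f]
  have Ob_bar: "Ob_bar \<Omega> \<Sigma> \<Theta> H\<Sigma> H\<Theta> Ob u = (\<lambda>t. Ob t (decomposition \<Omega> \<Sigma> \<Theta> H\<Sigma> H\<Theta> u t))" for u
    by (simp add: Ob_bar_def[abs_def])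
  have "is_kernel \<Omega> ut H\<Sigma> \<and> prod_left \<Omega> ut H\<Sigma> \<in> nonneg_measures (\<Omega> \<times> \<Sigma>) \<and>
      MP_solves \<Omega> \<Sigma> \<Theta> H\<Sigma> H\<Theta> Ob \<alpha> \<T> f (prod_left \<Omega> ut H\<Sigma>) \<gamma>"
    if sol: "P_solves \<Omega> \<Sigma> \<Theta> H\<Theta> Ob \<alpha> \<T> f ut \<gamma>" for ut \<gamma>
  proof -
    have feas: "P_feasible \<Omega> \<Sigma> \<Theta> H\<Theta> Ob \<alpha> \<T> f ut \<gamma>"
      using sol by (simp add: P_solves_def)
    \<comment> \<open>The competitor \<open>u'\<close> is replaced by its decomposition, which is
      feasible for the other problem with the same \<open>\<gamma>'\<close> and the same
      observations, hence with the same objective value.\<close>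
    have "objective \<Omega> \<Sigma> \<Theta> \<alpha> \<T> f (Ob_bar \<Omega> \<Sigma> \<Theta> H\<Sigma> H\<Theta> Ob (prod_left \<Omega> ut H\<Sigma>)) \<gamma>
        \<le> objective \<Omega> \<Sigma> \<Theta> \<alpha> \<T> f (Ob_bar \<Omega> \<Sigma> \<Theta> H\<Sigma> H\<Theta> Ob u') \<gamma>'"
      if "MP_feasible \<Omega> \<Sigma> \<Theta> H\<Sigma> H\<Theta> Ob \<alpha> \<T> f u' \<gamma>'" for u' \<gamma>'
      unfolding to_MP(3)[OF feas] Ob_bar[of u']
      using sol to_P(1)[OF that] by (simp add: P_solves_def)
    then have "MP_solves \<Omega> \<Sigma> \<Theta> H\<Sigma> H\<Theta> Ob \<alpha> \<T> f (prod_left \<Omega> ut H\<Sigma>) \<gamma>"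
      using to_MP(1)[OF feas] by (simp add: MP_solves_def)
    then show ?thesis
      using to_MP(2)[OF feas] by (simp add: is_decomposition_def MP_solves_def MP_feasible_def)
  qed
  moreover have "(\<exists>!ut. is_decomposition \<Omega> \<Sigma> \<Theta> H\<Sigma> H\<Theta> u ut) \<and>
      P_solves \<Omega> \<Sigma> \<Theta> H\<Theta> Ob \<alpha> \<T> f (decomposition \<Omega> \<Sigma> \<Theta> H\<Sigma> H\<Theta> u) \<gamma>"
    if sol: "MP_solves \<Omega> \<Sigma> \<Theta> H\<Sigma> H\<Theta> Ob \<alpha> \<T> f u \<gamma>" for u \<gamma>
  proof -
    have feas: "MP_feasible \<Omega> \<Sigma> \<Theta> H\<Sigma> H\<Theta> Ob \<alpha> \<T> f u \<gamma>"
      using sol by (simp add: MP_solves_def)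
    \<comment> \<open>Conversely, a competing family is replaced by its product with
      \<open>H\<Sigma>\<close>, again with unchanged objective value.\<close>
    have "objective \<Omega> \<Sigma> \<Theta> \<alpha> \<T> f (\<lambda>t. Ob t (decomposition \<Omega> \<Sigma> \<Theta> H\<Sigma> H\<Theta> u t)) \<gamma>
        \<le> objective \<Omega> \<Sigma> \<Theta> \<alpha> \<T> f (\<lambda>t. Ob t (ut' t)) \<gamma>'"
      if "P_feasible \<Omega> \<Sigma> \<Theta> H\<Theta> Ob \<alpha> \<T> f ut' \<gamma>'" for ut' \<gamma>'
      unfolding to_MP(3)[OF that, symmetric] Ob_bar[of u, symmetric]
      using sol to_MP(1)[OF that] by (simp add: MP_solves_def)
    then show ?thesis
      using to_P[OF feas] by (simp add: P_solves_def)
  qed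
  ultimately show ?thesis by blast
qed

end
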